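(* Let $n\ge 1$, $d\ge 0$, and let $M,N$ be arbitrary $\mathfrak q(n)$-modules. There is a well-defined action of the superalgebra $\mathcal H_d$ on $M\otimes N\otimes V^{\otimes d}$ in which - $s_i$ ($1\le i\le d-1$) acts by the signed permutation of the $i$-th and $(i+1)$-st copies of $V$: $v_i\otimes v_{i+1}\mapsto (-1)^{\overline{v_i}\,\overline{v_{i+1}}}v_{i+1}\otimes v_i$; - $c_i$ ($1\le i\le d$) acts by the odd map $C$ on the $i$-th copy of $V$ (and the identity on all other factors, with the sign rule); - $\tilde x_1$ acts as $\Omega_{M,1}$; - $\tilde z_0$ acts as $\Omega_{M,N}$; - $\tilde z_i$ ($1\le i\le d$) acts as $\Omega_{M,i}+\Omega_{N,i}+\Omega_{1,i}+\cdots+\Omega_{i-1,i}$. Moreover this action supercommutes with the action of $\mathfrak q(n)$, so that it induces a homomorphism of superalgebras $\mathcal H_d\to \operatorname{End}_{\mathfrak q(n)}(M\otimes N\otimes V^{\otimes d})$.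
   Context: All vector spaces are over $\mathbb C$ and $\mathbb Z_2$-graded; $\overline{x}$ denotes the parity of a homogeneous element; formulas for homogeneous elements are extended linearly. "Module" means supermodule. $\mathfrak q(n)$ is the Lie superalgebra of $2n\times 2n$ complex matrices $\begin{bmatrix} A & B \\ B & A \end{bmatrix}$, with even part $B=0$, odd part $A=0$, and bracket $[x,y]=xy-(-1)^{\overline x\,\overline y}yx$. With $E_{ij}$ the $n\times n$ matrix units, $e_{ij}=\begin{bmatrix} E_{ij} & 0 \\ 0 & E_{ij} \end{bmatrix}$, $f_{ij}=\begin{bmatrix} 0 & E_{ij} \\ E_{ij} & 0 \end{bmatrix}$. $V=\mathbb C^{2n}$ is the natural module (column vectors; the first $n$ standard basis vectors are even, the last $n$ odd). $C\in\operatorname{End}(V)$ is left multiplication by $\begin{bmatrix} 0 & -I_n \\ I_n & 0 \end{bmatrix}$ (odd). On tensor products $x.(v\otimes w)=(x.v)\otimes w+(-1)^{\overline x\,\overline v}v\otimes (x.w)$. Sign rule: $a_1\otimes\cdots\otimes a_k$ (homogeneous $a_i$) acts on $w_1\otimes\cdots\otimes w_k$ by $(-1)^{\sum_{i>j}\overline{a_i}\,\overline{w_j}}\,a_1w_1\otimes\cdots\otimes a_kw_k$. A homogeneous linear map $g:W\to U$ of $\mathfrak q(n)$-modules supercommutes with $\mathfrak q(n)$ if $g(x.w)=(-1)^{\overline x\,\overline g}x.g(w)$ for all homogeneous $x\in\mathfrak q(n)$, $w\in W$; $\operatorname{End}_{\mathfrak q(n)}(W)$ is the span of all homogeneous endomorphisms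 of $W$ that supercommute with $\mathfrak q(n)$. $\Omega=\sum_{1\le i,j\le n}e_{ij}\otimes f_{ji}-\sum_{1\le i,j\le n}f_{ij}\otimes e_{ji}\in\mathfrak q(n)\otimes\mathfrak q(n)$. On $M\otimes N\otimes V^{\otimes d}$, for two of the tensor factors $A,B$ with $A$ to the left of $B$ (each of $A,B$ is $M$, $N$, or an integer $k$ denoting the $k$-th copy of $V$), $\Omega_{A,B}$ applies the first leg of $\Omega$ to $A$, the second leg to $B$, and the identity elsewhere, with the sign rule. $\mathcal H_d$ is the unital associative superalgebra generated by even $s_1,\dots,s_{d-1}$, odd $c_1,\dots,c_d$, and odd $\tilde x_1,\tilde z_0,\dots,\tilde z_d$, subject to the following relations (a relation involving a generator that does not exist is omitted; for $d=0$ the only generator is $\tilde z_0$): $c_i^2=-1$, $c_ic_j=-c_jc_i$ ($i\ne j$); $s_i^2=1$, $s_is_j=s_js_i$ ($|i-j|>1$), $s_is_{i+1}s_i=s_{i+1}s_is_{i+1}$; $s_ic_j=c_js_i$ ($j\ne i,i+1$), $s_ic_i=c_{i+1}s_i$, $s_ic_{i+1}=c_is_i$; $s_i\tilde z_i=\tilde z_{i+1}s_i+c_i-c_{i+1}$ ($1\le i\le d-1$); $\tilde x_1s_i=s_i\tilde x_1$ ($2\le i\le d-1$); $\tilde z_js_i=s_i\tilde z_j$ ($0\le j\le d$, $j\ne i,i+1$); $c_i\tilde x_1=-\tilde x_1c_i$ ($1\le i\le d$); $c_i\tilde z_j=-\tilde z_jc_i$ ($1\le i\le d$, $0\le j\le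 d$); $\tilde x_1\big(s_1\tilde x_1s_1-(c_1-c_2)s_1\big)=-\big(s_1\tilde x_1s_1-(c_1-c_2)s_1\big)\tilde x_1$; $\tilde z_1\tilde z_2=-\tilde z_2\tilde z_1$; $\tilde z_0\tilde z_1=-\tilde z_1\tilde z_0$; $\tilde z_2\tilde x_1=-\tilde x_1\tilde z_2$; $(\tilde z_0-\tilde z_1+\tilde x_1)\tilde x_1=-\tilde x_1(\tilde z_0-\tilde z_1+\tilde x_1)$. *)

theory Defs
  imports
    "HOL-Analysis.Finite_Cartesian_Product"
    "HOL-Algebra.QuotRing"
    "HOL-Algebra.Module"
    "HOL-Library.Z2"
    "HOL-Library.Poly_Mapping"
begin

section \<open>Super vector spaces and superalgebras\<close>

text \<open>
  Parities are elements of the two-element field \<^typ>\<open>bit\<close>; \<open>psign r\<close> is $(-1)^r$.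
\<close>

definition psign :: "bit \<Rightarrow> complex" where
  "psign r = (if r = 1 then - 1 else 1)"

definition complex_ring :: "complex ring" where
  "complex_ring = \<lparr>carrier = UNIV, monoid.mult = (*), one = 1, zero = 0, add = (+)\<rparr>"

text \<open>
  The record \<^type>\<open>module\<close> has the fields of both a module and an algebra, so the following
  record carries super vector spaces (\<open>mult\<close> and \<open>one\<close> are then irrelevant) as well as
  superalgebras.
\<close>

record 'a superspace = "(complex, 'a) module" +
  homog :: "bit \<Rightarrow> 'a set"

definition super_space :: "('a, 'b) superspace_scheme \<Rightarrow> bool" where
  "super_space W \<longleftrightarrow>
     Module.module complex_ring W \<and>
     (\<forall>p. submodule (homog W p) complex_ring W) \<and>
     carrier W = set_add W (homog W 0) (homog W 1) \<and>
     homog W 0 \<inter> homog W 1 = {\<zero>\<^bsub>W\<^esub>}"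

definition lin_span :: "(complex, 'a, 'b) module_scheme \<Rightarrow> 'a set \<Rightarrow> 'a set" where
  "lin_span W X = \<Inter>{H. submodule H complex_ring W \<and> X \<subseteq> H}"

definition superalg_hom ::
    "('a, 'c) superspace_scheme \<Rightarrow> ('b, 'e) superspace_scheme \<Rightarrow> ('a \<Rightarrow> 'b) \<Rightarrow> bool" where
  "superalg_hom A B \<phi> \<longleftrightarrow>
     \<phi> \<in> ring_hom A B \<and>
     (\<forall>c. \<forall>a\<in>carrier A. \<phi> (c \<odot>\<^bsub>A\<^esub> a) = c \<odot>\<^bsub>B\<^esub> \<phi> a) \<and>
     (\<forall>p. \<phi> ` homog A p \<subseteq> homog B p)"

definition linear_maps ::
    "(complex, 'a, 'c) module_scheme \<Rightarrow> (complex, 'b, 'e) module_scheme \<Rightarrow> ('a \<Rightarrow> 'b) set" where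
  "linear_maps U W = {g \<in> carrier U \<rightarrow>\<^sub>E carrier W.
     (\<forall>x\<in>carrier U. \<forall>y\<in>carrier U. g (x \<oplus>\<^bsub>U\<^esub> y) = g x \<oplus>\<^bsub>W\<^esub> g y) \<and>
     (\<forall>c. \<forall>x\<in>carrier U. g (c \<odot>\<^bsub>U\<^esub> x) = c \<odot>\<^bsub>W\<^esub> g x)}"

definition End_super :: "('a, 'b) superspace_scheme \<Rightarrow> ('a \<Rightarrow> 'a) superspace" where
  "End_super W =
     \<lparr>carrier = linear_maps W W,
      monoid.mult = compose (carrier W),
      one = (\<lambda>x\<in>carrier W. x),
      zero = (\<lambda>x\<in>carrier W. \<zero>\<^bsub>W\<^esub>),
      add = (\<lambda>f g. \<lambda>x\<in>carrier W. f x \<oplus>\<^bsub>W\<^esub> g x),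
      smult = (\<lambda>c f. \<lambda>x\<in>carrier W. c \<odot>\<^bsub>W\<^esub> f x),
      homog = (\<lambda>p. {f \<in> linear_maps W W. \<forall>q. f ` homog W q \<subseteq> homog W (p + q)})\<rparr>"

text \<open>
  Quotient of a module (or algebra) by a submodule (or two-sided ideal): the carrier is the set of
  additive cosets, with the quotient ring structure of the library and the induced scalar
  multiplication.
\<close>

definition quot_module :: "(complex, 'a, 'b) module_scheme \<Rightarrow> 'a set \<Rightarrow> (complex, 'a set) module" where
  "quot_module A I =
     ring.extend (A Quot I)
       (module.fields (\<lambda>c X. \<Union>x\<in>X. I +>\<^bsub>A\<^esub> (c \<odot>\<^bsub>A\<^esub> x)))"


section \<open>The Lie superalgebra q(n) and its modules\<close>

text \<open>
  The number $n \ge 1$ is the cardinality of the finite type \<open>'k\<close>; the index type \<open>'k + 'k\<close>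
  numbers the $2n$ rows and columns, \<open>Inl\<close> being the first block and \<open>Inr\<close> the second one.
\<close>

type_synonym 'k vec2 = "complex ^ ('k + 'k)"
type_synonym 'k mat2 = "complex ^ ('k + 'k) ^ ('k + 'k)"

definition block ::
    "complex ^ 'k ^ 'k \<Rightarrow> complex ^ 'k ^ 'k \<Rightarrow> complex ^ 'k ^ 'k \<Rightarrow> complex ^ 'k ^ 'k \<Rightarrow>
     ('k::finite) mat2" where
  "block A B C D = (\<chi> r c.
     case r of
       Inl i \<Rightarrow> (case c of Inl j \<Rightarrow> A $ i $ j | Inr j \<Rightarrow> B $ i $ j)
     | Inr i \<Rightarrow> (case c of Inl j \<Rightarrow> C $ i $ j | Inr j \<Rightarrow> D $ i $ j))"

definition qmat :: "complex ^ 'k ^ 'k \<Rightarrow> complex ^ 'k ^ 'k \<Rightarrow> ('k::finite) mat2" where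
  "qmat A B = block A B B A"

definition qn :: "('k::finite) mat2 set" where
  "qn = {qmat A B | A B. True}"

definition qn_homog :: "bit \<Rightarrow> ('k::finite) mat2 set" where
  "qn_homog p = (if p = 0 then {qmat A 0 | A. True} else {qmat 0 B | B. True})"

definition qn_part :: "bit \<Rightarrow> ('k::finite) mat2 \<Rightarrow> 'k mat2" where
  "qn_part p x =
     (if p = 0 then qmat (\<chi> i j. x $ Inl i $ Inl j) 0
      else qmat 0 (\<chi> i j. x $ Inl i $ Inr j))"

text \<open>The bracket of an element of parity \<open>p\<close> with an element of parity \<open>q\<close>.\<close>

definition qn_bracket :: "bit \<Rightarrow> bit \<Rightarrow> 'k mat2 \<Rightarrow> 'k mat2 \<Rightarrow> ('k::finite) mat2" where
  "qn_bracket p q x y = x ** y - (\<chi> i j. psign (p * q) * (y ** x) $ i $ j)"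

definition matrix_unit :: "'k \<Rightarrow> 'k \<Rightarrow> complex ^ 'k ^ ('k::finite)" where
  "matrix_unit i j = (\<chi> a b. if a = i \<and> b = j then 1 else 0)"

definition e_unit :: "'k \<Rightarrow> 'k \<Rightarrow> ('k::finite) mat2" where
  "e_unit i j = qmat (matrix_unit i j) 0"

definition f_unit :: "'k \<Rightarrow> 'k \<Rightarrow> ('k::finite) mat2" where
  "f_unit i j = qmat 0 (matrix_unit i j)"

definition Cmat :: "('k::finite) mat2" where
  "Cmat = block 0 (- mat 1) (mat 1) 0"

record ('x, 'a) qmodule = "'a superspace" +
  act :: "'x \<Rightarrow> 'a \<Rightarrow> 'a"

definition q_module :: "(('k::finite) mat2, 'a, 'b) qmodule_scheme \<Rightarrow> bool" where
  "q_module M \<longleftrightarrow>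
     super_space M \<and>
     (\<forall>x\<in>qn. act M x \<in> carrier M \<rightarrow> carrier M) \<and>
     (\<forall>x\<in>qn. \<forall>m\<in>carrier M. \<forall>m'\<in>carrier M.
        act M x (m \<oplus>\<^bsub>M\<^esub> m') = act M x m \<oplus>\<^bsub>M\<^esub> act M x m') \<and>
     (\<forall>x\<in>qn. \<forall>c. \<forall>m\<in>carrier M. act M x (c \<odot>\<^bsub>M\<^esub> m) = c \<odot>\<^bsub>M\<^esub> act M x m) \<and>
     (\<forall>x\<in>qn. \<forall>y\<in>qn. \<forall>m\<in>carrier M. act M (x + y) m = act M x m \<oplus>\<^bsub>M\<^esub> act M y m) \<and>
     (\<forall>x\<in>qn. \<forall>c. \<forall>m\<in>carrier M.
        act M (\<chi> i j. c * x $ i $ j) m = c \<odot>\<^bsub>M\<^esub> act M x m) \<and>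
     (\<forall>p q. \<forall>x\<in>qn_homog p. act M x ` homog M q \<subseteq> homog M (p + q)) \<and>
     (\<forall>p q. \<forall>x\<in>qn_homog p. \<forall>y\<in>qn_homog q. \<forall>m\<in>carrier M.
        act M (qn_bracket p q x y) m =
          act M x (act M y m) \<ominus>\<^bsub>M\<^esub> psign (p * q) \<odot>\<^bsub>M\<^esub> act M y (act M x m))"

definition natural_module :: "(('k::finite) mat2, 'k vec2) qmodule" where
  "natural_module =
     \<lparr>carrier = UNIV, monoid.mult = undefined, one = undefined, zero = 0, add = (+),
      smult = (*s),
      homog = (\<lambda>p. if p = 0 then {v. \<forall>i. v $ Inr i = 0} else {v. \<forall>i. v $ Inl i = 0}),
      act = (*v)\<rparr>"

definition supercommutes ::
    "(('k::finite) mat2, 'a, 'b) qmodule_scheme \<Rightarrow> bit \<Rightarrow> ('a \<Rightarrow> 'a) \<Rightarrow> bool" where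
  "supercommutes W p g \<longleftrightarrow>
     (\<forall>q r. \<forall>x\<in>qn_homog q. \<forall>w\<in>homog W r.
        g (act W x w) = psign (q * p) \<odot>\<^bsub>W\<^esub> act W x (g w))"

definition End_q :: "(('k::finite) mat2, 'a, 'b) qmodule_scheme \<Rightarrow> ('a \<Rightarrow> 'a) superspace" where
  "End_q W =
     (let E = End_super W;
          S = lin_span E {g. \<exists>p. g \<in> homog E p \<and> supercommutes W p g}
      in E\<lparr>carrier := S, homog := (\<lambda>p. homog E p \<inter> S)\<rparr>)"


section \<open>The tensor product of M, N and d copies of V\<close>

text \<open>
  The tensor product is the quotient of the free vector space on the tuples $(m, n, (v_1,\dots,v_d))$
  by the multilinearity relations; the entry \<open>vs ! k\<close> belongs to the $(k+1)$-st copy of $V$.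
\<close>

definition tuples ::
    "('k mat2, 'm) qmodule \<Rightarrow> ('k mat2, 'n) qmodule \<Rightarrow> nat \<Rightarrow>
     ('m \<times> 'n \<times> ('k::finite) vec2 list) set" where
  "tuples M N d = {(m, n, vs). m \<in> carrier M \<and> n \<in> carrier N \<and> length vs = d}"

definition free_space ::
    "('k mat2, 'm) qmodule \<Rightarrow> ('k mat2, 'n) qmodule \<Rightarrow> nat \<Rightarrow>
     (complex, ('m \<times> 'n \<times> ('k::finite) vec2 list) \<Rightarrow>\<^sub>0 complex) module" where
  "free_space M N d =
     \<lparr>carrier = {u. Poly_Mapping.keys u \<subseteq> tuples M N d},
      monoid.mult = undefined, one = undefined, zero = 0, add = (+),
      smult = (\<lambda>c. Poly_Mapping.map ((*) c))\<rparr>"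

abbreviation point :: "'a \<Rightarrow> 'a \<Rightarrow>\<^sub>0 complex" where
  "point w \<equiv> Poly_Mapping.single w 1"

inductive_set multilin_relators ::
    "('k mat2, 'm) qmodule \<Rightarrow> ('k mat2, 'n) qmodule \<Rightarrow> nat \<Rightarrow>
     (('m \<times> 'n \<times> ('k::finite) vec2 list) \<Rightarrow>\<^sub>0 complex) set"
  for M N d where
  M_add: "\<lbrakk>(m, n, vs) \<in> tuples M N d; m' \<in> carrier M\<rbrakk> \<Longrightarrow>
     point (m \<oplus>\<^bsub>M\<^esub> m', n, vs) - point (m, n, vs) - point (m', n, vs)
       \<in> multilin_relators M N d"
| M_smult: "(m, n, vs) \<in> tuples M N d \<Longrightarrow>
     point (c \<odot>\<^bsub>M\<^esub> m, n, vs) - Poly_Mapping.single (m, n, vs) c \<in> multilin_relators M N d"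
| N_add: "\<lbrakk>(m, n, vs) \<in> tuples M N d; n' \<in> carrier N\<rbrakk> \<Longrightarrow>
     point (m, n \<oplus>\<^bsub>N\<^esub> n', vs) - point (m, n, vs) - point (m, n', vs)
       \<in> multilin_relators M N d"
| N_smult: "(m, n, vs) \<in> tuples M N d \<Longrightarrow>
     point (m, c \<odot>\<^bsub>N\<^esub> n, vs) - Poly_Mapping.single (m, n, vs) c \<in> multilin_relators M N d"
| V_add: "\<lbrakk>(m, n, vs) \<in> tuples M N d; k < d\<rbrakk> \<Longrightarrow>
     point (m, n, vs[k := v + v']) - point (m, n, vs[k := v]) - point (m, n, vs[k := v'])
       \<in> multilin_relators M N d"
| V_smult: "\<lbrakk>(m, n, vs) \<in> tuples M N d; k < d\<rbrakk> \<Longrightarrow>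
     point (m, n, vs[k := c *s v]) - Poly_Mapping.single (m, n, vs[k := v]) c
       \<in> multilin_relators M N d"

definition tensor_relations ::
    "('k mat2, 'm) qmodule \<Rightarrow> ('k mat2, 'n) qmodule \<Rightarrow> nat \<Rightarrow>
     (('m \<times> 'n \<times> ('k::finite) vec2 list) \<Rightarrow>\<^sub>0 complex) set" where
  "tensor_relations M N d = lin_span (free_space M N d) (multilin_relators M N d)"

type_synonym ('k, 'm, 'n) tens = "(('m \<times> 'n \<times> 'k vec2 list) \<Rightarrow>\<^sub>0 complex) set"

text \<open>\<open>pure M N d (m, n, [v1, ..., vd])\<close> is $m \otimes n \otimes v_1 \otimes \cdots \otimes v_d$.\<close>

definition pure ::
    "('k mat2, 'm) qmodule \<Rightarrow> ('k mat2, 'n) qmodule \<Rightarrow> nat \<Rightarrow>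
     'm \<times> 'n \<times> 'k vec2 list \<Rightarrow> ('k::finite, 'm, 'n) tens" where
  "pure M N d w = tensor_relations M N d +>\<^bsub>free_space M N d\<^esub> point w"

text \<open>
  A tuple with homogeneous entries, together with the list \<open>ps\<close> of the parities of its $d + 2$
  entries (from left to right).
\<close>

fun homog_tuple ::
    "('k mat2, 'm) qmodule \<Rightarrow> ('k mat2, 'n) qmodule \<Rightarrow> nat \<Rightarrow> bit list \<Rightarrow>
     'm \<times> 'n \<times> ('k::finite) vec2 list \<Rightarrow> bool" where
  "homog_tuple M N d ps (m, n, vs) \<longleftrightarrow>
     (\<exists>p q rs. ps = p # q # rs \<and> m \<in> homog M p \<and> n \<in> homog N q \<and> length vs = d \<and>
        list_all2 (\<lambda>v r. v \<in> homog natural_module r) vs rs)"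

definition tensor_space ::
    "('k mat2, 'm) qmodule \<Rightarrow> ('k mat2, 'n) qmodule \<Rightarrow> nat \<Rightarrow>
     ('k::finite, 'm, 'n) tens superspace" where
  "tensor_space M N d =
     (let T = quot_module (free_space M N d) (tensor_relations M N d)
      in module.extend T (superspace.fields
           (\<lambda>p. lin_span T {pure M N d w | w ps. homog_tuple M N d ps w \<and> sum_list ps = p})))"

text \<open>
  \<open>F ps w\<close> prescribes the value on the pure tensor of a homogeneous tuple \<open>w\<close> with parities \<open>ps\<close>;
  \<open>lin_ext M N d F\<close> is its linear extension to the whole tensor product.  It is unique because
  these tensors span; it exists for the prescriptions used below because they are multilinear.
\<close>

definition lin_ext ::
    "('k mat2, 'm) qmodule \<Rightarrow> ('k mat2, 'n) qmodule \<Rightarrow> nat \<Rightarrow>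
     (bit list \<Rightarrow> 'm \<times> 'n \<times> 'k vec2 list \<Rightarrow> ('k, 'm, 'n) tens) \<Rightarrow>
     ('k::finite, 'm, 'n) tens \<Rightarrow> ('k, 'm, 'n) tens" where
  "lin_ext M N d F =
     (THE g. g \<in> linear_maps (tensor_space M N d) (tensor_space M N d) \<and>
        (\<forall>ps w. homog_tuple M N d ps w \<longrightarrow> g (pure M N d w) = F ps w))"

datatype factor = FactorM | FactorN | FactorV nat

fun position :: "factor \<Rightarrow> nat" where
  "position FactorM = 0"
| "position FactorN = 1"
| "position (FactorV k) = k + 1"

definition factors :: "nat \<Rightarrow> factor set" where
  "factors d = {FactorM, FactorN} \<union> FactorV ` {1..d}"

text \<open>
  Sign rule: for operators of parities \<open>as\<close> applied to entries of parities \<open>ps\<close>, the sign is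
  $(-1)^{\sum_{i > j} a_i p_j}$.
\<close>

definition koszul :: "bit list \<Rightarrow> bit list \<Rightarrow> complex" where
  "koszul as ps = psign (\<Sum>i<length ps. \<Sum>j<i. as ! i * ps ! j)"

text \<open>\<open>f\<close> applies operators of parities \<open>as\<close> to the entries of a tuple.\<close>

definition signed_op ::
    "('k mat2, 'm) qmodule \<Rightarrow> ('k mat2, 'n) qmodule \<Rightarrow> nat \<Rightarrow> bit list \<Rightarrow>
     ('m \<times> 'n \<times> 'k vec2 list \<Rightarrow> 'm \<times> 'n \<times> 'k vec2 list) \<Rightarrow>
     bit list \<Rightarrow> 'm \<times> 'n \<times> 'k vec2 list \<Rightarrow> ('k::finite, 'm, 'n) tens" where
  "signed_op M N d as f ps w = koszul as ps \<odot>\<^bsub>tensor_space M N d\<^esub> pure M N d (f w)"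

fun act_at ::
    "('k mat2, 'm) qmodule \<Rightarrow> ('k mat2, 'n) qmodule \<Rightarrow> factor \<Rightarrow> 'k mat2 \<Rightarrow>
     'm \<times> 'n \<times> ('k::finite) vec2 list \<Rightarrow> 'm \<times> 'n \<times> 'k vec2 list" where
  "act_at M N FactorM x (m, n, vs) = (act M x m, n, vs)"
| "act_at M N FactorN x (m, n, vs) = (m, act N x n, vs)"
| "act_at M N (FactorV k) x (m, n, vs) = (m, n, vs[k - 1 := act natural_module x (vs ! (k - 1))])"

text \<open>
  The iterated coproduct: a homogeneous \<open>x\<close> of parity \<open>p\<close> acts by the sum over all factors, with the
  sign from moving \<open>x\<close> past the entries to the left of the factor.
\<close>

definition tensor_act ::
    "('k mat2, 'm) qmodule \<Rightarrow> ('k mat2, 'n) qmodule \<Rightarrow> nat \<Rightarrow> bit \<Rightarrow> 'k mat2 \<Rightarrow>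
     ('k::finite, 'm, 'n) tens \<Rightarrow> ('k, 'm, 'n) tens" where
  "tensor_act M N d p x = lin_ext M N d (\<lambda>ps w.
     \<Oplus>\<^bsub>tensor_space M N d\<^esub>A\<in>factors d.
       signed_op M N d ((replicate (d + 2) 0)[position A := p]) (act_at M N A x) ps w)"

definition tensor_module ::
    "('k mat2, 'm) qmodule \<Rightarrow> ('k mat2, 'n) qmodule \<Rightarrow> nat \<Rightarrow>
     ('k mat2, ('k::finite, 'm, 'n) tens) qmodule" where
  "tensor_module M N d = superspace.extend (tensor_space M N d) (qmodule.fields
     (\<lambda>x w. tensor_act M N d 0 (qn_part 0 x) w \<oplus>\<^bsub>tensor_space M N d\<^esub>
            tensor_act M N d 1 (qn_part 1 x) w))"


section \<open>The operators on the tensor product\<close>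

definition swap_op ::
    "('k mat2, 'm) qmodule \<Rightarrow> ('k mat2, 'n) qmodule \<Rightarrow> nat \<Rightarrow> nat \<Rightarrow>
     ('k::finite, 'm, 'n) tens \<Rightarrow> ('k, 'm, 'n) tens" where
  "swap_op M N d i = lin_ext M N d (\<lambda>ps (m, n, vs).
     psign (ps ! position (FactorV i) * ps ! position (FactorV (i + 1)))
       \<odot>\<^bsub>tensor_space M N d\<^esub> pure M N d (m, n, vs[i - 1 := vs ! i, i := vs ! (i - 1)]))"

definition C_op ::
    "('k mat2, 'm) qmodule \<Rightarrow> ('k mat2, 'n) qmodule \<Rightarrow> nat \<Rightarrow> nat \<Rightarrow>
     ('k::finite, 'm, 'n) tens \<Rightarrow> ('k, 'm, 'n) tens" where
  "C_op M N d i = lin_ext M N d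
     (signed_op M N d ((replicate (d + 2) 0)[position (FactorV i) := 1])
        (\<lambda>(m, n, vs). (m, n, vs[i - 1 := Cmat *v (vs ! (i - 1))])))"

text \<open>\<open>Omega_op M N d A B\<close> is $\Omega_{A,B}$, for a factor \<open>A\<close> to the left of the factor \<open>B\<close>.\<close>

definition Omega_op ::
    "('k mat2, 'm) qmodule \<Rightarrow> ('k mat2, 'n) qmodule \<Rightarrow> nat \<Rightarrow> factor \<Rightarrow> factor \<Rightarrow>
     ('k::finite, 'm, 'n) tens \<Rightarrow> ('k, 'm, 'n) tens" where
  "Omega_op M N d A B = lin_ext M N d (\<lambda>ps w.
     (\<Oplus>\<^bsub>tensor_space M N d\<^esub>i\<in>UNIV. \<Oplus>\<^bsub>tensor_space M N d\<^esub>j\<in>UNIV.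
        signed_op M N d ((replicate (d + 2) 0)[position A := 0, position B := 1])
          (act_at M N A (e_unit i j) \<circ> act_at M N B (f_unit j i)) ps w)
     \<ominus>\<^bsub>tensor_space M N d\<^esub>
     (\<Oplus>\<^bsub>tensor_space M N d\<^esub>i\<in>UNIV. \<Oplus>\<^bsub>tensor_space M N d\<^esub>j\<in>UNIV.
        signed_op M N d ((replicate (d + 2) 0)[position A := 1, position B := 0])
          (act_at M N A (f_unit i j) \<circ> act_at M N B (e_unit j i)) ps w))"


section \<open>The superalgebra $\mathcal{H}_d$\<close>

text \<open>
  The free associative algebra is the monoid algebra of the free monoid of words, with the
  convolution product of \<^theory>\<open>HOL-Library.Poly_Mapping\<close>.
\<close>

datatype 'g word = Word (letters: "'g list")

instantiation word :: (type) monoid_add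
begin

definition zero_word :: "'a word" where
  "zero_word = Word []"

definition plus_word :: "'a word \<Rightarrow> 'a word \<Rightarrow> 'a word" where
  "plus_word u w = Word (letters u @ letters w)"

instance
  by standard (simp_all add: zero_word_def plus_word_def)

end

definition free_superalgebra :: "'g set \<Rightarrow> ('g \<Rightarrow> bit) \<Rightarrow> ('g word \<Rightarrow>\<^sub>0 complex) superspace" where
  "free_superalgebra G par =
     \<lparr>carrier = {u. \<forall>w\<in>Poly_Mapping.keys u. set (letters w) \<subseteq> G},
      monoid.mult = (*), one = 1, zero = 0, add = (+),
      smult = (\<lambda>c. Poly_Mapping.map ((*) c)),
      homog = (\<lambda>p. {u. \<forall>w\<in>Poly_Mapping.keys u.
                 set (letters w) \<subseteq> G \<and> sum_list (map par (letters w)) = p})\<rparr>"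

text \<open>\<open>GenS i\<close>, \<open>GenC i\<close>, \<open>GenX\<close>, \<open>GenZ i\<close> stand for $s_i$, $c_i$, $\tilde x_1$, $\tilde z_i$.\<close>

datatype hgen = GenS nat | GenC nat | GenX | GenZ nat

fun hgen_parity :: "hgen \<Rightarrow> bit" where
  "hgen_parity (GenS i) = 0"
| "hgen_parity (GenC i) = 1"
| "hgen_parity GenX = 1"
| "hgen_parity (GenZ i) = 1"

definition hgens :: "nat \<Rightarrow> hgen set" where
  "hgens d = GenS ` {1..<d} \<union> GenC ` {1..d} \<union> (if d = 0 then {} else {GenX}) \<union> GenZ ` {0..d}"

abbreviation sg :: "nat \<Rightarrow> hgen word \<Rightarrow>\<^sub>0 complex" where "sg i \<equiv> point (Word [GenS i])"
abbreviation cg :: "nat \<Rightarrow> hgen word \<Rightarrow>\<^sub>0 complex" where "cg i \<equiv> point (Word [GenC i])"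
abbreviation xg :: "hgen word \<Rightarrow>\<^sub>0 complex" where "xg \<equiv> point (Word [GenX])"
abbreviation zg :: "nat \<Rightarrow> hgen word \<Rightarrow>\<^sub>0 complex" where "zg i \<equiv> point (Word [GenZ i])"

text \<open>
  \<open>hrel d l r\<close> states that \<open>l = r\<close> is one of the defining relations; the side conditions make
  every generator in the relation belong to \<^term>\<open>hgens d\<close>.
\<close>

inductive hrel :: "nat \<Rightarrow> (hgen word \<Rightarrow>\<^sub>0 complex) \<Rightarrow> (hgen word \<Rightarrow>\<^sub>0 complex) \<Rightarrow> bool"
  for d where
  c_square: "i \<in> {1..d} \<Longrightarrow> hrel d (cg i * cg i) (- 1)"
| c_c: "\<lbrakk>i \<in> {1..d}; j \<in> {1..d}; i \<noteq> j\<rbrakk> \<Longrightarrow> hrel d (cg i * cg j) (- (cg j * cg i))"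
| s_square: "i \<in> {1..<d} \<Longrightarrow> hrel d (sg i * sg i) 1"
| s_s: "\<lbrakk>i \<in> {1..<d}; j \<in> {1..<d}; \<bar>int i - int j\<bar> > 1\<rbrakk> \<Longrightarrow> hrel d (sg i * sg j) (sg j * sg i)"
| braid: "\<lbrakk>i \<in> {1..<d}; i + 1 \<in> {1..<d}\<rbrakk> \<Longrightarrow>
    hrel d (sg i * sg (i + 1) * sg i) (sg (i + 1) * sg i * sg (i + 1))"
| s_c: "\<lbrakk>i \<in> {1..<d}; j \<in> {1..d}; j \<noteq> i; j \<noteq> i + 1\<rbrakk> \<Longrightarrow> hrel d (sg i * cg j) (cg j * sg i)"
| s_c_left: "i \<in> {1..<d} \<Longrightarrow> hrel d (sg i * cg i) (cg (i + 1) * sg i)"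
| s_c_right: "i \<in> {1..<d} \<Longrightarrow> hrel d (sg i * cg (i + 1)) (cg i * sg i)"
| s_z: "i \<in> {1..<d} \<Longrightarrow> hrel d (sg i * zg i) (zg (i + 1) * sg i + cg i - cg (i + 1))"
| x_s: "i \<in> {2..<d} \<Longrightarrow> hrel d (xg * sg i) (sg i * xg)"
| z_s: "\<lbrakk>i \<in> {1..<d}; j \<in> {0..d}; j \<noteq> i; j \<noteq> i + 1\<rbrakk> \<Longrightarrow> hrel d (zg j * sg i) (sg i * zg j)"
| c_x: "i \<in> {1..d} \<Longrightarrow> hrel d (cg i * xg) (- (xg * cg i))"
| c_z: "\<lbrakk>i \<in> {1..d}; j \<in> {0..d}\<rbrakk> \<Longrightarrow> hrel d (cg i * zg j) (- (zg j * cg i))"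
| x_x: "d \<ge> 2 \<Longrightarrow>
    hrel d (xg * (sg 1 * xg * sg 1 - (cg 1 - cg 2) * sg 1))
           (- ((sg 1 * xg * sg 1 - (cg 1 - cg 2) * sg 1) * xg))"
| z1_z2: "d \<ge> 2 \<Longrightarrow> hrel d (zg 1 * zg 2) (- (zg 2 * zg 1))"
| z0_z1: "d \<ge> 1 \<Longrightarrow> hrel d (zg 0 * zg 1) (- (zg 1 * zg 0))"
| z2_x: "d \<ge> 2 \<Longrightarrow> hrel d (zg 2 * xg) (- (xg * zg 2))"
| z_x: "d \<ge> 1 \<Longrightarrow> hrel d ((zg 0 - zg 1 + xg) * xg) (- (xg * (zg 0 - zg 1 + xg)))"

abbreviation hfree :: "nat \<Rightarrow> (hgen word \<Rightarrow>\<^sub>0 complex) superspace" where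
  "hfree d \<equiv> free_superalgebra (hgens d) hgen_parity"

definition hideal :: "nat \<Rightarrow> (hgen word \<Rightarrow>\<^sub>0 complex) set" where
  "hideal d = Idl\<^bsub>hfree d\<^esub> {l - r | l r. hrel d l r}"

definition hclass :: "nat \<Rightarrow> (hgen word \<Rightarrow>\<^sub>0 complex) \<Rightarrow> (hgen word \<Rightarrow>\<^sub>0 complex) set" where
  "hclass d u = hideal d +>\<^bsub>hfree d\<^esub> u"

definition H_alg :: "nat \<Rightarrow> (hgen word \<Rightarrow>\<^sub>0 complex) set superspace" where
  "H_alg d = module.extend (quot_module (hfree d) (hideal d))
     (superspace.fields (\<lambda>p. hclass d ` homog (hfree d) p))"

end

theory Submission
  imports Defs "HOL-Combinatorics.Transposition"
begin

text \<open>
  Number the tensor factors $M, N, V_1, \dots, V_d$ from left to right by the positions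
  $0, 1, 2, \dots, d + 1$.  An element of $\mathfrak q(n)$ acts on the factor at position $p$ with the
  sign for passing the factors to the left of $p$.  Operators at different positions supercommute,
  operators at one position obey the bracket of $\mathfrak q(n)$, and on a copy of $V$ there are in
  addition all supermatrix units.  Every relation thus becomes a computation in an associative ring
  with these generators (locales \<open>q_slots\<close> and \<open>v_slots\<close>), where
  $\Omega_{p,q} = \sum_{i,j} e_{ij}(p) f_{ji}(q) - f_{ij}(p) e_{ji}(q)$ makes sense for any two positions
  and $\Omega_{q,p} = - \Omega_{p,q}$.
  
  Three facts carry the proof.
  
  \<^item> $\Omega$ is invariant: $\Omega_{p,q}$ supercommutes with $x(p) + x(q)$ for $x \in \mathfrak q(n)$
  (\<open>Om_E\<close>, \<open>Om_F\<close>).  The operator of $\tilde z_j$ is $\sum_{r \le j} \Omega_{r,j+1}$, and its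
  left leg is the total action on the positions $0, \dots, j$; it therefore anticommutes with every
  $\Omega_{p,q}$ with $p, q \le j$ (\<open>anti_Om_Jucys_Murphy\<close>).  The relations among $\tilde x_1$, its conjugate by
  $s_1$ and the $\tilde z_j$ are instances, with suitable sets of positions in place of $\{0, \dots, j\}$.
  
  \<^item> $C$ commutes with $e_{ij}$ and anticommutes with $f_{ij}$, so it anticommutes with $\Omega$
  (\<open>anti_C_Om\<close>).
  
  \<^item> The signed swap permutes positions, and on two copies of $V$ one has
  $\Omega_{p,q} = (c_q - c_p) s$ (\<open>Om_eq_C_Sw\<close>).  The summand $\Omega_{i,i+1}$ by which
  $\tilde z_{i+1}$ differs from the conjugate of $\tilde z_i$ produces the Clifford terms in the relations.
  
  The tensor product is a set of cosets in a free vector space.  To calculate in a ring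
  type, a linear section \<open>rho\<close> of the quotient map is fixed; an endomorphism of the tensor product
  then corresponds to an operator $x$ on the free space with $\rho x = x = x \rho$, and \<open>rho\<close> plays the
  part of the identity.  Signs are handled by the parity involutions: an odd operator at position $p$ is
  the unsigned tensor product of the involutions at the positions left of $p$, the given
  operator at $p$, and identities to the right.  The Koszul sign rule then reduces to
  $a \sigma = \pm \sigma a$ at a single position.
  
  The same involutions describe the grading: a vector is homogeneous if it is an eigenvector of the
  product of all involutions (\<open>graded_part_iff\<close>).  Evaluation of noncommutative polynomials at the
  operators is a homomorphism from the free superalgebra; it kills the defining relations
  (\<open>eval_free_relation\<close>), hence descends to $\mathcal H_d$.
\<close>

section \<open>Signs and supercommutators\<close>

text \<open>
  Parities are added and multiplied as elements of a field; the default rewriting of these operations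
  to logical connectives would hide the signs.
\<close>

declare add_bit_eq_xor [simp del] mult_bit_eq_and [simp del]

lemma bit_add_self [simp]: "x + x = (0::bit)" "x + (x + y) = (y::bit)"
  by (cases x; cases y; simp)+

definition ksign :: "bit \<Rightarrow> 'r::ring_1" where
  "ksign r = (if r = 1 then - 1 else 1)"

lemma ksign_simps [simp]: "ksign 0 = 1" "ksign 1 = - 1"
  by (simp_all add: ksign_def)

lemma ksign_add: "ksign (x + y) = ksign x * (ksign y :: 'r::ring_1)"
  by (cases x; cases y) (simp_all add: ksign_def)

lemma ksign_mult_self [simp]: "ksign x * ksign x = (1 :: 'r::ring_1)" "ksign x * (ksign x * y) = (y :: 'r::ring_1)"
  by (simp_all add: ksign_def)

lemma ksign_left_commute: "z * (ksign x * y) = ksign x * (z * (y :: 'r::ring_1))"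
  by (simp add: ksign_def)

definition comm :: "'r::ring \<Rightarrow> 'r \<Rightarrow> 'r" where "comm x y = x * y - y * x"
definition anti :: "'r::ring \<Rightarrow> 'r \<Rightarrow> 'r" where "anti x y = x * y + y * x"

lemma comm_add: "comm (x + y) z = comm x z + comm y z" "comm z (x + y) = comm z x + comm z y"
  "comm (x - y) z = comm x z - comm y z" "comm z (x - y) = comm z x - comm z y" "comm 0 z = 0" "comm z 0 = 0"
  by (simp_all add: comm_def algebra_simps)
lemma anti_add: "anti (x + y) z = anti x z + anti y z" "anti z (x + y) = anti z x + anti z y"
   "anti (x - y) z = anti x z - anti y z" "anti z (x - y) = anti z x - anti z y" "anti 0 z = 0" "anti z 0 = 0"
  by (simp_all add: anti_def algebra_simps)
lemma comm_sum: "comm (sum f A) z = (\<Sum>i\<in>A. comm (f i) z)" "comm z (sum f A) = (\<Sum>i\<in>A. comm z (f i))"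
  by (induction A rule: infinite_finite_induct) (simp_all add: comm_add)
lemma anti_sum: "anti (sum f A) z = (\<Sum>i\<in>A. anti (f i) z)" "anti z (sum f A) = (\<Sum>i\<in>A. anti z (f i))"
  by (induction A rule: infinite_finite_induct) (simp_all add: anti_add)

text \<open>
  The four Leibniz rules needed for products of two factors, according to the parities of the factors;
  the signs are those of the superbracket $[xy, z] = x [y, z] \pm [x, z] y$.
\<close>

lemma comm_mult: "comm (x * y) z = x * comm y z + comm x z * (y::'r::ring)"
  by (simp add: comm_def algebra_simps)
lemma anti_mult_even_odd: "anti (x * y) z = x * anti y z - comm x z * (y::'r::ring)"
  by (simp add: comm_def anti_def algebra_simps)
lemma anti_mult_odd_even: "anti (x * y) z = x * comm y z + anti x z * (y::'r::ring)"
  by (simp add: comm_def anti_def algebra_simps)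
lemma anti_swap: "anti x y = anti y (x::'r::ring)" by (simp add: anti_def)
lemma comm_eq_0_sym: "comm x y = 0 \<Longrightarrow> comm y (x::'r::ring) = 0" by (simp add: comm_def)
lemma comm_zero_iff: "comm x y = 0 \<longleftrightarrow> x * y = y * (x::'r::ring)" by (simp add: comm_def)
lemma anti_zero_iff: "anti x y = 0 \<longleftrightarrow> x * y = - (y * (x::'r::ring))"
  by (simp add: anti_def eq_neg_iff_add_eq_0)

lemma sum2_delta:
  fixes g :: "'k::finite \<Rightarrow> 'l::finite \<Rightarrow> 'r::comm_monoid_add"
  shows "(\<Sum>i\<in>UNIV. \<Sum>j\<in>UNIV. if i = a then g i j else 0) = (\<Sum>j\<in>UNIV. g a j)"
    and "(\<Sum>i\<in>UNIV. \<Sum>j\<in>UNIV. if j = b then g i j else 0) = (\<Sum>i\<in>UNIV. g i b)"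
proof -
  have "(\<Sum>i\<in>UNIV. \<Sum>j\<in>UNIV. if i = a then g i j else 0)
      = (\<Sum>i\<in>UNIV. if i = a then (\<Sum>j\<in>UNIV. g i j) else 0)"
    by (intro sum.cong) auto
  then show "(\<Sum>i\<in>UNIV. \<Sum>j\<in>UNIV. if i = a then g i j else 0) = (\<Sum>j\<in>UNIV. g a j)" by simp
qed simp

section \<open>The invariant tensor of q(n)\<close>

text \<open>
  \<open>E p i j\<close> and \<open>F p i j\<close> model the action of $e_{ij}$ and $f_{ij}$ on the factor at position \<open>p\<close>.
\<close>

locale q_slots =
  fixes P :: "'p set"
    and E F :: "'p \<Rightarrow> 'k::finite \<Rightarrow> 'k \<Rightarrow> 'r::ring_1"
  assumes EE: "p \<in> P \<Longrightarrow> comm (E p i j) (E p k l)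
      = (if j = k then E p i l else 0) - (if i = l then E p k j else 0)"
    and EF: "p \<in> P \<Longrightarrow> comm (E p i j) (F p k l)
      = (if j = k then F p i l else 0) - (if i = l then F p k j else 0)"
    and FF: "p \<in> P \<Longrightarrow> anti (F p i j) (F p k l)
      = (if j = k then E p i l else 0) + (if i = l then E p k j else 0)"
    and far_EE: "p \<in> P \<Longrightarrow> q \<in> P \<Longrightarrow> p \<noteq> q \<Longrightarrow> comm (E p i j) (E q k l) = 0"
    and far_EF: "p \<in> P \<Longrightarrow> q \<in> P \<Longrightarrow> p \<noteq> q \<Longrightarrow> comm (E p i j) (F q k l) = 0"
    and far_FF: "p \<in> P \<Longrightarrow> q \<in> P \<Longrightarrow> p \<noteq> q \<Longrightarrow> anti (F p i j) (F q k l) = 0"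
begin

lemma far_FE: "p \<in> P \<Longrightarrow> q \<in> P \<Longrightarrow> p \<noteq> q \<Longrightarrow> comm (F p i j) (E q k l) = 0"
  using far_EF comm_eq_0_sym by metis

lemma FE: "p \<in> P \<Longrightarrow> comm (F p i j) (E p k l)
      = (if j = k then F p i l else 0) - (if i = l then F p k j else 0)"
proof -
  assume "p \<in> P"
  then have "comm (E p k l) (F p i j) = (if l = i then F p k j else 0) - (if k = j then F p i l else 0)"
    by (rule EF)
  moreover have "comm (F p i j) (E p k l) = - comm (E p k l) (F p i j)" by (simp add: comm_def)
  ultimately show ?thesis by auto
qed

lemmas anti_EX = anti_mult_even_odd[of "E p i j" for p i j]
lemmas anti_FX = anti_mult_odd_even[of "F p i j" for p i j]

text \<open>
  The definition does not ask which of \<open>p\<close> and \<open>q\<close> stands to the left; both orders occur, because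
  the relation of $\tilde z_0 - \tilde z_1 + \tilde x_1$ with $\tilde x_1$ is invariance of
  $\Omega$ with the roles of $N$ and $V_1$ exchanged.
\<close>

definition Om :: "'p \<Rightarrow> 'p \<Rightarrow> 'r" where
  "Om p q = (\<Sum>i\<in>UNIV. \<Sum>j\<in>UNIV. E p i j * F q j i - F p i j * E q j i)"

lemma Om_swap: assumes "p \<in> P" "q \<in> P" "p \<noteq> q" shows "Om q p = - Om p q"
proof -
  have 1: "E q i j * F p j i = F p j i * E q i j" "F q i j * E p j i = E p j i * F q i j" for i j
    using far_EF[of q p i j j i] far_EF[of p q j i i j] assms by (simp_all add: comm_def)
  have "Om q p = (\<Sum>i\<in>UNIV. \<Sum>j\<in>UNIV. F p j i * E q i j - E p j i * F q i j)"
    unfolding Om_def 1 ..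
  also have "\<dots> = (\<Sum>j\<in>UNIV. \<Sum>i\<in>UNIV. F p j i * E q i j - E p j i * F q i j)"
    by (rule sum.swap)
  also have "\<dots> = - Om p q"
    by (simp add: Om_def sum_subtractf)
  finally show ?thesis .
qed

text \<open>
  Invariance under the even part.  Bracketing with $e_{kl}$ replaces one index of $e_{ij}$ or
  $f_{ji}$; the terms from position \<open>p\<close> cancel those from position \<open>q\<close>, as in the proof that a
  Casimir element is central.
\<close>

lemma Om_E: assumes "p \<in> P" "q \<in> P" "p \<noteq> q" shows "comm (Om p q) (E p k l + E q k l) = 0"
proof -
  have 1: "comm (E p i j * F q j i - F p i j * E q j i) (E p k l + E q k l)
     = (if j = k then E p i l * F q j i else 0) - (if i = l then E p k j * F q j i else 0)
     + (if i = k then E p i j * F q j l else 0) - (if j = l then E p i j * F q k i else 0)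
     - (if j = k then F p i l * E q j i else 0) + (if i = l then F p k j * E q j i else 0)
     - (if i = k then F p i j * E q j l else 0) + (if j = l then F p i j * E q k i else 0)" for i j
    using assms by (simp add: comm_add comm_mult EE FE far_EE far_FE ring_distribs)
  show ?thesis
    unfolding Om_def comm_sum 1 by (simp only: sum.distrib sum_subtractf sum2_delta) simp
qed

text \<open>
  Invariance under the odd part.  Brackets of $f_{kl}$ exchange the two sums in $\Omega$, and the
  minus sign between them makes the terms cancel.
\<close>

lemma Om_F: assumes "p \<in> P" "q \<in> P" "p \<noteq> q" shows "anti (Om p q) (F p k l + F q k l) = 0"
proof -
  have 1: "anti (E p i j * F q j i - F p i j * E q j i) (F p k l + F q k l)
     = (if i = k then E p i j * E q j l else 0) + (if j = l then E p i j * E q k i else 0)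
     - (if j = k then F p i l * F q j i else 0) + (if i = l then F p k j * F q j i else 0)
     - (if i = k then F p i j * F q j l else 0) + (if j = l then F p i j * F q k i else 0)
     - (if j = k then E p i l * E q j i else 0) - (if i = l then E p k j * E q j i else 0)" for i j
    using assms
    by (simp add: anti_add anti_EX anti_FX EF FF FE far_FE far_EF far_FF ring_distribs)
  show ?thesis
    unfolding Om_def anti_sum 1 by (simp only: sum.distrib sum_subtractf sum2_delta) simp
qed

lemma Om_far_E: assumes "p \<in> P" "q \<in> P" "r \<in> P" "r \<noteq> p" "r \<noteq> q" shows "comm (Om p q) (E r k l) = 0"
  unfolding Om_def comm_sum using assms by (simp add: comm_add comm_mult far_EE far_FE)

lemma Om_far_F: assumes "p \<in> P" "q \<in> P" "r \<in> P" "r \<noteq> p" "r \<noteq> q" shows "anti (Om p q) (F r k l) = 0"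
  unfolding Om_def anti_sum using assms
  by (simp add: anti_add anti_EX anti_FX far_EF far_FE far_FF)

lemma Om_sum_E:
  assumes "finite A" "A \<subseteq> P" "p \<in> A" "q \<in> A" "p \<noteq> q"
  shows "comm (Om p q) (\<Sum>r\<in>A. E r k l) = 0"
proof -
  have "(\<Sum>r\<in>A. E r k l) = E p k l + E q k l + (\<Sum>r\<in>A-{p}-{q}. E r k l)"
    using assms by (simp add: sum.remove[of A p] sum.remove[of "A-{p}" q] add.assoc)
  moreover have "(\<Sum>r\<in>A-{p}-{q}. comm (Om p q) (E r k l)) = 0"
    using assms by (intro sum.neutral ballI Om_far_E) auto
  ultimately show ?thesis using Om_E[of p q k l] assms by (auto simp: comm_add comm_sum)
qed

lemma Om_sum_F:
  assumes "finite A" "A \<subseteq> P" "p \<in> A" "q \<in> A" "p \<noteq> q"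
  shows "anti (Om p q) (\<Sum>r\<in>A. F r k l) = 0"
proof -
  have "(\<Sum>r\<in>A. F r k l) = F p k l + F q k l + (\<Sum>r\<in>A-{p}-{q}. F r k l)"
    using assms by (simp add: sum.remove[of A p] sum.remove[of "A-{p}" q] add.assoc)
  moreover have "(\<Sum>r\<in>A-{p}-{q}. anti (Om p q) (F r k l)) = 0"
    using assms by (intro sum.neutral ballI Om_far_F) auto
  ultimately show ?thesis using Om_F[of p q k l] assms by (auto simp: anti_add anti_sum)
qed

text \<open>
  The left legs of $\sum_{r \in A} \Omega_{r,m}$ are the diagonal action of $\mathfrak q(n)$ on the
  positions in \<open>A\<close>, with which $\Omega_{p,q}$ supercommutes when $p, q \in A$.  This is the mechanism by
  which Jucys-Murphy elements commute, with odd elements in place of even ones.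
\<close>

lemma anti_Om_Jucys_Murphy:
  assumes "finite A" "A \<subseteq> P" "p \<in> A" "q \<in> A" "p \<noteq> q" "m \<in> P" "m \<notin> A"
  shows "anti (Om p q) (\<Sum>r\<in>A. Om r m) = 0"
proof -
  have pq: "p \<in> P" "q \<in> P" "m \<noteq> p" "m \<noteq> q" using assms by auto
  have "(\<Sum>r\<in>A. Om r m) = (\<Sum>i\<in>UNIV. \<Sum>r\<in>A. \<Sum>j\<in>UNIV. E r i j * F m j i - F r i j * E m j i)"
    unfolding Om_def by (rule sum.swap)
  also have "\<dots> = (\<Sum>i\<in>UNIV. \<Sum>j\<in>UNIV. \<Sum>r\<in>A. E r i j * F m j i - F r i j * E m j i)"
    by (intro sum.cong refl) (rule sum.swap)
  also have "\<dots> = (\<Sum>i\<in>UNIV. \<Sum>j\<in>UNIV. (\<Sum>r\<in>A. E r i j) * F m j i - (\<Sum>r\<in>A. F r i j) * E m j i)"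
    by (simp add: sum_subtractf sum_distrib_right)
  finally have *: "(\<Sum>r\<in>A. Om r m) = \<dots>" .
  have "anti (Om p q) ((\<Sum>r\<in>A. E r i j) * F m j i) = 0" "anti (Om p q) ((\<Sum>r\<in>A. F r i j) * E m j i) = 0" for i j
    using Om_sum_E[OF assms(1-5), of i j] Om_sum_F[OF assms(1-5), of i j]
      Om_far_E[OF pq(1,2) assms(6) pq(3,4), of j i] Om_far_F[OF pq(1,2) assms(6) pq(3,4), of j i]
    by (auto simp: anti_swap[of "Om p q"] comm_eq_0_sym
        anti_mult_even_odd[of "\<Sum>r\<in>A. E r i j"] anti_mult_odd_even[of "\<Sum>r\<in>A. F r i j"])
  then show ?thesis unfolding * anti_sum by (simp add: anti_add)
qed

end

section \<open>Supermatrix units and the signed swap\<close>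

abbreviation tr :: "'p \<Rightarrow> 'p \<Rightarrow> 'p \<Rightarrow> 'p" where "tr \<equiv> Transposition.transpose"

fun index_parity :: "'k + 'k \<Rightarrow> bit" where
  "index_parity (Inl i) = 0" | "index_parity (Inr i) = 1"

lemma sum_UNIV_Plus:
  fixes f :: "'k::finite + 'l::finite \<Rightarrow> 'r::comm_monoid_add"
  shows "(\<Sum>a\<in>UNIV. f a) = (\<Sum>i\<in>UNIV. f (Inl i)) + (\<Sum>i\<in>UNIV. f (Inr i))"
  using sum.Plus[of "UNIV :: 'k set" "UNIV :: 'l set" f] by simp

lemma sum_delta2:
  fixes g :: "'l::finite \<Rightarrow> 'r::comm_monoid_add"
  shows "(\<Sum>j\<in>UNIV. if a = j then g j else 0) = g a" by simp

text \<open>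
  On a copy of $V$ all matrices act: \<open>U p a b\<close> models the matrix unit with rows and columns indexed by
  \<^typ>\<open>'k + 'k\<close>, of parity \<open>index_parity a + index_parity b\<close>.  The parameter \<open>u\<close> is the identity operator;
  it is not \<^term>\<open>1\<close>, because the ring in which this locale is interpreted contains the endomorphisms of the
  tensor product as a non-unital subring.
\<close>

locale v_slots = q_slots P E F for P :: "'p set"
    and E F :: "'p \<Rightarrow> 'k::finite \<Rightarrow> 'k \<Rightarrow> 'r::ring_1" +
  fixes VP :: "'p set" and U :: "'p \<Rightarrow> 'k + 'k \<Rightarrow> 'k + 'k \<Rightarrow> 'r" and u :: 'r
  assumes VP: "VP \<subseteq> P"
    and UU: "p \<in> VP \<Longrightarrow> U p a b * U p c e = (if b = c then U p a e else 0)"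
    and U_sum: "p \<in> VP \<Longrightarrow> (\<Sum>a\<in>UNIV. U p a a) = u"
    and far_UU: "p \<in> VP \<Longrightarrow> q \<in> VP \<Longrightarrow> p \<noteq> q \<Longrightarrow> U p a b * U q c e
        = ksign ((index_parity a + index_parity b) * (index_parity c + index_parity e)) * (U q c e * U p a b)"
    and far_UE: "p \<in> VP \<Longrightarrow> r \<in> P \<Longrightarrow> r \<noteq> p \<Longrightarrow> U p a b * E r k l = E r k l * U p a b"
    and far_UF: "p \<in> VP \<Longrightarrow> r \<in> P \<Longrightarrow> r \<noteq> p
        \<Longrightarrow> U p a b * F r k l = ksign (index_parity a + index_parity b) * (F r k l * U p a b)"
    and E_U: "p \<in> VP \<Longrightarrow> E p i j = U p (Inl i) (Inl j) + U p (Inr i) (Inr j)"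
    and F_U: "p \<in> VP \<Longrightarrow> F p i j = U p (Inl i) (Inr j) + U p (Inr i) (Inl j)"
begin

lemma u_U: assumes "p \<in> VP" shows "u * U p a b = U p a b" "U p a b * u = U p a b"
  using assms by (simp_all add: U_sum[OF assms, symmetric] sum_distrib_left sum_distrib_right UU)

text \<open>
  The signed swap of two copies of $V$, written as the usual element
  $\sum_{a,b} (-1)^{\bar b} E_{ab} \otimes E_{ba}$.  In this form its properties follow from the products of
  matrix units.
\<close>

definition Sw :: "'p \<Rightarrow> 'p \<Rightarrow> 'r" where
  "Sw p q = (\<Sum>a\<in>UNIV. \<Sum>b\<in>UNIV. ksign (index_parity b) * (U p a b * U q b a))"

definition C :: "'p \<Rightarrow> 'r" where
  "C p = (\<Sum>i\<in>UNIV. U p (Inr i) (Inl i) - U p (Inl i) (Inr i))"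

context
  fixes p q assumes pq: "p \<in> VP" "q \<in> VP" "p \<noteq> q"
begin

text \<open>
  The product with a matrix unit at either position collapses one of the two sums.  The swap
  property follows by comparing the signs; the same expansions give $\Omega = (c_q - c_p) s$.
\<close>

lemma Sw_mult_U_left:
  "Sw p q * U p c e = (\<Sum>a\<in>UNIV. ksign (index_parity c + (index_parity a + index_parity c) * (index_parity c + index_parity e)) * (U p a e * U q c a))"
proof -
  have 1: "ksign (index_parity b) * (U p a b * U q b a) * U p c e
     = (if c = b then ksign (index_parity b + (index_parity b + index_parity a) * (index_parity c + index_parity e)) * (U p a e * U q b a) else 0)"
    for a b
  proof -
    have "ksign (index_parity b) * (U p a b * U q b a) * U p c e
      = ksign (index_parity b) * (ksign ((index_parity b + index_parity a) * (index_parity c + index_parity e)) * ((U p a b * U p c e) * U q b a))"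
      using far_UU[of q p b a c e] pq by (simp add: mult.assoc ksign_left_commute[of "U p a b"])
    then show ?thesis using pq by (auto simp: UU ksign_add mult.assoc)
  qed
  show ?thesis
    unfolding Sw_def sum_distrib_right 1 sum_delta2 by (simp add: add.commute)
qed

lemma U_right_mult_Sw:
  "U q c e * Sw p q = (\<Sum>a\<in>UNIV. ksign (index_parity e + (index_parity c + index_parity e) * (index_parity a + index_parity e)) * (U p a e * U q c a))"
proof -
  have 1: "U q c e * (ksign (index_parity b) * (U p a b * U q b a))
     = (if e = b then ksign (index_parity b + (index_parity c + index_parity e) * (index_parity a + index_parity b)) * (U p a b * U q c a) else 0)"
    for a b
  proof -
    have "U q c e * (ksign (index_parity b) * (U p a b * U q b a))
        = ksign (index_parity b) * ((U q c e * U p a b) * U q b a)"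
      by (simp add: mult.assoc ksign_left_commute[of "U q c e"])
    also have "\<dots> = ksign (index_parity b) * (ksign ((index_parity c + index_parity e) * (index_parity a + index_parity b)) * (U p a b * (U q c e * U q b a)))"
      using far_UU[of q p c e a b] pq by (simp add: mult.assoc)
    finally show ?thesis using pq by (auto simp: UU ksign_add mult.assoc)
  qed
  show ?thesis
    unfolding Sw_def sum_distrib_left 1 sum_delta2 by simp
qed

lemma U_left_mult_Sw:
  "U p c e * Sw p q = (\<Sum>b\<in>UNIV. ksign (index_parity b) * (U p c b * U q b e))"
proof -
  have 1: "U p c e * (ksign (index_parity b) * (U p a b * U q b a))
     = (if a = e then ksign (index_parity b) * (U p c b * U q b a) else 0)"
    for a b
  proof -
    have "U p c e * (ksign (index_parity b) * (U p a b * U q b a))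
        = ksign (index_parity b) * ((U p c e * U p a b) * U q b a)"
      by (simp add: mult.assoc ksign_left_commute[of "U p c e"])
    then show ?thesis using pq by (auto simp: UU)
  qed
  show ?thesis
    unfolding Sw_def sum_distrib_left 1 sum2_delta by simp
qed

lemma Sw_mult_U: "Sw p q * U p c e = U q c e * Sw p q"
proof -
  have "x + (z + x) * (x + y) = y + (x + y) * (z + y)" for x y z :: bit
    by (cases x; cases y; cases z) simp_all
  then show ?thesis unfolding Sw_mult_U_left U_right_mult_Sw
    by (intro sum.cong refl arg_cong2[where f="(*)"] arg_cong[where f=ksign])
qed

lemma Sw_square: "Sw p q * Sw p q = u"
proof -
  have 1: "ksign (index_parity c + (index_parity a + index_parity c) * (index_parity c + index_parity e)) * (U p a e * U q c a) * (ksign (index_parity e) * U q e c)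
     = (if a = e then U p e e * U q c c else 0)" for a c e
  proof -
    have s: "x + (y + x) * (x + y) + y = 0" for x y :: bit by (cases x; cases y) simp_all
    have "ksign (index_parity c + (index_parity a + index_parity c) * (index_parity c + index_parity e)) * (U p a e * U q c a) * (ksign (index_parity e) * U q e c)
      = ksign (index_parity c + (index_parity a + index_parity c) * (index_parity c + index_parity e) + index_parity e) * (U p a e * (U q c a * U q e c))"
      by (simp add: mult.assoc ksign_left_commute[of "U p a e"] ksign_left_commute[of "U q c a"] ksign_add[of _ "index_parity e"])
    then show ?thesis using pq by (auto simp: UU s)
  qed
  have "Sw p q * Sw p q = (\<Sum>c\<in>UNIV. \<Sum>e\<in>UNIV. Sw p q * U p c e * (ksign (index_parity e) * U q e c))"
    unfolding Sw_def[of p q, THEN arg_cong[where f="\<lambda>x. Sw p q * x"]] sum_distrib_left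
    by (intro sum.cong refl) (simp add: mult.assoc ksign_left_commute)
  also have "\<dots> = (\<Sum>c\<in>UNIV. \<Sum>e\<in>UNIV. U p e e * U q c c)"
    unfolding Sw_mult_U_left sum_distrib_right 1 by simp
  also have "\<dots> = (\<Sum>e\<in>UNIV. U p e e * u)"
    unfolding sum.swap[of "\<lambda>c e. U p e e * U q c c"] sum_distrib_left[symmetric] U_sum[OF pq(2)] ..
  also have "\<dots> = u"
    using pq by (simp add: u_U U_sum)
  finally show ?thesis .
qed

text \<open>
  Passing $x$ through $E_{ab}$ and $E_{ba}$ gives the same sign twice.
\<close>

lemma Sw_commute:
  assumes x: "\<And>r a b. r \<in> {p, q} \<Longrightarrow> U r a b * x = ksign ((index_parity a + index_parity b) * t) * (x * U r a b)"
  shows "Sw p q * x = x * Sw p q"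
proof -
  have "U p a b * U q b a * x = x * (U p a b * U q b a)" for a b
  proof -
    have "U p a b * U q b a * x = ksign ((index_parity b + index_parity a) * t) * ((U p a b * x) * U q b a)"
      using x[of q b a] by (simp add: mult.assoc ksign_left_commute[of "U p a b"])
    also have "\<dots> = x * (U p a b * U q b a)"
      using x[of p a b] by (simp add: mult.assoc add.commute)
    finally show ?thesis .
  qed
  then show ?thesis
    unfolding Sw_def sum_distrib_left sum_distrib_right
    by (intro sum.cong refl) (simp add: mult.assoc ksign_left_commute[of x])
qed

lemma Sw_far_E: "r \<in> P \<Longrightarrow> r \<noteq> p \<Longrightarrow> r \<noteq> q \<Longrightarrow> Sw p q * E r k l = E r k l * Sw p q"
  by (rule Sw_commute[where t = 0])
    (simp, elim disjE, simp_all add: pq far_UE[OF pq(1)] far_UE[OF pq(2)])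

lemma Sw_far_F: "r \<in> P \<Longrightarrow> r \<noteq> p \<Longrightarrow> r \<noteq> q \<Longrightarrow> Sw p q * F r k l = F r k l * Sw p q"
  by (rule Sw_commute[where t = 1])
    (simp, elim disjE, simp_all add: pq far_UF[OF pq(1)] far_UF[OF pq(2)])

lemma Sw_far_U: "r \<in> VP \<Longrightarrow> r \<noteq> p \<Longrightarrow> r \<noteq> q \<Longrightarrow> Sw p q * U r c e = U r c e * Sw p q"
  by (rule Sw_commute[where t = "index_parity c + index_parity e"])
    (simp, elim disjE, simp_all add: far_UU[OF pq(1)] far_UU[OF pq(2)])

lemma Sw_swap: "Sw q p = Sw p q"
proof -
  have "ksign (index_parity b) * (U q a b * U p b a) = ksign (index_parity a) * (U p b a * U q a b)" for a b
  proof -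
    have s: "x + (y + x) * (x + y) = y" for x y :: bit by (cases x; cases y) simp_all
    have "ksign (index_parity b) * (U q a b * U p b a)
        = ksign (index_parity b + (index_parity a + index_parity b) * (index_parity b + index_parity a)) * (U p b a * U q a b)"
      using far_UU[of q p a b b a] pq by (simp add: ksign_add mult.assoc)
    then show ?thesis by (simp add: s)
  qed
  then show ?thesis
    unfolding Sw_def by (simp add: sum.swap[of "\<lambda>a b. ksign (index_parity a) * (U p b a * U q a b)"])
qed

end

text \<open>
  Conjugation by the swap renames positions.  Stated with the transposition of positions, this
  transports any expression in the operators, in particular $\Omega$ and the swaps themselves.
\<close>

lemma Sw_mult_E:
  assumes "p \<in> VP" "q \<in> VP" "p \<noteq> q" "r \<in> P"
  shows "Sw p q * E r k l = E (tr p q r) k l * Sw p q"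
proof (cases "r = p \<or> r = q")
  case True
  then show ?thesis using assms Sw_mult_U[of p q] Sw_mult_U[of q p] Sw_swap[of p q]
    by (auto simp: E_U ring_distribs)
qed (use assms Sw_far_E in \<open>auto simp: Transposition.transpose_def\<close>)

lemma Sw_mult_F:
  assumes "p \<in> VP" "q \<in> VP" "p \<noteq> q" "r \<in> P"
  shows "Sw p q * F r k l = F (tr p q r) k l * Sw p q"
proof (cases "r = p \<or> r = q")
  case True
  then show ?thesis using assms Sw_mult_U[of p q] Sw_mult_U[of q p] Sw_swap[of p q]
    by (auto simp: F_U ring_distribs)
qed (use assms Sw_far_F in \<open>auto simp: Transposition.transpose_def\<close>)

lemma Sw_mult_U_tr:
  assumes "p \<in> VP" "q \<in> VP" "p \<noteq> q" "r \<in> VP"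
  shows "Sw p q * U r c e = U (tr p q r) c e * Sw p q"
proof (cases "r = p \<or> r = q")
  case True
  then show ?thesis using assms Sw_mult_U[of p q] Sw_mult_U[of q p] Sw_swap[of p q] by auto
qed (use assms Sw_far_U in \<open>auto simp: Transposition.transpose_def\<close>)

lemma Sw_mult_C:
  assumes "p \<in> VP" "q \<in> VP" "p \<noteq> q" "r \<in> VP"
  shows "Sw p q * C r = C (tr p q r) * Sw p q"
  unfolding C_def sum_distrib_left sum_distrib_right
  using assms by (simp add: ring_distribs Sw_mult_U_tr)

lemma Sw_mult_Sw:
  assumes "p \<in> VP" "q \<in> VP" "p \<noteq> q" "r \<in> VP" "s \<in> VP"
  shows "Sw p q * Sw r s = Sw (tr p q r) (tr p q s) * Sw p q"
proof -
  have "Sw p q * (ksign (index_parity b) * (U r a b * U s b a))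
     = ksign (index_parity b) * (U (tr p q r) a b * U (tr p q s) b a) * Sw p q" for a b
  proof -
    have "Sw p q * (U r a b * U s b a) = U (tr p q r) a b * (Sw p q * U s b a)"
      using assms Sw_mult_U_tr[of p q r a b] by (simp add: mult.assoc[symmetric])
    then show ?thesis
      using assms Sw_mult_U_tr[of p q s b a] by (simp add: mult.assoc ksign_left_commute[of "Sw p q"])
  qed
  then show ?thesis
    unfolding Sw_def[of r s] Sw_def[of "tr p q r"] sum_distrib_left sum_distrib_right by simp
qed

lemma Sw_mult_Om:
  assumes "p \<in> VP" "q \<in> VP" "p \<noteq> q" "r \<in> P" "s \<in> P"
  shows "Sw p q * Om r s = Om (tr p q r) (tr p q s) * Sw p q"
proof -
  have "Sw p q * (E r i j * F s j i - F r i j * E s j i)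
    = (E (tr p q r) i j * F (tr p q s) j i - F (tr p q r) i j * E (tr p q s) j i) * Sw p q" for i j
  proof -
    have "Sw p q * (E r i j * F s j i) = E (tr p q r) i j * (Sw p q * F s j i)"
      "Sw p q * (F r i j * E s j i) = F (tr p q r) i j * (Sw p q * E s j i)"
      using Sw_mult_E[OF assms(1-3), of r] Sw_mult_F[OF assms(1-3), of r] assms(4)
      by (simp_all add: mult.assoc[symmetric])
    then show ?thesis
      using Sw_mult_E[OF assms(1-3), of s] Sw_mult_F[OF assms(1-3), of s] assms(5)
      by (simp add: left_diff_distrib right_diff_distrib mult.assoc)
  qed
  then show ?thesis unfolding Om_def sum_distrib_left sum_distrib_right by simp
qed

text \<open>
  Conjugating one swap by another yields the third swap of the three positions from either side.
\<close>

lemma Sw_braid: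
  assumes "p \<in> VP" "q \<in> VP" "r \<in> VP" "p \<noteq> q" "p \<noteq> r" "q \<noteq> r"
  shows "Sw p q * Sw q r * Sw p q = Sw q r * Sw p q * Sw q r"
proof -
  have u_Sw: "Sw p r * u = Sw p r"
    using assms by (simp add: Sw_def sum_distrib_right mult.assoc u_U)
  have "Sw p q * Sw q r * Sw p q = Sw p r * (Sw p q * Sw p q)"
    using assms Sw_mult_Sw[of p q q r] by (simp add: mult.assoc Transposition.transpose_def)
  moreover have "Sw q r * Sw p q * Sw q r = Sw p r * (Sw q r * Sw q r)"
    using assms Sw_mult_Sw[of q r p q] by (simp add: mult.assoc Transposition.transpose_def)
  ultimately show ?thesis using assms Sw_square u_Sw by simp
qed

lemma C_square: assumes "p \<in> VP" shows "C p * C p = - u"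
proof -
  have 1: "(U p (Inr i) (Inl i) - U p (Inl i) (Inr i)) * (U p (Inr j) (Inl j) - U p (Inl j) (Inr j))
     = (if i = j then - (U p (Inr i) (Inr j)) - U p (Inl i) (Inl j) else 0)" for i j
    using assms by (simp add: ring_distribs UU)
  show ?thesis
    unfolding C_def sum_distrib_left sum_distrib_right 1
    by (simp add: U_sum[OF assms, symmetric] sum_UNIV_Plus sum_subtractf sum_negf)
qed

lemma anti_C_C: assumes "p \<in> VP" "q \<in> VP" "p \<noteq> q" shows "anti (C p) (C q) = 0"
proof -
  have "anti (U p (Inr i) (Inl i) - U p (Inl i) (Inr i)) (U q (Inr j) (Inl j) - U q (Inl j) (Inr j)) = 0" for i j
    using far_UU[OF assms] by (simp add: anti_add) (simp add: anti_def)
  then show ?thesis by (simp add: C_def anti_sum)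
qed

lemma comm_C_E: assumes "p \<in> VP" "r \<in> P" shows "comm (C p) (E r k l) = 0"
proof (cases "r = p")
  case True
  have 1: "comm (U p (Inr i) (Inl i) - U p (Inl i) (Inr i)) (E p k l)
    = (if i = k then U p (Inr i) (Inl l) - U p (Inl i) (Inr l) else 0)
    - (if i = l then U p (Inr k) (Inl i) - U p (Inl k) (Inr i) else 0)" for i
    using assms by (simp add: E_U comm_def ring_distribs UU)
  show ?thesis unfolding C_def True comm_sum 1 by (simp add: sum_subtractf)
next
  case False
  then show ?thesis unfolding C_def comm_sum comm_add using assms by (simp add: comm_def far_UE)
qed

lemma anti_C_F: assumes "p \<in> VP" "r \<in> P" shows "anti (C p) (F r k l) = 0"
proof (cases "r = p")
  case True
  have 1: "anti (U p (Inr i) (Inl i) - U p (Inl i) (Inr i)) (F p k l)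
    = (if i = k then U p (Inr i) (Inr l) - U p (Inl i) (Inl l) else 0)
    + (if i = l then U p (Inl k) (Inl i) - U p (Inr k) (Inr i) else 0)" for i
    using assms by (simp add: F_U anti_def ring_distribs UU)
  show ?thesis unfolding C_def True anti_sum 1 by (simp add: sum.distrib)
next
  case False
  then show ?thesis unfolding C_def anti_sum anti_add using assms by (simp add: anti_def far_UF)
qed

lemma anti_C_Om: assumes "p \<in> VP" "r \<in> P" "s \<in> P" shows "anti (C p) (Om r s) = 0"
  using assms anti_C_F[unfolded anti_swap[of "C _"]] comm_eq_0_sym[OF comm_C_E]
  by (simp add: anti_swap[of "C p"] Om_def anti_sum anti_add anti_EX anti_FX)

text \<open>
  In blocks, $\Omega_{p,q}$ is a combination of eight double sums of products of matrix units.  Four of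
  them make up $c_q s$, and the other four $- c_p s$.
\<close>

theorem Om_eq_C_Sw:
  assumes pq: "p \<in> VP" "q \<in> VP" "p \<noteq> q"
  shows "Om p q = (C q - C p) * Sw p q"
proof -
  let ?l = Inl and ?r = Inr
  have "C q * Sw p q = (\<Sum>i\<in>UNIV. U q (?r i) (?l i) * Sw p q - U q (?l i) (?r i) * Sw p q)"
    by (simp add: C_def sum_distrib_right left_diff_distrib)
  also have "\<dots> = (\<Sum>i\<in>UNIV. \<Sum>j\<in>UNIV. U p (?l j) (?l i) * U q (?r i) (?l j) - U p (?l j) (?r i) * U q (?l i) (?l j)
      - U p (?r j) (?l i) * U q (?r i) (?r j) + U p (?r j) (?r i) * U q (?l i) (?r j))"
    unfolding U_right_mult_Sw[OF pq] by (simp add: sum_UNIV_Plus sum_subtractf sum.distrib sum_negf)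
  also have "\<dots> = (\<Sum>i\<in>UNIV. \<Sum>j\<in>UNIV. U p (?l i) (?l j) * U q (?r j) (?l i) - U p (?l i) (?r j) * U q (?l j) (?l i)
      - U p (?r i) (?l j) * U q (?r j) (?r i) + U p (?r i) (?r j) * U q (?l j) (?r i))"
    by (rule sum.swap)
  finally have Cq: "C q * Sw p q = \<dots>" .
  have "C p * Sw p q = (\<Sum>i\<in>UNIV. U p (?r i) (?l i) * Sw p q - U p (?l i) (?r i) * Sw p q)"
    by (simp add: C_def sum_distrib_right left_diff_distrib)
  also have "\<dots> = (\<Sum>i\<in>UNIV. \<Sum>j\<in>UNIV. U p (?r i) (?l j) * U q (?l j) (?l i) - U p (?r i) (?r j) * U q (?r j) (?l i)
      - U p (?l i) (?l j) * U q (?l j) (?r i) + U p (?l i) (?r j) * U q (?r j) (?r i))"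
    unfolding U_left_mult_Sw[OF pq] by (simp add: sum_UNIV_Plus sum_subtractf sum.distrib sum_negf)
  finally have Cp: "C p * Sw p q = \<dots>" .
  show ?thesis
    unfolding left_diff_distrib Cq Cp Om_def sum_subtractf[symmetric] using pq
    by (intro sum.cong refl) (simp add: E_U F_U ring_distribs)
qed

end

section \<open>Linear operators on free vector spaces\<close>

abbreviation scl :: "complex \<Rightarrow> ('a \<Rightarrow>\<^sub>0 complex) \<Rightarrow> 'a \<Rightarrow>\<^sub>0 complex" where
  "scl c \<equiv> Poly_Mapping.map ((*) c)"

lemma lookup_scl [simp]: "Poly_Mapping.lookup (scl c u) w = c * Poly_Mapping.lookup u w"
  by (simp add: Poly_Mapping.map.rep_eq when_def)

interpretation pm: vector_space scl
  by standard (auto intro!: poly_mapping_eqI simp: lookup_add algebra_simps)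

interpretation pmp: vector_space_pair scl scl ..

abbreviation lin :: "(('a \<Rightarrow>\<^sub>0 complex) \<Rightarrow> ('b \<Rightarrow>\<^sub>0 complex)) \<Rightarrow> bool" where
  "lin \<equiv> Vector_Spaces.linear scl scl"

lemma linI: "(\<And>u v. f (u + v) = f u + f v) \<Longrightarrow> (\<And>c u. f (scl c u) = scl c (f u)) \<Longrightarrow> lin f"
  by (rule Vector_Spaces.linear_iff[THEN iffD2]) (auto intro: pm.vector_space_axioms)

lemma linD: assumes "lin f"
  shows "f (u + v) = f u + f v" "f (scl c u) = scl c (f u)" "f 0 = 0" "f (u - v) = f u - f v"
    "f (- u) = - f u" "f (sum g A) = (\<Sum>i\<in>A. f (g i))"
  by (rule pmp.linear_add[OF assms] pmp.linear_scale[OF assms] pmp.linear_0[OF assms]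
      pmp.linear_diff[OF assms] pmp.linear_neg[OF assms] pmp.linear_sum[OF assms])+

lemma scl_single: "scl c (Poly_Mapping.single w a) = Poly_Mapping.single w (c * a)"
  by (rule poly_mapping_eqI) (simp add: lookup_single when_def)

lemma scl_minus_one: "scl (- 1) u = - u"
  by (rule poly_mapping_eqI) simp

lemma poly_mapping_sum_points:
  assumes "finite S" "Poly_Mapping.keys u \<subseteq> S"
  shows "(\<Sum>w\<in>S. scl (Poly_Mapping.lookup u w) (point w)) = u"
proof (rule poly_mapping_eqI)
  fix k
  have "Poly_Mapping.lookup (\<Sum>w\<in>S. scl (Poly_Mapping.lookup u w) (point w)) k
      = (\<Sum>w\<in>S. if w = k then Poly_Mapping.lookup u k else 0)"
    unfolding lookup_sum by (intro sum.cong) (auto simp: lookup_single when_def)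
  then show "Poly_Mapping.lookup (\<Sum>w\<in>S. scl (Poly_Mapping.lookup u w) (point w)) k = Poly_Mapping.lookup u k"
    using assms by (auto simp: in_keys_iff)
qed

lemma span_points: assumes "Poly_Mapping.keys u \<subseteq> S" shows "u \<in> pm.span (point ` S)"
proof -
  have "(\<Sum>w\<in>Poly_Mapping.keys u. scl (Poly_Mapping.lookup u w) (point w)) \<in> pm.span (point ` S)"
    using assms by (intro pm.span_sum pm.span_scale pm.span_base) auto
  then show ?thesis unfolding poly_mapping_sum_points[OF finite_keys order_refl] .
qed

definition lext :: "('a \<Rightarrow> 'b \<Rightarrow>\<^sub>0 complex) \<Rightarrow> ('a \<Rightarrow>\<^sub>0 complex) \<Rightarrow> 'b \<Rightarrow>\<^sub>0 complex" where
  "lext t u = (\<Sum>w\<in>Poly_Mapping.keys u. scl (Poly_Mapping.lookup u w) (t w))"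

lemma lext_superset:
  "finite S \<Longrightarrow> Poly_Mapping.keys u \<subseteq> S \<Longrightarrow> lext t u = (\<Sum>w\<in>S. scl (Poly_Mapping.lookup u w) (t w))"
  unfolding lext_def by (rule sum.mono_neutral_left) (auto simp: in_keys_iff)

lemma lext_point [simp]: "lext t (point w) = t w"
  by (simp add: lext_def)

lemma lin_lext: "lin (lext t)"
proof (rule linI)
  fix u v :: "'a \<Rightarrow>\<^sub>0 complex"
  let ?S = "Poly_Mapping.keys u \<union> Poly_Mapping.keys v"
  have "lext t x = (\<Sum>w\<in>?S. scl (Poly_Mapping.lookup x w) (t w))" if "x \<in> {u, v, u + v}" for x
    using that Poly_Mapping.keys_add[of u v] by (intro lext_superset) auto
  then show "lext t (u + v) = lext t u + lext t v"
    by (simp add: lookup_add pm.scale_left_distrib sum.distrib)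
next
  fix c u
  have "lext t (scl c u) = (\<Sum>w\<in>Poly_Mapping.keys u. scl (Poly_Mapping.lookup (scl c u) w) (t w))"
    by (intro lext_superset) (auto simp: in_keys_iff)
  then show "lext t (scl c u) = scl c (lext t u)"
    by (simp add: lext_def pm.scale_sum_right)
qed

text \<open>
  A projection onto a complement of \<open>R\<close> in \<open>U\<close>, extended by zero on a complement of \<open>U\<close>: it
  chooses a representative of each coset of \<open>R\<close> in \<open>U\<close>, linearly.  A basis adapted to
  $R \subseteq U$ provides it.
\<close>

lemma exists_linear_section:
  assumes R: "pm.subspace R" and U: "pm.subspace U" and RU: "R \<subseteq> U"
  shows "\<exists>\<rho>. lin \<rho> \<and> (\<forall>u\<in>U. \<rho> u - u \<in> R) \<and> (\<forall>r\<in>R. \<rho> r = 0) \<and> range \<rho> \<subseteq> U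
    \<and> (\<forall>w. \<rho> (\<rho> w) = \<rho> w)"
proof -
  obtain B where B: "B \<subseteq> R" "pm.independent B" "R \<subseteq> pm.span B"
    using pm.maximal_independent_subset_extend[of "{}" R] pm.independent_empty by auto
  obtain B' where B': "B \<subseteq> B'" "B' \<subseteq> U" "pm.independent B'" "U \<subseteq> pm.span B'"
    using pm.maximal_independent_subset_extend[of B U] B RU by (metis subset_trans)
  obtain \<rho> where \<rho>: "lin \<rho>" "\<And>x. x \<in> B' \<Longrightarrow> \<rho> x = (if x \<in> B then 0 else x)"
     "range \<rho> = pm.span ((\<lambda>x. if x \<in> B then 0 else x) ` B')"
    using pmp.linear_independent_extend_subspace[OF B'(3), of "\<lambda>x. if x \<in> B then 0 else x"] by blast
  have "\<rho> u - u \<in> R" if "u \<in> U" for u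
  proof -
    have "u \<in> pm.span B'" using that B' by auto
    then show ?thesis
    proof (induction rule: pm.span_induct_alt)
      case base
      show ?case using R by (simp add: linD[OF \<rho>(1)] pm.subspace_0)
    next
      case (step c x y)
      have "\<rho> x - x \<in> R" using B R step(1) \<rho>(2)[of x] by (auto simp: pm.subspace_0 pm.subspace_neg)
      moreover have "\<rho> (scl c x + y) - (scl c x + y) = scl c (\<rho> x - x) + (\<rho> y - y)"
        by (simp add: linD[OF \<rho>(1)] pm.scale_right_diff_distrib)
      ultimately show ?case using R step(2) by (metis pm.subspace_add pm.subspace_scale)
    qed
  qed
  moreover have "\<rho> u = 0" if "u \<in> R" for u
  proof -
    have "u \<in> pm.span B" using that B by auto
    then show ?thesis
      by (induction rule: pm.span_induct_alt) (use \<rho> B' in \<open>auto simp: linD[OF \<rho>(1)]\<close>)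
  qed
  moreover have "range \<rho> \<subseteq> U"
    unfolding \<rho>(3) by (rule pm.span_minimal) (use B' U in \<open>auto simp: pm.subspace_0\<close>)
  moreover have "\<rho> (\<rho> w) = \<rho> w" for w
  proof -
    have "\<rho> w \<in> pm.span ((\<lambda>x. if x \<in> B then 0 else x) ` B')" using \<rho>(3) by auto
    then show ?thesis
    proof (induction rule: pm.span_induct_alt)
      case (step c x y)
      have "\<rho> x = x" using step(1) \<rho>(2) linD(3)[OF \<rho>(1)] by (auto split: if_splits)
      then show ?case using step(2) by (simp add: linD[OF \<rho>(1)])
    qed (rule linD(3)[OF \<rho>(1)])
  qed
  ultimately show ?thesis using \<rho>(1) by blast
qed

text \<open>
  As a type with a ring structure, so that identities between operators can be proved by
  rewriting in rings.
\<close>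

typedef 'a linop = "{f :: ('a \<Rightarrow>\<^sub>0 complex) \<Rightarrow> ('a \<Rightarrow>\<^sub>0 complex). lin f}"
  morphisms ap Linop
  by (rule exI[of _ "\<lambda>u. 0"]) (auto intro: linI)

setup_lifting type_definition_linop

instantiation linop :: (type) ring_1
begin
lift_definition zero_linop :: "'a linop" is "\<lambda>u. 0" by (auto intro: linI)
lift_definition one_linop :: "'a linop" is "\<lambda>u. u" by (auto intro: linI)
lift_definition plus_linop :: "'a linop \<Rightarrow> 'a linop \<Rightarrow> 'a linop" is "\<lambda>f g u. f u + g u"
  by (rule linI) (auto simp: linD pm.scale_right_distrib)
lift_definition minus_linop :: "'a linop \<Rightarrow> 'a linop \<Rightarrow> 'a linop" is "\<lambda>f g u. f u - g u"
  by (rule linI) (auto simp: linD pm.scale_right_diff_distrib)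
lift_definition uminus_linop :: "'a linop \<Rightarrow> 'a linop" is "\<lambda>f u. - f u"
  by (rule linI) (auto simp: linD)
lift_definition times_linop :: "'a linop \<Rightarrow> 'a linop \<Rightarrow> 'a linop" is "\<lambda>f g u. f (g u)"
  by (rule linI) (auto simp: linD)
instance
proof
  show "(0::'a linop) \<noteq> 1"
  proof
    assume "(0::'a linop) = 1"
    then have "ap (0::'a linop) (point undefined) = ap 1 (point undefined)" by simp
    then have "(0 :: 'a \<Rightarrow>\<^sub>0 complex) = point undefined" by (simp add: zero_linop.rep_eq one_linop.rep_eq)
    then show False by (metis lookup_single_eq lookup_zero one_neq_zero)
  qed
qed (transfer; auto simp: linD)+
end

lift_definition scal :: "complex \<Rightarrow> 'a linop" is "scl"
  by (rule linI) (auto simp: pm.scale_right_distrib mult.commute)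

lemmas ap_simps [simp] = zero_linop.rep_eq one_linop.rep_eq plus_linop.rep_eq minus_linop.rep_eq
  uminus_linop.rep_eq times_linop.rep_eq scal.rep_eq

lemma lin_ap [simp]: "lin (ap x)" using ap by auto

lemmas ap_lin = linD[OF lin_ap]

lemma ap_sum [simp]: "ap (sum f A) u = (\<Sum>i\<in>A. ap (f i) u)"
  by (induction A rule: infinite_finite_induct) auto

lemma linop_eqI: "(\<And>u. ap x u = ap y u) \<Longrightarrow> x = y"
  by (simp add: ap_inject[symmetric] fun_eq_iff)

lemma scal_commute: "x * scal c = scal c * x"
  by (rule linop_eqI) (simp add: ap_lin)

lemma scal_simps: "scal (a + b) = scal a + scal b" "scal (a * b) = scal a * scal b" "scal 1 = 1" "scal 0 = 0"
    "scal (- a) = - scal a"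
  by (rule linop_eqI; simp add: pm.scale_left_distrib)+

section \<open>Quotients of free vector spaces\<close>

lemma submodule_iff_subspace:
  fixes A :: "(complex, 'a \<Rightarrow>\<^sub>0 complex, 'b) module_scheme"
  assumes A: "add A = (+)" "zero A = 0" "smult A = scl" "pm.subspace (carrier A)"
  shows "submodule H complex_ring A \<longleftrightarrow> pm.subspace H \<and> H \<subseteq> carrier A"
proof
  assume *: "submodule H complex_ring A"
  then interpret subgroup H "add_monoid A" by (simp add: submodule_def)
  from * have "scl c u \<in> H" if "u \<in> H" for c u
    using that A by (auto simp: submodule_def submodule_axioms_def complex_ring_def)
  then show "pm.subspace H \<and> H \<subseteq> carrier A"
    using m_closed one_closed subset A by (auto simp: pm.subspace_def)
next
  assume *: "pm.subspace H \<and> H \<subseteq> carrier A"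
  have "inv\<^bsub>add_monoid A\<^esub> x = - x" if "x \<in> carrier A" for x
    unfolding m_inv_def using that A pm.subspace_neg[OF A(4)]
    by (intro the_equality) (auto simp: eq_neg_iff_add_eq_0 add.commute)
  then show "submodule H complex_ring A"
    using A * by (auto simp: submodule_def submodule_axioms_def subgroup_def pm.subspace_def[of H] pm.subspace_neg)
qed

lemma lin_span_eq_span:
  fixes A :: "(complex, 'a \<Rightarrow>\<^sub>0 complex, 'b) module_scheme"
  assumes A: "add A = (+)" "zero A = 0" "smult A = scl" "pm.subspace (carrier A)" "X \<subseteq> carrier A"
  shows "lin_span A X = pm.span X"
proof -
  have "pm.span X \<subseteq> carrier A" using A by (intro pm.span_minimal)
  then have "pm.span X \<in> {H. (pm.subspace H \<and> H \<subseteq> carrier A) \<and> X \<subseteq> H}"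
    by (auto intro: pm.span_base)
  then show ?thesis
    unfolding lin_span_def submodule_iff_subspace[OF A(1-4)] using pm.span_minimal by blast
qed

text \<open>
  Both the tensor product and $\mathcal H_d$ are quotients of a subspace of a free vector space, with
  the quotient operations of \<^const>\<open>quot_module\<close>; the coset map \<open>cls\<close> reduces them to operations on
  representatives.
\<close>

locale pm_quot =
  fixes A :: "(complex, 'a \<Rightarrow>\<^sub>0 complex, 'b) module_scheme" and I :: "('a \<Rightarrow>\<^sub>0 complex) set"
  assumes add_A: "add A = (+)" and zero_A: "zero A = 0" and smult_A: "smult A = scl"
    and sub_A: "pm.subspace (carrier A)" and sub_I: "pm.subspace I" and I_A: "I \<subseteq> carrier A"
begin

definition cls :: "('a \<Rightarrow>\<^sub>0 complex) \<Rightarrow> ('a \<Rightarrow>\<^sub>0 complex) set" where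
  "cls u = I +>\<^bsub>A\<^esub> u"

abbreviation "Q \<equiv> quot_module A I"

lemma cls_mem: "x \<in> cls u \<longleftrightarrow> x - u \<in> I"
  unfolding cls_def a_r_coset_def r_coset_def
  by (auto simp: add_A intro: bexI[of _ "x - u"])

lemma cls_eq: "cls u = cls v \<longleftrightarrow> u - v \<in> I"
proof
  assume "cls u = cls v"
  then have "u \<in> cls v" using cls_mem[of u u] pm.subspace_0[OF sub_I] by simp
  then show "u - v \<in> I" by (simp add: cls_mem)
next
  assume uv: "u - v \<in> I"
  have "x - u \<in> I \<longleftrightarrow> x - v \<in> I" for x
    using pm.subspace_add[OF sub_I, of "x - u" "u - v"] pm.subspace_diff[OF sub_I, of "x - v" "u - v"] uv
    by auto
  then show "cls u = cls v" by (auto simp: cls_mem)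
qed

lemma self_in_cls: "u \<in> cls u" using cls_mem[of u u] pm.subspace_0[OF sub_I] by simp

lemma carrier_Q: "carrier Q = cls ` carrier A"
  by (auto simp: quot_module_def ring.defs module.defs FactRing_simps cls_def)

lemma add_Q: "cls u \<oplus>\<^bsub>Q\<^esub> cls v = cls (u + v)"
proof -
  have "cls u \<oplus>\<^bsub>Q\<^esub> cls v = (\<Union>x\<in>cls u. \<Union>y\<in>cls v. {x + y})"
    by (simp add: quot_module_def ring.defs FactRing_def set_add_def set_mult_def add_A)
  also have "\<dots> = cls (u + v)"
  proof (intro equalityI subsetI)
    fix x assume "x \<in> (\<Union>x\<in>cls u. \<Union>y\<in>cls v. {x + y})"
    then show "x \<in> cls (u + v)"
      using pm.subspace_add[OF sub_I] by (auto simp: cls_mem) (metis add_diff_add)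
  next
    fix x assume "x \<in> cls (u + v)"
    then have "x - v \<in> cls u" "v \<in> cls v" "x = (x - v) + v"
      by (auto simp: cls_mem self_in_cls algebra_simps pm.subspace_0[OF sub_I])
    then show "x \<in> (\<Union>x\<in>cls u. \<Union>y\<in>cls v. {x + y})" by blast
  qed
  finally show ?thesis .
qed

lemma zero_Q: "\<zero>\<^bsub>Q\<^esub> = cls 0"
  by (auto simp: quot_module_def ring.defs FactRing_def cls_mem)

lemma smult_Q: "c \<odot>\<^bsub>Q\<^esub> cls u = cls (scl c u)"
proof -
  have "c \<odot>\<^bsub>Q\<^esub> cls u = (\<Union>x\<in>cls u. cls (scl c x))"
    by (simp add: quot_module_def ring.defs module.defs smult_A cls_def)
  also have "\<dots> = (\<Union>x\<in>cls u. cls (scl c u))"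
    using pm.subspace_scale[OF sub_I] by (intro SUP_cong refl) (simp add: cls_eq cls_mem pm.scale_right_diff_distrib[symmetric])
  finally show ?thesis using self_in_cls by blast
qed

lemma one_Q: "\<one>\<^bsub>Q\<^esub> = cls \<one>\<^bsub>A\<^esub>"
  by (simp add: quot_module_def ring.defs FactRing_def cls_def)

lemma carrier_mem [simp, intro]: "u \<in> carrier A \<Longrightarrow> cls u \<in> carrier Q"
  by (simp add: carrier_Q)

lemmas sub = pm.subspace_add[OF sub_A] pm.subspace_scale[OF sub_A] pm.subspace_0[OF sub_A] pm.subspace_neg[OF sub_A]

lemma module_Q: "Module.module complex_ring Q"
proof (rule moduleI)
  show "cring complex_ring"
    by (rule cringI)
      (auto simp: complex_ring_def algebra_simps intro!: abelian_groupI comm_monoidI exI[of _ "- _"])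
  show "abelian_group Q"
  proof (rule abelian_groupI)
    fix x assume "x \<in> carrier Q"
    then obtain u where "x = cls u" "u \<in> carrier A" by (auto simp: carrier_Q)
    then show "\<exists>y\<in>carrier Q. y \<oplus>\<^bsub>Q\<^esub> x = \<zero>\<^bsub>Q\<^esub>"
      by (intro bexI[of _ "cls (- u)"]) (auto simp: add_Q zero_Q sub)
  qed (auto simp: carrier_Q add_Q zero_Q sub add_ac intro!: imageI)
qed (auto simp: carrier_Q add_Q smult_Q sub complex_ring_def pm.scale_left_distrib pm.scale_right_distrib)

lemma abelian_group_Q: "abelian_group Q" using module_Q by (simp add: Module.module_def)

lemma finsum_Q:
  assumes "finite S" "\<And>i. i \<in> S \<Longrightarrow> f i \<in> carrier A"
  shows "finsum Q (\<lambda>i. cls (f i)) S = cls (sum f S)"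
proof -
  interpret abelian_group Q by (rule abelian_group_Q)
  show ?thesis using assms
    by (induction S rule: finite_induct) (auto simp: zero_Q add_Q)
qed

lemma minus_Q:
  assumes "u \<in> carrier A" "v \<in> carrier A"
  shows "cls u \<ominus>\<^bsub>Q\<^esub> cls v = cls (u - v)"
proof -
  interpret abelian_group Q by (rule abelian_group_Q)
  have "- v \<in> carrier A" using assms pm.subspace_neg[OF sub_A] by auto
  then have "\<ominus>\<^bsub>Q\<^esub> cls v = cls (- v)"
    using assms by (intro minus_equality) (auto simp: add_Q zero_Q)
  then show ?thesis by (simp add: a_minus_def add_Q)
qed

end

section \<open>The parity involution of a super vector space\<close>

lemma complex_ring_simps [simp]:
  "carrier complex_ring = UNIV" "a \<otimes>\<^bsub>complex_ring\<^esub> b = a * b" "\<one>\<^bsub>complex_ring\<^esub> = 1"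
  "\<zero>\<^bsub>complex_ring\<^esub> = 0" "a \<oplus>\<^bsub>complex_ring\<^esub> b = a + b"
  by (simp_all add: complex_ring_def)

lemma psign_simps [simp]: "psign 0 = 1" "psign 1 = - 1" "psign x * psign x = 1" "psign x * (psign x * c) = c"
  by (simp_all add: psign_def)

lemma psign_add: "psign (x + y) = psign x * psign y"
  by (cases x; cases y) (simp_all add: psign_def)

locale cmodule = Module.module complex_ring W for W :: "(complex, 'a, 'b) module_scheme"
begin

lemma smult_simps:
  "c \<odot>\<^bsub>W\<^esub> x \<in> carrier W" "c \<odot>\<^bsub>W\<^esub> (c' \<odot>\<^bsub>W\<^esub> x) = (c * c') \<odot>\<^bsub>W\<^esub> x" "1 \<odot>\<^bsub>W\<^esub> x = x"
  "0 \<odot>\<^bsub>W\<^esub> x = \<zero>\<^bsub>W\<^esub>" if "x \<in> carrier W"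
  using that smult_assoc1[of c c' x] smult_one[of x] smult_l_null[of x] by simp_all

lemma smult_distribs:
  "c \<odot>\<^bsub>W\<^esub> (x \<oplus>\<^bsub>W\<^esub> y) = c \<odot>\<^bsub>W\<^esub> x \<oplus>\<^bsub>W\<^esub> c \<odot>\<^bsub>W\<^esub> y"
  "(c + c') \<odot>\<^bsub>W\<^esub> x = c \<odot>\<^bsub>W\<^esub> x \<oplus>\<^bsub>W\<^esub> c' \<odot>\<^bsub>W\<^esub> x" if "x \<in> carrier W" "y \<in> carrier W"
  using that smult_r_distr[of c x y] smult_l_distr[of c c' x] by simp_all

lemma a_inv_smult: "x \<in> carrier W \<Longrightarrow> \<ominus>\<^bsub>W\<^esub> x = (- 1) \<odot>\<^bsub>W\<^esub> x"
  using smult_distribs(2)[of x x "- 1" 1] by (intro minus_equality) (simp_all add: smult_simps)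

lemma minus_smult: "x \<in> carrier W \<Longrightarrow> y \<in> carrier W \<Longrightarrow> x \<ominus>\<^bsub>W\<^esub> y = x \<oplus>\<^bsub>W\<^esub> (- 1) \<odot>\<^bsub>W\<^esub> y"
  by (simp add: a_minus_def a_inv_smult)

end

text \<open>
  In contrast to \<^const>\<open>linear_maps\<close>, the values outside the carrier are arbitrary, so that such maps
  are closed under ordinary composition.
\<close>

definition mod_lin :: "(complex, 'a, 'b) module_scheme \<Rightarrow> ('a \<Rightarrow> 'a) \<Rightarrow> bool" where
  "mod_lin W f \<longleftrightarrow> f \<in> carrier W \<rightarrow> carrier W
     \<and> (\<forall>x\<in>carrier W. \<forall>y\<in>carrier W. f (x \<oplus>\<^bsub>W\<^esub> y) = f x \<oplus>\<^bsub>W\<^esub> f y)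
     \<and> (\<forall>c. \<forall>x\<in>carrier W. f (c \<odot>\<^bsub>W\<^esub> x) = c \<odot>\<^bsub>W\<^esub> f x)"

lemma mod_linD:
  assumes "mod_lin W f" "x \<in> carrier W"
  shows "f x \<in> carrier W" "y \<in> carrier W \<Longrightarrow> f (x \<oplus>\<^bsub>W\<^esub> y) = f x \<oplus>\<^bsub>W\<^esub> f y"
    "f (c \<odot>\<^bsub>W\<^esub> x) = c \<odot>\<^bsub>W\<^esub> f x"
  using assms by (auto simp: mod_lin_def)

lemma mod_lin_id: "mod_lin W id" "mod_lin W (\<lambda>x. x)" by (auto simp: mod_lin_def)

lemma mod_lin_comp: "mod_lin W f \<Longrightarrow> mod_lin W g \<Longrightarrow> mod_lin W (f \<circ> g)"
  unfolding mod_lin_def by (auto simp: Pi_iff)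

locale super_mod = fixes W :: "('a, 'b) superspace_scheme" assumes super: "super_space W"
begin

sublocale cmodule W
  using super by (simp add: super_space_def cmodule_def)

lemma homog_sub: "submodule (homog W p) complex_ring W"
  using super by (simp add: super_space_def)

lemma homog_carrier: "x \<in> homog W p \<Longrightarrow> x \<in> carrier W"
  using submoduleE(1)[OF homog_sub] by auto

lemma homog_add: "x \<in> homog W p \<Longrightarrow> y \<in> homog W p \<Longrightarrow> x \<oplus>\<^bsub>W\<^esub> y \<in> homog W p"
  using submoduleE(5)[OF homog_sub] by auto

lemma homog_smult: "x \<in> homog W p \<Longrightarrow> c \<odot>\<^bsub>W\<^esub> x \<in> homog W p"
  using submoduleE(4)[OF homog_sub] by auto

lemma homog_decomp: "x \<in> carrier W \<Longrightarrow> \<exists>a\<in>homog W 0. \<exists>b\<in>homog W 1. x = a \<oplus>\<^bsub>W\<^esub> b"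
  using super by (auto simp: super_space_def set_add_def set_mult_def)

lemma homog_unique:
  assumes "a \<in> homog W 0" "a' \<in> homog W 0" "b \<in> homog W 1" "b' \<in> homog W 1"
    "a \<oplus>\<^bsub>W\<^esub> b = a' \<oplus>\<^bsub>W\<^esub> b'"
  shows "a = a' \<and> b = b'"
proof -
  note [simp] = homog_carrier[OF assms(1)] homog_carrier[OF assms(2)] homog_carrier[OF assms(3)] homog_carrier[OF assms(4)]
  have "a \<ominus>\<^bsub>W\<^esub> a' = b' \<ominus>\<^bsub>W\<^esub> b"
  proof -
    have "(a \<ominus>\<^bsub>W\<^esub> a') \<oplus>\<^bsub>W\<^esub> (a' \<oplus>\<^bsub>W\<^esub> b) = a \<oplus>\<^bsub>W\<^esub> b"
      by (simp add: a_minus_def a_assoc r_neg1 l_neg r_neg2)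
    moreover have "(b' \<ominus>\<^bsub>W\<^esub> b) \<oplus>\<^bsub>W\<^esub> (a' \<oplus>\<^bsub>W\<^esub> b) = a' \<oplus>\<^bsub>W\<^esub> b'"
      by (simp add: a_minus_def a_assoc a_comm[of a' b] a_comm[of a' b'] r_neg1 r_neg2 l_neg)
    ultimately show ?thesis using assms(5)
        by (simp add: add.right_cancel[of "a' \<oplus>\<^bsub>W\<^esub> b" "a \<ominus>\<^bsub>W\<^esub> a'" "b' \<ominus>\<^bsub>W\<^esub> b", symmetric])
  qed
  moreover have "a \<ominus>\<^bsub>W\<^esub> a' \<in> homog W 0" "b' \<ominus>\<^bsub>W\<^esub> b \<in> homog W 1"
    using assms by (simp_all add: minus_smult homog_add homog_smult)
  ultimately have "a \<ominus>\<^bsub>W\<^esub> a' \<in> {\<zero>\<^bsub>W\<^esub>}" "b' \<ominus>\<^bsub>W\<^esub> b \<in> {\<zero>\<^bsub>W\<^esub>}"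
    using super by (auto simp: super_space_def)
  moreover have "(a \<ominus>\<^bsub>W\<^esub> a') \<oplus>\<^bsub>W\<^esub> a' = a" "(b' \<ominus>\<^bsub>W\<^esub> b) \<oplus>\<^bsub>W\<^esub> b = b'"
    by (simp_all add: a_minus_def a_assoc l_neg)
  ultimately show ?thesis by simp
qed

lemma mod_lin_eqI:
  assumes "mod_lin W f" "mod_lin W g" "\<And>p x. x \<in> homog W p \<Longrightarrow> f x = g x" "x \<in> carrier W"
  shows "f x = g x"
  using homog_decomp[OF assms(4)] assms(1-3) homog_carrier by (auto simp: mod_lin_def)

lemma mod_lin_smult: "mod_lin W f \<Longrightarrow> mod_lin W (\<lambda>x. c \<odot>\<^bsub>W\<^esub> f x)"
  by (auto simp: mod_lin_def smult_simps smult_distribs Pi_iff mult.commute)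

lemma mod_lin_add: "mod_lin W f \<Longrightarrow> mod_lin W g \<Longrightarrow> mod_lin W (\<lambda>x. f x \<oplus>\<^bsub>W\<^esub> g x)"
  by (auto simp: mod_lin_def smult_simps smult_distribs Pi_iff a_ac)

text \<open>
  The involution $x_0 + x_1 \mapsto x_0 - x_1$; uniqueness of the decomposition makes it linear.
\<close>

lemma exists_parity: "\<exists>\<sigma>. mod_lin W \<sigma> \<and> (\<forall>p. \<forall>x\<in>homog W p. \<sigma> x = psign p \<odot>\<^bsub>W\<^esub> x)"
proof -
  obtain e o' where eo: "\<And>x. x \<in> carrier W \<Longrightarrow> e x \<in> homog W 0 \<and> o' x \<in> homog W 1 \<and> x = e x \<oplus>\<^bsub>W\<^esub> o' x"
    using homog_decomp by metis
  define \<sigma> where "\<sigma> x = e x \<oplus>\<^bsub>W\<^esub> (- 1) \<odot>\<^bsub>W\<^esub> o' x" for x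
  have \<sigma>: "\<sigma> (a \<oplus>\<^bsub>W\<^esub> b) = a \<oplus>\<^bsub>W\<^esub> (- 1) \<odot>\<^bsub>W\<^esub> b" if "a \<in> homog W 0" "b \<in> homog W 1" for a b
    using homog_unique[of "e (a \<oplus>\<^bsub>W\<^esub> b)" a "o' (a \<oplus>\<^bsub>W\<^esub> b)" b] eo[of "a \<oplus>\<^bsub>W\<^esub> b"] that homog_carrier
    by (auto simp: \<sigma>_def)
  have z: "\<zero>\<^bsub>W\<^esub> \<in> homog W p" for p using super by (cases p) (auto simp: super_space_def)
  have "mod_lin W \<sigma>"
    unfolding mod_lin_def
  proof (intro conjI ballI allI)
    show "\<sigma> \<in> carrier W \<rightarrow> carrier W"
      using eo homog_carrier by (fastforce simp: \<sigma>_def smult_simps)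
  next
    fix x y assume xy: "x \<in> carrier W" "y \<in> carrier W"
    obtain a b where ab: "a \<in> homog W 0" "b \<in> homog W 1" "x = a \<oplus>\<^bsub>W\<^esub> b" using homog_decomp xy by blast
    obtain c d where cd: "c \<in> homog W 0" "d \<in> homog W 1" "y = c \<oplus>\<^bsub>W\<^esub> d" using homog_decomp xy by blast
    note [simp] = ab(1,2)[THEN homog_carrier] cd(1,2)[THEN homog_carrier]
    have "x \<oplus>\<^bsub>W\<^esub> y = (a \<oplus>\<^bsub>W\<^esub> c) \<oplus>\<^bsub>W\<^esub> (b \<oplus>\<^bsub>W\<^esub> d)" by (simp add: ab cd a_ac)
    then have "\<sigma> (x \<oplus>\<^bsub>W\<^esub> y) = (a \<oplus>\<^bsub>W\<^esub> c) \<oplus>\<^bsub>W\<^esub> (- 1) \<odot>\<^bsub>W\<^esub> (b \<oplus>\<^bsub>W\<^esub> d)"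
      using ab cd by (simp only: \<sigma> homog_add)
    then show "\<sigma> (x \<oplus>\<^bsub>W\<^esub> y) = \<sigma> x \<oplus>\<^bsub>W\<^esub> \<sigma> y"
      using ab cd by (simp add: \<sigma> smult_distribs smult_simps a_ac)
  next
    fix c x assume x: "x \<in> carrier W"
    obtain a b where ab: "a \<in> homog W 0" "b \<in> homog W 1" "x = a \<oplus>\<^bsub>W\<^esub> b" using homog_decomp x by blast
    note [simp] = ab(1,2)[THEN homog_carrier]
    show "\<sigma> (c \<odot>\<^bsub>W\<^esub> x) = c \<odot>\<^bsub>W\<^esub> \<sigma> x"
      using ab \<sigma>[of "c \<odot>\<^bsub>W\<^esub> a" "c \<odot>\<^bsub>W\<^esub> b"] by (simp add: \<sigma> smult_distribs smult_simps homog_smult mult.commute)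
  qed
  moreover have "\<sigma> x = psign p \<odot>\<^bsub>W\<^esub> x" if x: "x \<in> homog W p" for p x
  proof (cases "p = 0")
    case True
    then show ?thesis using \<sigma>[of x "\<zero>\<^bsub>W\<^esub>"] x z[of 1] homog_carrier[OF x] smult_r_null[of "- 1"]
      by (simp add: smult_simps)
  next
    case False
    then have "p = 1" by simp
    then show ?thesis using \<sigma>[of "\<zero>\<^bsub>W\<^esub>" x] x z[of 0] homog_carrier[OF x]
      by (simp add: smult_simps)
  qed
  ultimately show ?thesis by blast
qed

definition \<sigma> :: "'a \<Rightarrow> 'a" where
  "\<sigma> = (SOME \<sigma>. mod_lin W \<sigma> \<and> (\<forall>p. \<forall>x\<in>homog W p. \<sigma> x = psign p \<odot>\<^bsub>W\<^esub> x))"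

lemma mod_lin_\<sigma>: "mod_lin W \<sigma>" and \<sigma>_homog: "x \<in> homog W p \<Longrightarrow> \<sigma> x = psign p \<odot>\<^bsub>W\<^esub> x"
  using someI_ex[OF exists_parity] by (auto simp: \<sigma>_def)

lemma \<sigma>_\<sigma>: assumes "x \<in> carrier W" shows "\<sigma> (\<sigma> x) = x"
proof -
  have "(\<sigma> \<circ> \<sigma>) x = id x"
    using assms mod_lin_comp[OF mod_lin_\<sigma> mod_lin_\<sigma>] mod_lin_id(1)
    by (rule mod_lin_eqI[rotated 3]) (auto simp: \<sigma>_homog homog_carrier smult_simps mod_linD[OF mod_lin_\<sigma>])
  then show ?thesis by simp
qed

text \<open>
  All signs that come from operators on $M$ and $N$ are obtained from this rule.
\<close>

lemma \<sigma>_commute: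
  assumes "mod_lin W f" "\<And>q. f ` homog W q \<subseteq> homog W (t + q)" "x \<in> carrier W"
  shows "f (\<sigma> x) = psign t \<odot>\<^bsub>W\<^esub> \<sigma> (f x)"
proof -
  have "(f \<circ> \<sigma>) y = psign t \<odot>\<^bsub>W\<^esub> (\<sigma> \<circ> f) y" if y: "y \<in> homog W q" for q y
  proof -
    have f: "f y \<in> homog W (t + q)" using assms(2) y by auto
    show ?thesis
      using mod_linD(3)[OF assms(1) homog_carrier[OF y]] homog_carrier[OF f]
      by (simp add: \<sigma>_homog[OF y] \<sigma>_homog[OF f] smult_simps psign_add)
  qed
  then have "(f \<circ> \<sigma>) x = psign t \<odot>\<^bsub>W\<^esub> (\<sigma> \<circ> f) x"
    by (rule mod_lin_eqI[OF mod_lin_comp mod_lin_smult[OF mod_lin_comp] _ assms(3),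
        OF assms(1) mod_lin_\<sigma> mod_lin_\<sigma> assms(1)])
  then show ?thesis by simp
qed

end

section \<open>A linear section of the tensor product\<close>

lemma matrix_smult_vector:
  "(\<chi> i j. c * A $ i $ j) *v x = c *s (A *v (x :: complex ^ 'n))"
  by (simp add: vec_eq_iff matrix_vector_mult_def sum_distrib_left mult.assoc)

type_synonym ('m, 'n, 'k) tensor_tuple = "'m \<times> 'n \<times> 'k vec2 list"

text \<open>
  One operator for each of the three kinds of factors.  At position $0$ only the first component
  matters, at position $1$ the second one, and at later positions the third one; with this
  convention one function from positions to local operators describes a tensor product of operators.
\<close>

type_synonym ('m, 'n, 'k) local_op = "('m \<Rightarrow> 'm) \<times> ('n \<Rightarrow> 'n) \<times> 'k mat2"

locale tensor =
  fixes M :: "(('k::finite) mat2, 'm) qmodule" and N :: "('k mat2, 'n) qmodule" and d :: nat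
  assumes qM: "q_module M" and qN: "q_module N"
begin

sublocale sM: super_mod M using qM by (simp add: super_mod_def q_module_def)
sublocale sN: super_mod N using qN by (simp add: super_mod_def q_module_def)

abbreviation "tup \<equiv> tuples M N d"
abbreviation "FS \<equiv> free_space M N d"
abbreviation "RR \<equiv> tensor_relations M N d"

lemma FS_simps: "add FS = (+)" "zero FS = 0" "smult FS = scl" "carrier FS = {u. Poly_Mapping.keys u \<subseteq> tup}"
  by (simp_all add: free_space_def)

lemma subspace_FS: "pm.subspace (carrier FS)"
  unfolding FS_simps
proof (rule pm.subspaceI)
  fix x y :: "('m, 'n, 'k) tensor_tuple \<Rightarrow>\<^sub>0 complex"
  assume "x \<in> {u. Poly_Mapping.keys u \<subseteq> tup}" "y \<in> {u. Poly_Mapping.keys u \<subseteq> tup}"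
  then show "x + y \<in> {u. Poly_Mapping.keys u \<subseteq> tup}" using Poly_Mapping.keys_add[of x y] by blast
next
  fix c and x :: "('m, 'n, 'k) tensor_tuple \<Rightarrow>\<^sub>0 complex"
  assume "x \<in> {u. Poly_Mapping.keys u \<subseteq> tup}"
  moreover have "Poly_Mapping.keys (scl c x) \<subseteq> Poly_Mapping.keys x" by (auto simp: in_keys_iff)
  ultimately show "scl c x \<in> {u. Poly_Mapping.keys u \<subseteq> tup}" by blast
qed simp

lemma point_FS: "w \<in> tup \<Longrightarrow> point w \<in> carrier FS" by (simp add: FS_simps)

lemma single_FS: "w \<in> tup \<Longrightarrow> Poly_Mapping.single w c \<in> carrier FS" by (simp add: FS_simps)

lemma relators_FS: "multilin_relators M N d \<subseteq> carrier FS"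
proof
  fix r assume "r \<in> multilin_relators M N d"
  then show "r \<in> carrier FS"
    by cases (simp_all only:, (intro pm.subspace_diff[OF subspace_FS] point_FS single_FS;
        simp add: tuples_def sM.smult_simps sN.smult_simps)+)
qed

lemma RR_eq: "RR = pm.span (multilin_relators M N d)"
  unfolding tensor_relations_def by (rule lin_span_eq_span[OF FS_simps(1-3) subspace_FS relators_FS])

sublocale pm_quot FS RR
proof
  show "pm.subspace RR" unfolding RR_eq by (rule pm.subspace_span)
  show "RR \<subseteq> carrier FS" unfolding RR_eq by (rule pm.span_minimal[OF relators_FS subspace_FS])
qed (rule FS_simps subspace_FS)+

definition rho :: "(('m, 'n, 'k) tensor_tuple \<Rightarrow>\<^sub>0 complex) \<Rightarrow> ('m, 'n, 'k) tensor_tuple \<Rightarrow>\<^sub>0 complex" where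
  "rho = (SOME \<rho>. lin \<rho> \<and> (\<forall>u\<in>carrier FS. \<rho> u - u \<in> RR) \<and> (\<forall>r\<in>RR. \<rho> r = 0) \<and> range \<rho> \<subseteq> carrier FS
    \<and> (\<forall>w. \<rho> (\<rho> w) = \<rho> w))"

lemma rho: "lin rho" "u \<in> carrier FS \<Longrightarrow> rho u - u \<in> RR" "r \<in> RR \<Longrightarrow> rho r = 0" "rho u \<in> carrier FS"
   "rho (rho u) = rho u"
  using someI_ex[OF exists_linear_section[OF sub_I sub_A I_A]] unfolding rho_def[symmetric] by auto

lemmas rho_lin = linD[OF rho(1)]

text \<open>
  \<open>P w\<close> represents the pure tensor of the tuple \<open>w\<close>; unlike \<^term>\<open>point w\<close> it is multilinear in \<open>w\<close>.
\<close>

definition P :: "('m, 'n, 'k) tensor_tuple \<Rightarrow> ('m, 'n, 'k) tensor_tuple \<Rightarrow>\<^sub>0 complex" where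
  "P w = rho (point w)"

lemma cls_rho: "u \<in> carrier FS \<Longrightarrow> cls (rho u) = cls u"
  by (simp add: cls_eq rho)

lemma pure_eq_cls: "pure M N d w = cls (point w)"
  by (simp add: pure_def cls_def)

lemma pure_eq: "w \<in> tup \<Longrightarrow> pure M N d w = cls (P w)"
  by (simp add: pure_eq_cls P_def cls_rho point_FS)

lemma relator_rho: "r \<in> multilin_relators M N d \<Longrightarrow> rho r = 0"
  by (simp add: rho RR_eq pm.span_base)

lemma P_M_add: "(m, n, vs) \<in> tup \<Longrightarrow> m' \<in> carrier M \<Longrightarrow> P (m \<oplus>\<^bsub>M\<^esub> m', n, vs) = P (m, n, vs) + P (m', n, vs)"
  using relator_rho[OF M_add, of m n vs m'] by (simp add: P_def rho_lin algebra_simps)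
lemma P_N_add: "(m, n, vs) \<in> tup \<Longrightarrow> n' \<in> carrier N \<Longrightarrow> P (m, n \<oplus>\<^bsub>N\<^esub> n', vs) = P (m, n, vs) + P (m, n', vs)"
  using relator_rho[OF N_add, of m n vs n'] by (simp add: P_def rho_lin algebra_simps)
lemma P_V_add: "(m, n, vs) \<in> tup \<Longrightarrow> k < d \<Longrightarrow> P (m, n, vs[k := v + v'])
    = P (m, n, vs[k := v]) + P (m, n, vs[k := v'])"
  using relator_rho[OF V_add, of m n vs k v v'] by (simp add: P_def rho_lin algebra_simps)

lemma rho_single: "rho (Poly_Mapping.single w c) = scl c (P w)"
  using scl_single[of c w 1] by (simp add: P_def rho_lin(2)[symmetric])

lemma P_M_smult: "(m, n, vs) \<in> tup \<Longrightarrow> P (c \<odot>\<^bsub>M\<^esub> m, n, vs) = scl c (P (m, n, vs))"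
  using relator_rho[OF M_smult, of m n vs c] by (simp add: rho_lin rho_single flip: P_def)
lemma P_N_smult: "(m, n, vs) \<in> tup \<Longrightarrow> P (m, c \<odot>\<^bsub>N\<^esub> n, vs) = scl c (P (m, n, vs))"
  using relator_rho[OF N_smult, of m n vs c] by (simp add: rho_lin rho_single flip: P_def)
lemma P_V_smult: "(m, n, vs) \<in> tup \<Longrightarrow> k < d \<Longrightarrow> P (m, n, vs[k := c *s v]) = scl c (P (m, n, vs[k := v]))"
  using relator_rho[OF V_smult, of m n vs k c v] by (simp add: rho_lin rho_single flip: P_def)

section \<open>Operators acting factor by factor\<close>

definition loc_comp :: "('m, 'n, 'k) local_op \<Rightarrow> ('m, 'n, 'k) local_op \<Rightarrow> ('m, 'n, 'k) local_op" where
  "loc_comp a b = (fst a \<circ> fst b, fst (snd a) \<circ> fst (snd b), snd (snd a) ** snd (snd b))"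

definition loc_id :: "('m, 'n, 'k) local_op" where "loc_id = (id, id, mat 1)"

definition loc_add :: "('m, 'n, 'k) local_op \<Rightarrow> ('m, 'n, 'k) local_op \<Rightarrow> ('m, 'n, 'k) local_op" where
  "loc_add a b = (\<lambda>m. fst a m \<oplus>\<^bsub>M\<^esub> fst b m, \<lambda>n. fst (snd a) n \<oplus>\<^bsub>N\<^esub> fst (snd b) n, snd (snd a) + snd (snd b))"

definition loc_scale :: "complex \<Rightarrow> ('m, 'n, 'k) local_op \<Rightarrow> ('m, 'n, 'k) local_op" where
  "loc_scale c a = (\<lambda>m. c \<odot>\<^bsub>M\<^esub> fst a m, \<lambda>n. c \<odot>\<^bsub>N\<^esub> fst (snd a) n, \<chi> i j. c * snd (snd a) $ i $ j)"

definition loc_linear :: "nat \<Rightarrow> ('m, 'n, 'k) local_op \<Rightarrow> bool" where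
  "loc_linear p a \<longleftrightarrow> (p = 0 \<longrightarrow> mod_lin M (fst a)) \<and> (p = 1 \<longrightarrow> mod_lin N (fst (snd a)))"

text \<open>
  Agreement of those components that matter at position \<open>p\<close>.
\<close>

definition loc_eq :: "nat \<Rightarrow> ('m, 'n, 'k) local_op \<Rightarrow> ('m, 'n, 'k) local_op \<Rightarrow> bool" where
  "loc_eq p a b \<longleftrightarrow> (p = 0 \<longrightarrow> (\<forall>m\<in>carrier M. fst a m = fst b m))
     \<and> (p = 1 \<longrightarrow> (\<forall>n\<in>carrier N. fst (snd a) n = fst (snd b) n)) \<and> (p \<ge> 2 \<longrightarrow> snd (snd a) = snd (snd b))"

lemma loc_eq_refl [simp]: "loc_eq p a a" by (simp add: loc_eq_def)
lemma loc_eq_sym: "loc_eq p a b \<Longrightarrow> loc_eq p b a" by (auto simp: loc_eq_def)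
lemma loc_eq_trans: "loc_eq p a b \<Longrightarrow> loc_eq p b c \<Longrightarrow> loc_eq p a c" by (auto simp: loc_eq_def)

lemma loc_linear_intros [intro, simp]: "loc_linear p loc_id"
  "loc_linear p a \<Longrightarrow> loc_linear p b \<Longrightarrow> loc_linear p (loc_comp a b)" "loc_linear p a \<Longrightarrow> loc_linear p b
      \<Longrightarrow> loc_linear p (loc_add a b)" "loc_linear p a \<Longrightarrow> loc_linear p (loc_scale c a)"
  by (auto simp: loc_linear_def loc_id_def loc_comp_def loc_add_def loc_scale_def mod_lin_id mod_lin_comp sM.mod_lin_add sN.mod_lin_add sM.mod_lin_smult sN.mod_lin_smult)

lemma loc_id_comp [simp]: "loc_comp loc_id a = a" "loc_comp a loc_id = a"
    by (simp_all add: loc_comp_def loc_id_def)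

text \<open>
  The operator $l_0 \otimes l_1 \otimes \cdots$ on tuples, without any signs.  The entry \<open>k\<close> of the list
  belongs to position \<open>k + 2\<close>.
\<close>

definition tuple_map :: "(nat \<Rightarrow> ('m, 'n, 'k) local_op) \<Rightarrow> ('m, 'n, 'k) tensor_tuple \<Rightarrow> ('m, 'n, 'k) tensor_tuple" where
  "tuple_map l w = (case w of (m, n, vs) \<Rightarrow> (fst (l 0) m, fst (snd (l 1)) n, map (\<lambda>k. snd (snd (l (k + 2))) *v (vs ! k)) [0..<length vs]))"

lemma tuple_map_tuples: "(\<And>p. loc_linear p (l p)) \<Longrightarrow> w \<in> tup \<Longrightarrow> tuple_map l w \<in> tup"
  using mod_linD(1)[of M "fst (l 0)"] mod_linD(1)[of N "fst (snd (l 1))"] unfolding loc_linear_def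
  by (auto simp: tuple_map_def tuples_def)

lemma tuple_map_comp: "tuple_map l (tuple_map l' w) = tuple_map (\<lambda>p. loc_comp (l p) (l' p)) w"
  by (auto simp: tuple_map_def loc_comp_def matrix_vector_mul_assoc split: prod.split)

lemma tuple_map_id: "w \<in> tup \<Longrightarrow> tuple_map (\<lambda>p. loc_id) w = w"
  by (auto simp: tuple_map_def loc_id_def tuples_def map_nth split: prod.split)

lemma tuple_map_cong: "(\<And>p. p < d + 2 \<Longrightarrow> loc_eq p (l p) (l' p)) \<Longrightarrow> w \<in> tup \<Longrightarrow> tuple_map l w = tuple_map l' w"
  unfolding tuple_map_def loc_eq_def tuples_def by (auto split: prod.split)

lemma map_upt_update:
  "k < length vs \<Longrightarrow> map (\<lambda>i. f i (vs[k := x] ! i)) [0..<length vs]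
      = (map (\<lambda>i. f i (vs ! i)) [0..<length vs])[k := f k x]"
  by (rule nth_equalityI) (auto simp: nth_list_update)

text \<open>
  Linear maps in each factor turn a multilinearity relator into a relator of the same kind; this
  makes the induced operator on the tensor product well defined.
\<close>

lemma tuple_map_relator:
  assumes "r \<in> multilin_relators M N d" and ok: "\<And>p. loc_linear p (l p)"
  shows "lext (\<lambda>w. point (tuple_map l w)) r \<in> multilin_relators M N d"
proof -
  let ?f = "lext (\<lambda>w. point (tuple_map l w))"
  have s: "?f (Poly_Mapping.single w c) = Poly_Mapping.single (tuple_map l w) c" for w c
    using linD(2)[OF lin_lext, of "\<lambda>w. point (tuple_map l w)" c "point w"] by (simp add: scl_single)
  have lM: "mod_lin M (fst (l 0))" and lN: "mod_lin N (fst (snd (l (Suc 0))))"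
    using ok[of 0] ok[of 1] by (auto simp: loc_linear_def)
  have t: "tuple_map l (m, n, vs) \<in> tup" if "(m, n, vs) \<in> tup" for m n vs
    using tuple_map_tuples[OF ok] that by blast
  from assms(1) show ?thesis
  proof cases
    case (M_add m n vs m')
    then show ?thesis
      using multilin_relators.M_add[of "fst (l 0) m" "fst (snd (l 1)) n" "map (\<lambda>k. snd (snd (l (k + 2))) *v (vs ! k)) [0..<length vs]"]
        t[OF M_add(2)] mod_linD[OF lM]
      by (auto simp: linD[OF lin_lext] tuple_map_def tuples_def)
  next
    case (M_smult m n vs c)
    have eq: "?f r = point (tuple_map l (c \<odot>\<^bsub>M\<^esub> m, n, vs)) - Poly_Mapping.single (tuple_map l (m, n, vs)) c"
      unfolding M_smult(1) linD[OF lin_lext] s lext_point ..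
    show ?thesis unfolding eq
      using multilin_relators.M_smult[of "fst (l 0) m" "fst (snd (l 1)) n" "map (\<lambda>k. snd (snd (l (k + 2))) *v (vs ! k)) [0..<length vs]"]
        M_smult(2) t[OF M_smult(2)] mod_linD[OF lM]
      by (auto simp: tuple_map_def tuples_def)
  next
    case (N_add m n vs m')
    then show ?thesis
      using multilin_relators.N_add[of "fst (l 0) m" "fst (snd (l 1)) n" "map (\<lambda>k. snd (snd (l (k + 2))) *v (vs ! k)) [0..<length vs]"]
        t[OF N_add(2)] mod_linD[OF lN]
      by (auto simp: linD[OF lin_lext] tuple_map_def tuples_def)
  next
    case (N_smult m n vs c)
    have eq: "?f r = point (tuple_map l (m, c \<odot>\<^bsub>N\<^esub> n, vs)) - Poly_Mapping.single (tuple_map l (m, n, vs)) c"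
      unfolding N_smult(1) linD[OF lin_lext] s lext_point ..
    show ?thesis unfolding eq
      using multilin_relators.N_smult[of "fst (l 0) m" "fst (snd (l 1)) n" "map (\<lambda>k. snd (snd (l (k + 2))) *v (vs ! k)) [0..<length vs]"]
        N_smult(2) t[OF N_smult(2)] mod_linD[OF lN]
      by (auto simp: tuple_map_def tuples_def)
  next
    case (V_add m n vs k v v')
    then show ?thesis
      using multilin_relators.V_add[of "fst (l 0) m" "fst (snd (l 1)) n" "map (\<lambda>k. snd (snd (l (k + 2))) *v (vs ! k)) [0..<length vs]" M N d k
          "snd (snd (l (k + 2))) *v v" "snd (snd (l (k + 2))) *v v'"]
        t[OF V_add(2)] map_upt_update[of k vs "\<lambda>k v. snd (snd (l (k + 2))) *v v"]
      by (auto simp: linD[OF lin_lext] tuple_map_def tuples_def matrix_vector_right_distrib)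
  next
    case (V_smult m n vs k c v)
    have eq: "?f r = point (tuple_map l (m, n, vs[k := c *s v])) - Poly_Mapping.single (tuple_map l (m, n, vs[k := v])) c"
      unfolding V_smult(1) linD[OF lin_lext] s lext_point ..
    show ?thesis unfolding eq
      using multilin_relators.V_smult[of "fst (l 0) m" "fst (snd (l 1)) n" "map (\<lambda>k. snd (snd (l (k + 2))) *v (vs ! k)) [0..<length vs]" M N d k
          c "snd (snd (l (k + 2))) *v v"]
        V_smult(2,3) t[OF V_smult(2)] map_upt_update[of k vs "\<lambda>k v. snd (snd (l (k + 2))) *v v"]
      by (auto simp: tuple_map_def tuples_def vector_scalar_commute)
  qed
qed

lemma tuple_map_RR:
  assumes "r \<in> RR" "\<And>p. loc_linear p (l p)"
  shows "lext (\<lambda>w. point (tuple_map l w)) r \<in> RR"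
  using assms(1) unfolding RR_eq
proof (induction rule: pm.span_induct_alt)
  case (step c x y)
  then show ?case
    using pm.span_base[OF tuple_map_relator[OF step(1) assms(2)]]
        by (simp add: linD[OF lin_lext] pm.span_add pm.span_scale)
qed (simp add: linD[OF lin_lext] pm.span_zero)

definition u :: "('m, 'n, 'k) tensor_tuple linop" where "u = Linop rho"

lemma ap_u [simp]: "ap u w = rho w" by (simp add: u_def Linop_inverse rho)

definition G :: "(nat \<Rightarrow> ('m, 'n, 'k) local_op) \<Rightarrow> ('m, 'n, 'k) tensor_tuple linop" where
  "G l = u * Linop (lext (\<lambda>w. point (tuple_map l w))) * u"

lemma u_u [simp]: "u * u = u" by (rule linop_eqI) (simp add: rho)

text \<open>
  The operators \<open>x\<close> with $u x = x = x u$ for the idempotent $u = \rho$: the ring of endomorphisms of the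
  tensor product, with identity \<open>u\<close>.
\<close>

definition corner :: "('m, 'n, 'k) tensor_tuple linop set" where "corner = {x. u * x = x \<and> x * u = x}"

lemma corner_u: "x \<in> corner \<Longrightarrow> u * x = x" "x \<in> corner \<Longrightarrow> x * u = x"
  by (auto simp: corner_def)

lemma corner_intros [intro, simp]: "u \<in> corner" "0 \<in> corner" "G l \<in> corner"
  "x \<in> corner \<Longrightarrow> y \<in> corner \<Longrightarrow> x + y \<in> corner" "x \<in> corner \<Longrightarrow> y \<in> corner \<Longrightarrow> x - y \<in> corner"
  "x \<in> corner \<Longrightarrow> y \<in> corner \<Longrightarrow> x * y \<in> corner" "x \<in> corner \<Longrightarrow> - x \<in> corner" "x \<in> corner \<Longrightarrow> scal c * x \<in> corner"
proof -
  show "G l \<in> corner" by (simp add: corner_def G_def mult.assoc) (simp add: mult.assoc[symmetric])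
  show "x \<in> corner \<Longrightarrow> y \<in> corner \<Longrightarrow> x * y \<in> corner"
    by (simp add: corner_def mult.assoc) (simp add: mult.assoc[symmetric])
  show "x \<in> corner \<Longrightarrow> scal c * x \<in> corner"
    by (simp add: corner_def mult.assoc) (simp add: mult.assoc[symmetric] scal_commute[of u] del: scal_commute, simp add: mult.assoc)
qed (auto simp: corner_def ring_distribs)

lemma corner_sum [intro, simp]: "(\<And>i. i \<in> A \<Longrightarrow> f i \<in> corner) \<Longrightarrow> sum f A \<in> corner"
  by (induction A rule: infinite_finite_induct) auto

lemma corner_sg [intro, simp]: "x \<in> corner \<Longrightarrow> ksign t * x \<in> corner" by (simp add: ksign_def)

lemma ap_corner: assumes "x \<in> corner" shows "ap x w \<in> carrier FS" "rho (ap x w) = ap x w" "ap x (rho w) = ap x w"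
  "r \<in> RR \<Longrightarrow> ap x r = 0" "w \<in> carrier FS \<Longrightarrow> w - w' \<in> RR \<Longrightarrow> ap x w = ap x w'"
proof -
  show 1: "rho (ap x w) = ap x w" using corner_u(1)[OF assms] by (metis ap_simps(6) ap_u)
  show 2: "ap x (rho w) = ap x w" for w using corner_u(2)[OF assms] by (metis ap_simps(6) ap_u)
  show "ap x w \<in> carrier FS" using rho(4)[of "ap x w"] 1 by simp
  show 3: "r \<in> RR \<Longrightarrow> ap x r = 0" for r using 2[of r] by (simp add: rho ap_lin)
  show "w \<in> carrier FS \<Longrightarrow> w - w' \<in> RR \<Longrightarrow> ap x w = ap x w'" using 3[of "w - w'"] by (simp add: ap_lin)
qed

text \<open>
  Pure tensors span.
\<close>

lemma corner_eqI:
  assumes "x \<in> corner" "y \<in> corner" "\<And>w. w \<in> tup \<Longrightarrow> ap x (P w) = ap y (P w)"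
  shows "x = y"
proof (rule linop_eqI)
  fix w
  have "rho w \<in> pm.span (point ` tup)" using rho(4)[of w] by (intro span_points) (simp add: FS_simps)
  then have "ap x (rho w) = ap y (rho w)"
  proof (induction rule: pm.span_induct_alt)
    case (step c a b)
    then show ?case using assms(3) ap_corner(3)[OF assms(1)] ap_corner(3)[OF assms(2)]
      by (auto simp: ap_lin P_def)
  qed (simp add: ap_lin)
  then show "ap x w = ap y w" using assms by (simp add: ap_corner)
qed

lemma ap_G:
  assumes "w \<in> tup" "\<And>p. loc_linear p (l p)"
  shows "ap (G l) (P w) = P (tuple_map l w)"
proof -
  let ?f = "lext (\<lambda>w. point (tuple_map l w))"
  have "rho (point w) - point w \<in> RR" using assms by (simp add: rho point_FS)
  then have "rho (?f (rho (point w) - point w)) = 0"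
    by (intro rho(3) tuple_map_RR assms(2))
  then show ?thesis
    by (simp add: G_def P_def Linop_inverse lin_lext rho(5) rho_lin linD[OF lin_lext])
qed

lemma G_mult:
  assumes "\<And>p. loc_linear p (l p)" "\<And>p. loc_linear p (l' p)"
  shows "G l * G l' = G (\<lambda>p. loc_comp (l p) (l' p))"
  by (rule corner_eqI) (simp_all add: ap_G assms tuple_map_tuples tuple_map_comp)

lemma G_cong:
  assumes "\<And>p. loc_linear p (l p)" "\<And>p. loc_linear p (l' p)" "\<And>p. p < d + 2 \<Longrightarrow> loc_eq p (l p) (l' p)"
  shows "G l = G l'"
  by (rule corner_eqI) (simp_all add: ap_G assms tuple_map_cong[OF assms(3)])

lemma G_id: "G (\<lambda>p. loc_id) = u"
  by (rule corner_eqI) (simp_all add: ap_G tuple_map_id, simp add: P_def rho)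

lemma tuple_map_upd:
  "tuple_map (l(0 := a)) (m, n, vs) = (fst a m, snd (tuple_map l (m, n, vs)))"
  "tuple_map (l(Suc 0 := a)) (m, n, vs) = (fst (l 0) m, fst (snd a) n, snd (snd (tuple_map l (m, n, vs))))"
  "k < length vs \<Longrightarrow> tuple_map (l(Suc (Suc k) := a)) (m, n, vs)
      = (fst (l 0) m, fst (snd (l 1)) n, (snd (snd (tuple_map l (m, n, vs))))[k := snd (snd a) *v (vs ! k)])"
  by (auto simp: tuple_map_def intro!: nth_equalityI simp: nth_list_update)

lemma P_tuple_map_add:
  assumes "w \<in> tup" "p < d + 2" "\<And>q. loc_linear q (l q)" "loc_linear p a" "loc_linear p b"
  shows "P (tuple_map (l(p := loc_add a b)) w) = P (tuple_map (l(p := a)) w) + P (tuple_map (l(p := b)) w)"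
proof -
  obtain m n vs where w: "w = (m, n, vs)" "m \<in> carrier M" "n \<in> carrier N" "length vs = d"
    using assms(1) by (auto simp: tuples_def)
  have t: "tuple_map l (m, n, vs) \<in> tup" using tuple_map_tuples[OF assms(3)] assms(1) w by auto
  consider "p = 0" | "p = Suc 0" | k where "p = Suc (Suc k)" "k < d" using assms(2)
      by (cases p; cases "p - 1") auto
  then show ?thesis
  proof cases
    case 1
    then show ?thesis using assms(4,5) w t
      by (auto simp: tuple_map_upd loc_add_def loc_linear_def mod_linD P_M_add tuples_def tuple_map_def)
  next
    case 2
    then show ?thesis using assms(4,5) w t
      by (auto simp: tuple_map_upd loc_add_def loc_linear_def mod_linD P_N_add tuples_def tuple_map_def)
  next
    case 3
    then show ?thesis using P_V_add[OF t[unfolded tuple_map_def prod.case], of k] w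
      by (simp add: tuple_map_upd loc_add_def matrix_vector_mult_add_rdistrib) (simp add: tuple_map_def)
  qed
qed

lemma P_tuple_map_scal:
  assumes "w \<in> tup" "p < d + 2" "\<And>q. loc_linear q (l q)" "loc_linear p a"
  shows "P (tuple_map (l(p := loc_scale c a)) w) = scl c (P (tuple_map (l(p := a)) w))"
proof -
  obtain m n vs where w: "w = (m, n, vs)" "m \<in> carrier M" "n \<in> carrier N" "length vs = d"
    using assms(1) by (auto simp: tuples_def)
  have t: "tuple_map l (m, n, vs) \<in> tup" using tuple_map_tuples[OF assms(3)] assms(1) w by auto
  consider "p = 0" | "p = Suc 0" | k where "p = Suc (Suc k)" "k < d" using assms(2)
      by (cases p; cases "p - 1") auto
  then show ?thesis
  proof cases
    case 1
    then show ?thesis using assms(4) w t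
      by (auto simp: tuple_map_upd loc_scale_def loc_linear_def mod_linD P_M_smult tuples_def tuple_map_def)
  next
    case 2
    then show ?thesis using assms(4) w t
      by (auto simp: tuple_map_upd loc_scale_def loc_linear_def mod_linD P_N_smult tuples_def tuple_map_def)
  next
    case 3
    then show ?thesis using P_V_smult[OF t[unfolded tuple_map_def prod.case], of k] w
      by (simp add: tuple_map_upd loc_scale_def matrix_smult_vector) (simp add: tuple_map_def)
  qed
qed

lemma G_add:
  assumes "p < d + 2" "\<And>q. loc_linear q (l q)" "loc_linear p a" "loc_linear p b"
  shows "G (l(p := loc_add a b)) = G (l(p := a)) + G (l(p := b))"
  by (rule corner_eqI) (use assms in \<open>simp_all add: ap_G P_tuple_map_add\<close>)

lemma G_scal:
  assumes "p < d + 2" "\<And>q. loc_linear q (l q)" "loc_linear p a"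
  shows "G (l(p := loc_scale c a)) = scal c * G (l(p := a))"
  by (rule corner_eqI) (use assms in \<open>simp_all add: ap_G P_tuple_map_scal\<close>)

end

lemma scal_psign: "scal (psign t) = ksign t"
  by (cases t) (simp_all add: scal_simps)

section \<open>Matrix units in q(n)\<close>

lemma mat_entries:
  "(A ** B) $ a $ b = (\<Sum>c\<in>UNIV. A $ a $ c * B $ c $ b)"
  by (simp add: matrix_matrix_mult_def)

definition parity_matrix :: "('k::finite) mat2" where
  "parity_matrix = (\<chi> a b. if a = b then psign (index_parity a) else 0)"

text \<open>
  The matrix maps vectors of parity \<open>s\<close> to vectors of parity \<open>t + s\<close>.
\<close>

definition mat_parity :: "bit \<Rightarrow> ('k::finite) mat2 \<Rightarrow> bool" where
  "mat_parity t X \<longleftrightarrow> (\<forall>a b. X $ a $ b \<noteq> 0 \<longrightarrow> index_parity a + index_parity b = t)"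

lemma mult_parity_matrix:
  "(X ** parity_matrix) $ a $ b = X $ a $ b * psign (index_parity b)"
  "(parity_matrix ** X) $ a $ b = psign (index_parity a) * X $ a $ b"
  by (simp_all add: mat_entries parity_matrix_def if_distrib[of "\<lambda>x. x * _"] if_distrib[of "\<lambda>x. _ * x"] cong: if_cong)

lemma parity_matrix_square: "parity_matrix ** parity_matrix = mat 1"
  by (simp add: vec_eq_iff mult_parity_matrix mat_def) (simp add: parity_matrix_def)

lemma mat_parity_commute:
  assumes "mat_parity t X"
  shows "X ** parity_matrix = (\<chi> i j. psign t * (parity_matrix ** X) $ i $ j)"
proof -
  have "X $ a $ b * psign (index_parity b) = psign t * (psign (index_parity a) * X $ a $ b)" for a b
  proof (cases "X $ a $ b = 0")
    case False
    then have "t = index_parity a + index_parity b" using assms by (auto simp: mat_parity_def)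
    then show ?thesis by (simp add: psign_add)
  qed simp
  then show ?thesis by (simp add: vec_eq_iff mult_parity_matrix)
qed

lemma matrix_unit_mult: "matrix_unit a b ** matrix_unit c e = (if b = c then matrix_unit a e else 0)"
proof -
  have "(\<Sum>y\<in>UNIV. (if x = a \<and> y = b then 1 else 0) * (if y = c \<and> z = e then 1 else 0))
    = (\<Sum>y\<in>UNIV. if y = b then (if x = a \<and> b = c \<and> z = e then 1 else 0) else (0::complex))" for x z
    by (intro sum.cong) auto
  then show ?thesis
    by (auto simp: vec_eq_iff mat_entries matrix_unit_def)
qed

lemma sum_matrix_unit: "(\<Sum>a\<in>UNIV. matrix_unit a a) = mat 1"
proof -
  have "(\<Sum>a\<in>UNIV. matrix_unit a a $ x $ y) = (\<Sum>a\<in>UNIV. if a = x then mat 1 $ x $ y else 0)" for x y :: 'a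
    by (intro sum.cong) (auto simp: matrix_unit_def mat_def)
  then show ?thesis
    by (simp add: vec_eq_iff)
qed

lemma mat_parity_matrix_unit: "mat_parity (index_parity a + index_parity b) (matrix_unit a b)"
  by (auto simp: mat_parity_def matrix_unit_def)

lemma qmat_nth:
  "qmat A B $ Inl i $ Inl j = A $ i $ j" "qmat A B $ Inl i $ Inr j = B $ i $ j"
  "qmat A B $ Inr i $ Inl j = B $ i $ j" "qmat A B $ Inr i $ Inr j = A $ i $ j"
  by (simp_all add: qmat_def block_def)

lemma forall_sum_type: "(\<forall>a. Q a) \<longleftrightarrow> (\<forall>i. Q (Inl i)) \<and> (\<forall>i. Q (Inr i))"
  by (metis sum.exhaust)

lemma e_unit_eq: "e_unit i j = matrix_unit (Inl i) (Inl j) + matrix_unit (Inr i) (Inr j)"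
  and f_unit_eq: "f_unit i j = matrix_unit (Inl i) (Inr j) + matrix_unit (Inr i) (Inl j)"
  by (simp_all add: e_unit_def f_unit_def vec_eq_iff forall_sum_type qmat_nth) (simp_all add: matrix_unit_def)

lemma qmat_add: "qmat A B + qmat A' B' = qmat (A + A') (B + B')"
  by (simp add: vec_eq_iff forall_sum_type qmat_nth)
lemma qmat_diff: "qmat A B - qmat A' B' = qmat (A - A') (B - B')"
  by (simp add: vec_eq_iff forall_sum_type qmat_nth)
lemma qmat_smult: "(\<chi> i j. c * qmat A B $ i $ j) = qmat (\<chi> i j. c * A $ i $ j) (\<chi> i j. c * B $ i $ j)"
  by (simp add: vec_eq_iff forall_sum_type qmat_nth)

lemma qn_closed: "0 \<in> qn" "x \<in> qn \<Longrightarrow> y \<in> qn \<Longrightarrow> x + y \<in> qn" "x \<in> qn \<Longrightarrow> (\<chi> i j. c * x $ i $ j) \<in> qn"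
  "x \<in> qn_homog t \<Longrightarrow> x \<in> qn"
proof -
  have "(0 :: 'a mat2) = qmat 0 0" by (simp add: vec_eq_iff forall_sum_type qmat_nth)
  then show "(0 :: 'a mat2) \<in> qn" by (auto simp: qn_def)
  show "x + y \<in> qn" if "x \<in> qn" "y \<in> qn" using that unfolding qn_def by (clarsimp simp: qmat_add) blast
  show "(\<chi> i j. c * x $ i $ j) \<in> qn" if "x \<in> qn" using that unfolding qn_def by (clarsimp simp: qmat_smult) blast
qed (auto simp: qn_def qn_homog_def split: if_splits)

lemma qn_sum: "(\<And>i. i \<in> S \<Longrightarrow> f i \<in> qn) \<Longrightarrow> sum f S \<in> qn"
  by (induction S rule: infinite_finite_induct) (auto simp: qn_closed)

lemma unit_homog: "e_unit i j \<in> qn_homog 0" "f_unit i j \<in> qn_homog 1"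
  by (auto simp: qn_homog_def e_unit_def f_unit_def)

lemma mat_parity_qn_homog: "x \<in> qn_homog t \<Longrightarrow> mat_parity t x"
  by (auto simp: mat_parity_def qn_homog_def forall_sum_type qmat_nth split: if_splits)

lemma qn_homog_expand:
  "x \<in> qn_homog 0 \<Longrightarrow> x = (\<Sum>i\<in>UNIV. \<Sum>j\<in>UNIV. (\<chi> a b. x $ Inl i $ Inl j * e_unit i j $ a $ b))"
  "x \<in> qn_homog 1 \<Longrightarrow> x = (\<Sum>i\<in>UNIV. \<Sum>j\<in>UNIV. (\<chi> a b. x $ Inl i $ Inr j * f_unit i j $ a $ b))"
proof -
  have 1: "(\<Sum>i\<in>UNIV. \<Sum>j\<in>UNIV. A $ i $ j * matrix_unit i j $ a $ b)
      = A $ a $ b" for A :: "complex ^ 'b ^ ('b::finite)" and a b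
  proof -
    have "(\<Sum>i\<in>UNIV. \<Sum>j\<in>UNIV. A $ i $ j * matrix_unit i j $ a $ b)
      = (\<Sum>i\<in>UNIV. \<Sum>j\<in>UNIV. if j = b then (if i = a then A $ a $ b else 0) else 0)"
      by (intro sum.cong refl) (auto simp: matrix_unit_def)
    then show ?thesis by (simp only: sum2_delta) simp
  qed
  show "x \<in> qn_homog 0 \<Longrightarrow> x = (\<Sum>i\<in>UNIV. \<Sum>j\<in>UNIV. (\<chi> a b. x $ Inl i $ Inl j * e_unit i j $ a $ b))"
    by (auto simp: qn_homog_def vec_eq_iff forall_sum_type qmat_nth e_unit_def 1)
  show "x \<in> qn_homog 1 \<Longrightarrow> x = (\<Sum>i\<in>UNIV. \<Sum>j\<in>UNIV. (\<chi> a b. x $ Inl i $ Inr j * f_unit i j $ a $ b))"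
    by (auto simp: qn_homog_def vec_eq_iff forall_sum_type qmat_nth f_unit_def 1)
qed

lemma matrix_add_mult: "(A + B) ** C = A ** C + B ** (C :: 'a::semiring_1 ^ 'n ^ 'm)"
  by (simp add: vec_eq_iff matrix_matrix_mult_def distrib_right sum.distrib)

text \<open>
  The structure constants of $\mathfrak q(n)$.
\<close>

lemma bracket_units:
  "qn_bracket 0 0 (e_unit i j) (e_unit k l) = (if j = k then e_unit i l else 0) - (if i
      = l then e_unit k j else 0)"
  "qn_bracket 0 1 (e_unit i j) (f_unit k l) = (if j = k then f_unit i l else 0) - (if i
      = l then f_unit k j else 0)"
  "qn_bracket 1 1 (f_unit i j) (f_unit k l) = (if j = k then e_unit i l else 0) + (if i
      = l then e_unit k j else 0)"
proof -
  have 1: "x - (\<chi> i j. - 1 * y $ i $ j) = x + y" for x y :: "('k::finite) mat2" by (simp add: vec_eq_iff)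
  have 2: "(\<chi> i j. y $ i $ j) = y" for y :: "('k::finite) mat2" by (simp add: vec_eq_iff)
  show "qn_bracket 0 0 (e_unit i j) (e_unit k l) = (if j = k then e_unit i l else 0) - (if i
      = l then e_unit k j else 0)"
    and "qn_bracket 0 1 (e_unit i j) (f_unit k l) = (if j = k then f_unit i l else 0) - (if i
        = l then f_unit k j else 0)"
    "qn_bracket 1 1 (f_unit i j) (f_unit k l) = (if j = k then e_unit i l else 0) + (if i
        = l then e_unit k j else 0)"
    unfolding qn_bracket_def mult_zero_left mult_1_left psign_simps(1,2) 1 2
    by (auto simp: e_unit_eq f_unit_eq matrix_add_ldistrib matrix_add_mult matrix_unit_mult)
qed

lemma q_moduleD:
  assumes "q_module M"
  shows "\<forall>x\<in>qn. act M x \<in> carrier M \<rightarrow> carrier M"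
    "\<forall>x\<in>qn. \<forall>m\<in>carrier M. \<forall>m'\<in>carrier M. act M x (m \<oplus>\<^bsub>M\<^esub> m') = act M x m \<oplus>\<^bsub>M\<^esub> act M x m'"
    "\<forall>x\<in>qn. \<forall>c. \<forall>m\<in>carrier M. act M x (c \<odot>\<^bsub>M\<^esub> m) = c \<odot>\<^bsub>M\<^esub> act M x m"
    "\<forall>x\<in>qn. \<forall>y\<in>qn. \<forall>m\<in>carrier M. act M (x + y) m = act M x m \<oplus>\<^bsub>M\<^esub> act M y m"
    "\<forall>x\<in>qn. \<forall>c. \<forall>m\<in>carrier M. act M (\<chi> i j. c * x $ i $ j) m = c \<odot>\<^bsub>M\<^esub> act M x m"
    "\<forall>p q. \<forall>x\<in>qn_homog p. act M x ` homog M q \<subseteq> homog M (p + q)"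
    "\<forall>p q. \<forall>x\<in>qn_homog p. \<forall>y\<in>qn_homog q. \<forall>m\<in>carrier M.
        act M (qn_bracket p q x y) m =
          act M x (act M y m) \<ominus>\<^bsub>M\<^esub> psign (p * q) \<odot>\<^bsub>M\<^esub> act M y (act M x m)"
  by (insert assms[unfolded q_module_def], elim conjE, assumption)+

context v_slots begin

lemma Sw_sum:
  assumes "finite A" "A \<subseteq> P" "p \<in> A \<inter> VP" "q \<in> A \<inter> VP" "p \<noteq> q"
  shows "comm (Sw p q) (\<Sum>r\<in>A. E r k l) = 0" "comm (Sw p q) (\<Sum>r\<in>A. F r k l) = 0"
proof -
  have bij: "bij_betw (tr p q) A A"
    by (rule bij_betwI[of _ _ _ "tr p q"]) (use assms in \<open>auto simp: Transposition.transpose_def\<close>)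
  have *: "comm (Sw p q) (sum f A) = 0" if "\<And>r. r \<in> A \<Longrightarrow> Sw p q * f r = f (tr p q r) * Sw p q" for f
  proof -
    have "Sw p q * sum f A = (\<Sum>r\<in>A. f (tr p q r)) * Sw p q"
      unfolding sum_distrib_left sum_distrib_right using that by (intro sum.cong refl)
    then show ?thesis
      unfolding sum.reindex_bij_betw[OF bij] by (simp add: comm_zero_iff)
  qed
  show "comm (Sw p q) (\<Sum>r\<in>A. E r k l) = 0" "comm (Sw p q) (\<Sum>r\<in>A. F r k l) = 0"
    by (rule *, rule Sw_mult_E Sw_mult_F; use assms in auto)+
qed

lemma C_sum:
  assumes "finite A" "A \<subseteq> P" "p \<in> VP"
  shows "comm (C p) (\<Sum>r\<in>A. E r k l) = 0" "anti (C p) (\<Sum>r\<in>A. F r k l) = 0"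
  unfolding comm_sum anti_sum using assms by (auto intro!: sum.neutral comm_C_E anti_C_F)

end

context tensor begin

section \<open>Signed operators at one position\<close>

definition loc_sigma :: "('m, 'n, 'k) local_op" where
  "loc_sigma = (sM.\<sigma>, sN.\<sigma>, parity_matrix)"

definition loc_sigma_pow :: "bit \<Rightarrow> ('m, 'n, 'k) local_op" where
  "loc_sigma_pow t = (if t = 1 then loc_sigma else loc_id)"

lemma loc_linear_loc_sigma_pow [simp, intro]: "loc_linear p loc_sigma" "loc_linear p (loc_sigma_pow t)"
  by (auto simp: loc_linear_def loc_sigma_def loc_sigma_pow_def loc_id_def mod_lin_id sM.mod_lin_\<sigma> sN.mod_lin_\<sigma>)

lemma loc_sigma_pow_simps [simp]: "loc_sigma_pow 0 = loc_id" "loc_sigma_pow 1 = loc_sigma"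
    by (simp_all add: loc_sigma_pow_def)

lemma loc_sigma_pow_add: "loc_eq p (loc_comp (loc_sigma_pow t) (loc_sigma_pow s)) (loc_sigma_pow (t + s))"
proof -
  have "loc_eq p (loc_comp loc_sigma loc_sigma) loc_id"
    by (auto simp: loc_eq_def loc_comp_def loc_sigma_def loc_id_def sM.\<sigma>_\<sigma> sN.\<sigma>_\<sigma> parity_matrix_square)
  then show ?thesis by (cases t; cases s) auto
qed

text \<open>
  Being homogeneous of parity \<open>t\<close>, expressed by the commutation with the parity involution.
\<close>

definition loc_parity :: "bit \<Rightarrow> nat \<Rightarrow> ('m, 'n, 'k) local_op \<Rightarrow> bool" where
  "loc_parity t p a \<longleftrightarrow> loc_linear p a \<and> loc_eq p (loc_comp a loc_sigma) (loc_scale (psign t) (loc_comp loc_sigma a))"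

lemma loc_eq_loc_scale_one: "loc_linear p a \<Longrightarrow> loc_eq p a (loc_scale 1 a)"
  using sM.smult_simps(3) sN.smult_simps(3)
  by (auto simp: loc_eq_def loc_scale_def loc_linear_def mod_linD vec_eq_iff)

lemma loc_parity_loc_sigma_pow: "loc_parity t p a
    \<Longrightarrow> loc_eq p (loc_comp a (loc_sigma_pow s)) (loc_scale (psign (t * s)) (loc_comp (loc_sigma_pow s) a))"
  by (cases s) (auto simp: loc_parity_def loc_eq_loc_scale_one)

text \<open>
  The operator \<open>a\<close> of parity \<open>t\<close> at position \<open>p\<close> with the Koszul sign: if \<open>t\<close> is odd, the involutions
  at all positions before \<open>p\<close> multiply by $-1$ for each odd entry that \<open>a\<close> has to pass.
\<close>

definition slot :: "bit \<Rightarrow> nat \<Rightarrow> ('m, 'n, 'k) local_op \<Rightarrow> ('m, 'n, 'k) tensor_tuple linop" where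
  "slot t p a = G ((\<lambda>q. if q < p then loc_sigma_pow t else loc_id)(p := a))"

lemma slot_corner [simp, intro]: "slot t p a \<in> corner" by (simp add: slot_def)

lemma slot_mult_same:
  assumes "loc_linear p a" "loc_linear p b" shows "slot t p a * slot s p b = slot (t + s) p (loc_comp a b)"
  unfolding slot_def
  by (subst G_mult) (use assms loc_sigma_pow_add in \<open>auto intro!: G_cong\<close>)

text \<open>
  The two products differ only at the left one of the two positions, where the involution
  from the sign rule of the other operator stands once after and once before \<open>a\<close>.
\<close>

lemma slot_supercommute_less:
  assumes "p < q" "q < d + 2" "loc_parity t p a" "loc_linear q b"
  shows "slot t p a * slot s q b = ksign (t * s) * (slot s q b * slot t p a)"
proof -
  let ?l = "\<lambda>r. if r < p then loc_sigma_pow (t + s) else if r < q then loc_sigma_pow s else if r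
      = q then b else loc_id"
  let ?x = "loc_comp (loc_sigma_pow s) a"
  have ok: "loc_linear p a" using assms by (simp add: loc_parity_def)
  have "slot t p a * slot s q b = G (?l(p := loc_scale (psign (t * s)) ?x))"
    unfolding slot_def
    by (subst G_mult) (use assms ok loc_sigma_pow_add loc_parity_loc_sigma_pow[OF assms(3)] in \<open>auto intro!: G_cong\<close>)
  also have "\<dots> = ksign (t * s) * G (?l(p := ?x))"
    using assms ok by (subst G_scal) (auto simp: scal_psign)
  also have "G (?l(p := ?x)) = slot s q b * slot t p a"
    unfolding slot_def
    by (subst G_mult) (use assms ok loc_sigma_pow_add[of _ s t] in \<open>auto intro!: G_cong intro: loc_eq_sym simp: add.commute[of t s]\<close>)
  finally show ?thesis .
qed

lemma slot_supercommute:
  assumes "p \<noteq> q" "p < d + 2" "q < d + 2" "loc_parity t p a" "loc_parity s q b"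
  shows "slot t p a * slot s q b = ksign (t * s) * (slot s q b * slot t p a)"
proof (cases "p < q")
  case True
  then show ?thesis using slot_supercommute_less assms by (auto simp: loc_parity_def)
next
  case False
  then have "slot s q b * slot t p a = ksign (t * s) * (slot t p a * slot s q b)"
    using slot_supercommute_less[of q p s b a t] assms by (auto simp: loc_parity_def mult.commute)
  then show ?thesis by simp
qed

lemma slot_cong: "loc_linear p a \<Longrightarrow> loc_linear p b \<Longrightarrow> loc_eq p a b \<Longrightarrow> slot t p a = slot t p b"
  unfolding slot_def by (rule G_cong) auto

lemma slot_add: "p < d + 2 \<Longrightarrow> loc_linear p a \<Longrightarrow> loc_linear p b \<Longrightarrow> slot t p (loc_add a b) = slot t p a + slot t p b"
  unfolding slot_def by (rule G_add) auto

lemma slot_scal: "p < d + 2 \<Longrightarrow> loc_linear p a \<Longrightarrow> slot t p (loc_scale c a) = scal c * slot t p a"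
  unfolding slot_def by (rule G_scal) auto

lemma slot_id: "slot 0 p loc_id = u"
  unfolding slot_def G_id[symmetric] by (rule G_cong) auto

text \<open>
  The total parity involution; its eigenspaces are the homogeneous parts of the tensor product.
\<close>

definition Pi_op :: "('m, 'n, 'k) tensor_tuple linop" where "Pi_op = G (\<lambda>p. loc_sigma)"

lemma slot_Pi:
  assumes "p < d + 2" "loc_parity t p a"
  shows "slot t p a * Pi_op = ksign t * (Pi_op * slot t p a)"
proof -
  let ?l = "\<lambda>r. if r < p then loc_sigma_pow (t + 1) else loc_sigma"
  have ok: "loc_linear p a" and eq: "loc_eq p (loc_comp a loc_sigma) (loc_scale (psign t) (loc_comp loc_sigma a))" using assms by (simp_all add: loc_parity_def)
  have l: "loc_eq q (loc_comp (loc_sigma_pow t) loc_sigma) (loc_sigma_pow (t + 1))" "loc_eq q (loc_comp loc_sigma (loc_sigma_pow t)) (loc_sigma_pow (t + 1))" for q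
    using loc_sigma_pow_add[of q t 1] loc_sigma_pow_add[of q 1 t] by (simp_all add: add.commute)
  have "slot t p a * Pi_op = G (?l(p := loc_scale (psign t) (loc_comp loc_sigma a)))"
    unfolding slot_def Pi_op_def
    by (subst G_mult) (use ok l eq in \<open>auto intro!: G_cong\<close>)
  also have "\<dots> = ksign t * G (?l(p := loc_comp loc_sigma a))"
    using assms ok by (subst G_scal) (auto simp: scal_psign)
  also have "G (?l(p := loc_comp loc_sigma a)) = Pi_op * slot t p a"
    unfolding slot_def Pi_op_def
    by (subst G_mult) (use ok l in \<open>auto intro!: G_cong intro: loc_eq_sym\<close>)
  finally show ?thesis .
qed

definition loc_act :: "'k mat2 \<Rightarrow> ('m, 'n, 'k) local_op" where
  "loc_act x = (act M x, act N x, x)"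

lemmas act_laws = q_moduleD[OF qM] q_moduleD[OF qN]

lemma mod_lin_act: assumes "x \<in> qn" shows "mod_lin M (act M x)" "mod_lin N (act N x)"
  using bspec[OF act_laws(1) assms] bspec[OF act_laws(2) assms] bspec[OF act_laws(3) assms]
    bspec[OF act_laws(8) assms] bspec[OF act_laws(9) assms] bspec[OF act_laws(10) assms]
  by (simp_all add: mod_lin_def)

lemma act_add:
  assumes "x \<in> qn" "y \<in> qn"
  shows "m \<in> carrier M \<Longrightarrow> act M (x + y) m = act M x m \<oplus>\<^bsub>M\<^esub> act M y m"
    "n \<in> carrier N \<Longrightarrow> act N (x + y) n = act N x n \<oplus>\<^bsub>N\<^esub> act N y n"
  using act_laws(4,11) assms by simp_all

lemma act_smult:
  assumes "x \<in> qn"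
  shows "m \<in> carrier M \<Longrightarrow> act M (\<chi> i j. c * x $ i $ j) m = c \<odot>\<^bsub>M\<^esub> act M x m"
    "n \<in> carrier N \<Longrightarrow> act N (\<chi> i j. c * x $ i $ j) n = c \<odot>\<^bsub>N\<^esub> act N x n"
  using act_laws(5,12) assms by simp_all

lemma act_homog:
  assumes "x \<in> qn_homog t"
  shows "act M x ` homog M q \<subseteq> homog M (t + q)" "act N x ` homog N q \<subseteq> homog N (t + q)"
  using act_laws(6,13) assms by simp_all

lemma act_bracket:
  assumes "x \<in> qn_homog t" "y \<in> qn_homog s"
  shows "m \<in> carrier M \<Longrightarrow> act M (qn_bracket t s x y) m
      = act M x (act M y m) \<ominus>\<^bsub>M\<^esub> psign (t * s) \<odot>\<^bsub>M\<^esub> act M y (act M x m)"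
    "n \<in> carrier N \<Longrightarrow> act N (qn_bracket t s x y) n
        = act N x (act N y n) \<ominus>\<^bsub>N\<^esub> psign (t * s) \<odot>\<^bsub>N\<^esub> act N y (act N x n)"
  using act_laws(7,14) assms by simp_all

lemma loc_linear_loc_act: "x \<in> qn \<Longrightarrow> loc_linear p (loc_act x)"
  by (auto simp: loc_linear_def loc_act_def mod_lin_act)

lemma loc_parity_loc_act: assumes "x \<in> qn_homog t" shows "loc_parity t p (loc_act x)"
proof -
  note M = act_homog(1)[OF assms] and N = act_homog(2)[OF assms]
  show ?thesis
    using sM.\<sigma>_commute[OF mod_lin_act(1) M] sN.\<sigma>_commute[OF mod_lin_act(2) N] qn_closed(4)[OF assms]
      mat_parity_commute[OF mat_parity_qn_homog[OF assms]]
      loc_linear_loc_act[OF qn_closed(4)[OF assms], of p]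
    by (auto simp: loc_parity_def loc_linear_loc_act loc_eq_def loc_act_def loc_comp_def loc_sigma_def loc_scale_def)
qed

definition slot_act :: "bit \<Rightarrow> nat \<Rightarrow> 'k mat2 \<Rightarrow> ('m, 'n, 'k) tensor_tuple linop" where
  "slot_act t p x = slot t p (loc_act x)"

lemma slot_act_corner [simp, intro]: "slot_act t p x \<in> corner" by (simp add: slot_act_def)

lemma slot_act_add: assumes "x \<in> qn" "y \<in> qn" "p < d + 2" shows "slot_act t p (x + y)
    = slot_act t p x + slot_act t p y"
proof -
  have "loc_eq p (loc_act (x + y)) (loc_add (loc_act x) (loc_act y))"
    using act_add assms by (simp add: loc_eq_def loc_act_def loc_add_def)
  then show ?thesis unfolding slot_act_def
    using assms by (subst slot_add[symmetric]) (auto intro!: slot_cong simp: loc_linear_loc_act qn_closed)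
qed

lemma slot_act_scal: assumes "x \<in> qn" "p < d + 2" shows "slot_act t p (\<chi> i j. c * x $ i $ j)
    = scal c * slot_act t p x"
proof -
  have "loc_eq p (loc_act (\<chi> i j. c * x $ i $ j)) (loc_scale c (loc_act x))"
    using act_smult assms by (simp add: loc_eq_def loc_act_def loc_scale_def)
  then show ?thesis unfolding slot_act_def
    using assms by (subst slot_scal[symmetric]) (auto intro!: slot_cong simp: loc_linear_loc_act qn_closed)
qed

lemma slot_act_0: "p < d + 2 \<Longrightarrow> slot_act t p 0 = 0"
  using slot_act_add[of 0 0 p t] by (simp add: qn_closed)

lemma slot_act_diff: assumes "x \<in> qn" "y \<in> qn" "p < d + 2" shows "slot_act t p (x - y)
    = slot_act t p x - slot_act t p y"
proof -
  have *: "x - y = x + (\<chi> i j. - 1 * y $ i $ j)" by (simp add: vec_eq_iff)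
  show ?thesis unfolding * using assms by (simp only: slot_act_add slot_act_scal qn_closed) (simp add: scal_simps)
qed

lemma slot_act_sum: "(\<And>i. i \<in> S \<Longrightarrow> f i \<in> qn) \<Longrightarrow> p < d + 2 \<Longrightarrow> slot_act t p (sum f S) = (\<Sum>i\<in>S. slot_act t p (f i))"
  by (induction S rule: infinite_finite_induct) (auto simp: slot_act_0 slot_act_add qn_sum)

text \<open>
  The bracket axiom of the module carries over to every position, as the involutions before \<open>p\<close>
  multiply according to the sum of the parities.  For a copy of $V$ it is the definition of the
  bracket.
\<close>

lemma slot_act_bracket:
  assumes "x \<in> qn_homog t" "y \<in> qn_homog s" "qn_bracket t s x y \<in> qn" "p < d + 2"
  shows "slot_act (t + s) p (qn_bracket t s x y)
      = slot_act t p x * slot_act s p y - ksign (t * s) * (slot_act s p y * slot_act t p x)"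
proof -
  let ?r = "loc_add (loc_comp (loc_act x) (loc_act y)) (loc_scale (- psign (t * s)) (loc_comp (loc_act y) (loc_act x)))"
  have qn: "x \<in> qn" "y \<in> qn" using assms qn_closed by auto
  have ok: "loc_linear p (loc_act x)" "loc_linear p (loc_act y)" using qn by (simp_all add: loc_linear_loc_act)
  have M: "act M (qn_bracket t s x y) m = act M x (act M y m) \<oplus>\<^bsub>M\<^esub> (- psign (t * s)) \<odot>\<^bsub>M\<^esub> act M y (act M x m)" if "m \<in> carrier M" for m
    using that mod_linD(1)[OF mod_lin_act(1)] qn assms by (simp add: act_bracket sM.minus_smult sM.smult_simps)
  have N: "act N (qn_bracket t s x y) m = act N x (act N y m) \<oplus>\<^bsub>N\<^esub> (- psign (t * s)) \<odot>\<^bsub>N\<^esub> act N y (act N x m)" if "m \<in> carrier N" for m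
    using that mod_linD(1)[OF mod_lin_act(2)] qn assms by (simp add: act_bracket sN.minus_smult sN.smult_simps)
  have "loc_eq p (loc_act (qn_bracket t s x y)) ?r"
    using M N by (auto simp: loc_eq_def loc_act_def loc_add_def loc_scale_def loc_comp_def qn_bracket_def vec_eq_iff)
  then have "slot_act (t + s) p (qn_bracket t s x y) = slot (t + s) p ?r"
    unfolding slot_act_def using ok by (intro slot_cong) (auto simp: loc_linear_loc_act assms(3))
  also have "\<dots> = slot (t + s) p (loc_comp (loc_act x) (loc_act y)) - ksign (t * s) * slot (s + t) p (loc_comp (loc_act y) (loc_act x))"
    using ok assms(4) by (subst slot_add) (auto simp: slot_scal scal_simps scal_psign add.commute[of t s])
  finally show ?thesis unfolding slot_act_def using ok by (simp add: slot_mult_same)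
qed

definition E :: "nat \<Rightarrow> 'k \<Rightarrow> 'k \<Rightarrow> ('m, 'n, 'k) tensor_tuple linop" where "E p i j = slot_act 0 p (e_unit i j)"
definition F :: "nat \<Rightarrow> 'k \<Rightarrow> 'k \<Rightarrow> ('m, 'n, 'k) tensor_tuple linop" where "F p i j = slot_act 1 p (f_unit i j)"
definition loc_matrix :: "'k mat2 \<Rightarrow> ('m, 'n, 'k) local_op" where "loc_matrix X = (id, id, X)"
definition U :: "nat \<Rightarrow> 'k + 'k \<Rightarrow> 'k + 'k \<Rightarrow> ('m, 'n, 'k) tensor_tuple linop" where
  "U p a b = slot (index_parity a + index_parity b) p (loc_matrix (matrix_unit a b))"

lemma loc_linear_loc_matrix [simp, intro]: "loc_linear p (loc_matrix X)"
    by (simp add: loc_linear_def loc_matrix_def mod_lin_id)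

lemma loc_parity_loc_matrix: "2 \<le> p \<Longrightarrow> mat_parity t X \<Longrightarrow> loc_parity t p (loc_matrix X)"
  using mat_parity_commute[of t X] loc_linear_loc_matrix[of p X]
      by (auto simp: loc_parity_def loc_eq_def loc_matrix_def loc_comp_def loc_sigma_def loc_scale_def)

lemma slot_loc_matrix_add:
  assumes "2 \<le> p" "p < d + 2"
  shows "slot t p (loc_matrix (X + X')) = slot t p (loc_matrix X) + slot t p (loc_matrix X')"
proof -
  have "slot t p (loc_matrix (X + X')) = slot t p (loc_add (loc_matrix X) (loc_matrix X'))"
    by (rule slot_cong[OF loc_linear_loc_matrix loc_linear_intros(3)[OF loc_linear_loc_matrix loc_linear_loc_matrix]])
      (use assms in \<open>simp add: loc_eq_def loc_matrix_def loc_add_def\<close>)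
  then show ?thesis using assms by (simp add: slot_add)
qed

lemma slot_loc_matrix_0: "2 \<le> p \<Longrightarrow> p < d + 2 \<Longrightarrow> slot t p (loc_matrix 0) = 0"
  using slot_loc_matrix_add[of p t 0 0] by simp

lemma slot_loc_matrix_sum: "2 \<le> p \<Longrightarrow> p < d + 2 \<Longrightarrow> slot t p (loc_matrix (sum f S))
    = (\<Sum>i\<in>S. slot t p (loc_matrix (f i)))"
  by (induction S rule: infinite_finite_induct) (auto simp: slot_loc_matrix_0 slot_loc_matrix_add)

lemma slot_loc_act_loc_matrix: "2 \<le> p \<Longrightarrow> x \<in> qn \<Longrightarrow> slot t p (loc_act x) = slot t p (loc_matrix x)"
  by (rule slot_cong[OF loc_linear_loc_act loc_linear_loc_matrix]) (auto simp: loc_eq_def loc_act_def loc_matrix_def)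

lemma units_qn: "e_unit i j \<in> qn" "f_unit i j \<in> qn" using unit_homog qn_closed(4) by blast+

lemma slot_act_if: "p < d + 2 \<Longrightarrow> slot_act t p (if c then x else 0) = (if c then slot_act t p x else 0)"
  by (simp add: slot_act_0)

lemma if_qn: "x \<in> qn \<Longrightarrow> (if c then x else 0) \<in> qn" by (simp add: qn_closed)

lemma diff_qn: assumes "x \<in> qn" "y \<in> qn" shows "x - y \<in> qn"
  using assms unfolding qn_def by (clarsimp simp: qmat_diff) blast

text \<open>
  The interpretation that makes the computations of \<^locale>\<open>v_slots\<close> available on the tensor product.
\<close>

sublocale alg: v_slots "{..<d + 2}" E F "{2..<d + 2}" U u
proof
  fix p i j k l assume "p \<in> {..<d + 2}"
  then have p: "p < d + 2" by simp
  note qn = units_qn if_qn diff_qn qn_closed(2)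
  show "comm (E p i j) (E p k l) = (if j = k then E p i l else 0) - (if i = l then E p k j else 0)"
  proof -
    have "slot_act (0 + 0) p (qn_bracket 0 0 (e_unit i j) (e_unit k l))
      = slot_act 0 p (if j = k then e_unit i l else 0) - slot_act 0 p (if i = l then e_unit k j else 0)"
      unfolding bracket_units by (simp only: slot_act_diff[OF _ _ p] qn add_0)
    moreover have "slot_act (0 + 0) p (qn_bracket 0 0 (e_unit i j) (e_unit k l)) = comm (E p i j) (E p k l)"
      by (subst slot_act_bracket[OF unit_homog(1) unit_homog(1) _ p])
        (simp_all only: bracket_units qn comm_def E_def mult_zero_left ksign_simps mult_1_left)
    ultimately show ?thesis by (simp only: slot_act_if[OF p] E_def)
  qed
  show "comm (E p i j) (F p k l) = (if j = k then F p i l else 0) - (if i = l then F p k j else 0)"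
  proof -
    have "slot_act (0 + 1) p (qn_bracket 0 1 (e_unit i j) (f_unit k l))
      = slot_act 1 p (if j = k then f_unit i l else 0) - slot_act 1 p (if i = l then f_unit k j else 0)"
      unfolding bracket_units by (simp only: slot_act_diff[OF _ _ p] qn add_0)
    moreover have "slot_act (0 + 1) p (qn_bracket 0 1 (e_unit i j) (f_unit k l)) = comm (E p i j) (F p k l)"
      by (subst slot_act_bracket[OF unit_homog(1) unit_homog(2) _ p])
        (simp_all only: bracket_units qn comm_def E_def F_def mult_zero_left ksign_simps mult_1_left)
    ultimately show ?thesis by (simp only: slot_act_if[OF p] F_def)
  qed
  show "anti (F p i j) (F p k l) = (if j = k then E p i l else 0) + (if i = l then E p k j else 0)"
  proof -
    have "slot_act (1 + 1) p (qn_bracket 1 1 (f_unit i j) (f_unit k l))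
      = slot_act 0 p (if j = k then e_unit i l else 0) + slot_act 0 p (if i = l then e_unit k j else 0)"
      unfolding bracket_units bit_add_self by (simp only: slot_act_add[OF _ _ p] qn)
    moreover have "slot_act (1 + 1) p (qn_bracket 1 1 (f_unit i j) (f_unit k l)) = anti (F p i j) (F p k l)"
      by (subst slot_act_bracket[OF unit_homog(2) unit_homog(2) _ p])
        (simp_all add: bracket_units qn anti_def F_def)
    ultimately show ?thesis by (simp only: slot_act_if[OF p] E_def)
  qed
next
  fix p q i j k l assume "p \<in> {..<d + 2}" "q \<in> {..<d + 2}" "p \<noteq> q"
  then have pq: "p \<noteq> q" "p < d + 2" "q < d + 2" by auto
  note s = slot_supercommute[OF pq loc_parity_loc_act loc_parity_loc_act]
  show "comm (E p i j) (E q k l) = 0"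
    unfolding E_def slot_act_def comm_def s[OF unit_homog(1) unit_homog(1)] by simp
  show "comm (E p i j) (F q k l) = 0"
    unfolding E_def F_def slot_act_def comm_def s[OF unit_homog(1) unit_homog(2)] by simp
  show "anti (F p i j) (F q k l) = 0"
    unfolding F_def slot_act_def anti_def s[OF unit_homog(2) unit_homog(2)] by simp
next
  show "{2..<d + 2} \<subseteq> {..<d + 2}" by auto
next
  fix p a b c e assume p: "p \<in> {2..<d + 2}"
  have "U p a b * U p c e = slot (index_parity a + index_parity b + (index_parity c + index_parity e)) p (loc_matrix (matrix_unit a b ** matrix_unit c e))"
    unfolding U_def using p
    by (subst slot_mult_same) (auto intro!: slot_cong simp: loc_eq_def loc_comp_def loc_matrix_def loc_linear_def mod_lin_id mod_lin_comp)
  then show "U p a b * U p c e = (if b = c then U p a e else 0)"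
    using p by (auto simp: matrix_unit_mult slot_loc_matrix_0 U_def add.assoc)
next
  fix p assume p: "p \<in> {2..<d + 2}"
  then have "(\<Sum>a\<in>UNIV. U p a a) = slot 0 p (loc_matrix (mat 1))"
    by (simp add: U_def slot_loc_matrix_sum[symmetric] sum_matrix_unit)
  also have "loc_matrix (mat 1) = loc_id" by (simp add: loc_matrix_def loc_id_def)
  finally show "(\<Sum>a\<in>UNIV. U p a a) = u" by (simp add: slot_id)
next
  fix p q a b c e assume "p \<in> {2..<d + 2}" "q \<in> {2..<d + 2}" "p \<noteq> q"
  then show "U p a b * U q c e = ksign ((index_parity a + index_parity b) * (index_parity c + index_parity e)) * (U q c e * U p a b)"
    unfolding U_def by (intro slot_supercommute loc_parity_loc_matrix mat_parity_matrix_unit) auto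
next
  fix p r a b k l assume "p \<in> {2..<d + 2}" "r \<in> {..<d + 2}" "r \<noteq> p"
  then have pr: "p \<noteq> r" "p < d + 2" "r < d + 2" "2 \<le> p" by auto
  note s = slot_supercommute[OF pr(1-3) loc_parity_loc_matrix[OF pr(4) mat_parity_matrix_unit] loc_parity_loc_act]
  show "U p a b * E r k l = E r k l * U p a b"
    unfolding U_def E_def slot_act_def s[OF unit_homog(1)] by simp
  show "U p a b * F r k l = ksign (index_parity a + index_parity b) * (F r k l * U p a b)"
    unfolding U_def F_def slot_act_def s[OF unit_homog(2)] by simp
next
  fix p i j assume "p \<in> {2..<d + 2}"
  then show "E p i j = U p (Inl i) (Inl j) + U p (Inr i) (Inr j)" "F p i j
      = U p (Inl i) (Inr j) + U p (Inr i) (Inl j)"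
    unfolding E_def F_def slot_act_def U_def
        by (simp_all add: slot_loc_act_loc_matrix units_qn) (simp_all add: e_unit_eq f_unit_eq slot_loc_matrix_add)
qed

end

section \<open>The grading of the tensor product\<close>

lemma map_identity [simp]: "Poly_Mapping.map (\<lambda>a. a) (v :: 'a \<Rightarrow>\<^sub>0 complex) = v"
  by (rule poly_mapping_eqI) (simp add: Poly_Mapping.map.rep_eq when_def)

text \<open>
  Unfolding this predicate lets the simplifier replace \<open>d\<close> by the length of a list in every term that
  depends on it.
\<close>

declare homog_tuple.simps [simp del]

context pm_quot begin

lemma lin_span_Q:
  assumes "A' \<subseteq> carrier A"
  shows "lin_span Q (cls ` A') = cls ` pm.span A'"
proof -
  interpret Q: Module.module complex_ring Q by (rule module_Q)
  have sp: "pm.span A' \<subseteq> carrier A" using assms sub_A by (rule pm.span_minimal)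
  have "submodule (cls ` pm.span A') complex_ring Q"
  proof (rule Q.submoduleI)
    show "cls ` pm.span A' \<subseteq> carrier Q" unfolding carrier_Q using sp by (rule image_mono)
    show "\<zero>\<^bsub>Q\<^esub> \<in> cls ` pm.span A'" unfolding zero_Q by (rule imageI[OF pm.span_zero])
  next
    fix a assume "a \<in> cls ` pm.span A'"
    then obtain y where y: "a = cls y" "y \<in> pm.span A'" by blast
    then have yc: "y \<in> carrier A" "- y \<in> carrier A" using sp sub(4) by blast+
    have "\<ominus>\<^bsub>Q\<^esub> cls y = cls (- y)"
      by (rule Q.minus_equality[OF _ carrier_mem[OF yc(1)] carrier_mem[OF yc(2)]]) (simp only: add_Q zero_Q left_minus)
    then show "\<ominus>\<^bsub>Q\<^esub> a \<in> cls ` pm.span A'" unfolding y(1) using imageI[OF pm.span_neg[OF y(2)]] by simp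
  next
    fix a b assume "a \<in> cls ` pm.span A'" "b \<in> cls ` pm.span A'"
    then obtain y z where y: "a = cls y" "y \<in> pm.span A'" "b = cls z" "z \<in> pm.span A'" by blast
    show "a \<oplus>\<^bsub>Q\<^esub> b \<in> cls ` pm.span A'"
      unfolding y(1,3) add_Q by (rule imageI[OF pm.span_add[OF y(2,4)]])
  next
    fix c b assume "b \<in> cls ` pm.span A'"
    then obtain z where y: "b = cls z" "z \<in> pm.span A'" by blast
    show "c \<odot>\<^bsub>Q\<^esub> b \<in> cls ` pm.span A'"
      unfolding y(1) smult_Q by (rule imageI[OF pm.span_scale[OF y(2)]])
  qed
  moreover have "cls ` A' \<subseteq> cls ` pm.span A'" by (auto intro: pm.span_base)
  moreover have "cls ` pm.span A' \<subseteq> H" if H: "submodule H complex_ring Q" "cls ` A' \<subseteq> H" for H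
  proof safe
    fix y assume "y \<in> pm.span A'"
    then show "cls y \<in> H"
    proof (induction rule: pm.span_induct_alt)
      case base
      have "\<zero>\<^bsub>Q\<^esub> \<in> H"
        using subgroup.one_closed[OF submodule.axioms(1)[OF H(1)]] by simp
      then show ?case unfolding zero_Q .
    next
      case (step c x y)
      have "cls x \<in> H" using H(2) step(1) by blast
      then have "c \<odot>\<^bsub>Q\<^esub> cls x \<oplus>\<^bsub>Q\<^esub> cls y \<in> H"
        by (intro Q.submoduleE(5)[OF H(1) _ step(2)] Q.submoduleE(4)[OF H(1)]) simp_all
      then show ?case unfolding smult_Q add_Q .
    qed
  qed
  ultimately show ?thesis unfolding lin_span_def
    by (intro equalityI Inter_lower Inter_greatest) simp_all
qed

end

lemma position_cases:
  assumes "(p::nat) < d + 2"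
  obtains "p = 0" | "p = Suc 0" | k where "p = Suc (Suc k)" "k < d"
  using assms by (cases p; cases "p - 1") auto

lemma natural_homog:
  "v \<in> homog natural_module r \<longleftrightarrow> (\<forall>a. v $ a \<noteq> 0 \<longrightarrow> index_parity a = r)"
  by (cases r) (auto simp: natural_module_def forall_sum_type)

lemma parity_matrix_vector: "v \<in> homog natural_module r \<Longrightarrow> parity_matrix *v v = psign r *s v"
proof -
  assume v: "v \<in> homog natural_module r"
  have "(\<Sum>b\<in>UNIV. parity_matrix $ a $ b * v $ b) = (\<Sum>b\<in>UNIV. if b
      = a then psign (index_parity a) * v $ a else 0)" for a
    by (intro sum.cong) (auto simp: parity_matrix_def)
  then show ?thesis using v by (auto simp: vec_eq_iff matrix_vector_mult_def natural_homog)
qed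

lemma matrix_unit_vector: "matrix_unit a b *v v = v $ b *s axis a 1"
proof -
  have "(\<Sum>y\<in>UNIV. matrix_unit a b $ x $ y * v $ y) = (\<Sum>y\<in>UNIV. if y = b then (if x
      = a then v $ b else 0) else 0)" for x
    by (intro sum.cong) (auto simp: matrix_unit_def)
  then show ?thesis by (auto simp: vec_eq_iff matrix_vector_mult_def axis_def)
qed

lemma natural_decomp: "\<exists>v0 v1. v = v0 + v1 \<and> v0 \<in> homog natural_module 0 \<and> v1 \<in> homog natural_module 1"
proof (intro exI conjI)
  show "v = (\<chi> a. if index_parity a = 0 then v $ a else 0) + (\<chi> a. if index_parity a = 1 then v $ a else 0)"
    by (auto simp: vec_eq_iff)
qed (auto simp: natural_homog)

context tensor begin

lemma homog_tuple_tup: "homog_tuple M N d ps w \<Longrightarrow> w \<in> tup" "homog_tuple M N d ps w \<Longrightarrow> length ps = d + 2"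
  by (cases w; auto simp: homog_tuple.simps tuples_def sM.homog_carrier sN.homog_carrier dest: list_all2_lengthD)+

lemma homog_tupleI:
  assumes "m \<in> homog M p" "n \<in> homog N q" "length vs = d" "\<And>i. i < d \<Longrightarrow> \<exists>r. vs ! i \<in> homog natural_module r"
  shows "\<exists>ps. homog_tuple M N d ps (m, n, vs)"
proof -
  obtain f where f: "\<And>i. i < d \<Longrightarrow> vs ! i \<in> homog natural_module (f i)" using assms(4) by metis
  have "homog_tuple M N d (p # q # map f [0..<d]) (m, n, vs)"
    using assms f by (auto simp: homog_tuple.simps list_all2_conv_all_nth)
  then show ?thesis by blast
qed

definition graded_part :: "bit \<Rightarrow> (('m, 'n, 'k) tensor_tuple \<Rightarrow>\<^sub>0 complex) set" where
  "graded_part p = pm.span {P w | w ps. homog_tuple M N d ps w \<and> sum_list ps = p}"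

text \<open>
  The entries of a tuple are decomposed into their homogeneous parts one at a time: first the vectors
  with index below \<open>k\<close>, by induction on \<open>k\<close>, and then those from $N$ and $M$.
\<close>

lemma P_homog_span:
  assumes "w \<in> tup" shows "P w \<in> pm.span {P w | w ps. homog_tuple M N d ps w}" (is "_ \<in> ?S")
proof -
  have V: "P (m, n, vs) \<in> ?S"
    if "m \<in> homog M p" "n \<in> homog N q" "length vs = d" "\<And>i. k \<le> i \<Longrightarrow> i < d
        \<Longrightarrow> \<exists>r. vs ! i \<in> homog natural_module r" "k \<le> d"
    for m n vs p q k
    using that
  proof (induction k arbitrary: vs)
    case 0
    then show ?case using homog_tupleI[of m p n q vs] by (intro pm.span_base) blast
  next
    case (Suc k)
    obtain v0 v1 where v: "vs ! k = v0 + v1" "v0 \<in> homog natural_module 0" "v1 \<in> homog natural_module 1"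
      using natural_decomp by blast
    have "P (m, n, vs) = P (m, n, vs[k := v0 + v1])" using v(1) by (metis list_update_id)
    also have "\<dots> = P (m, n, vs[k := v0]) + P (m, n, vs[k := v1])"
      using Suc.prems by (intro P_V_add) (auto simp: tuples_def sM.homog_carrier sN.homog_carrier)
    also have "\<dots> \<in> ?S"
    proof (rule pm.span_add)
      have *: "\<exists>r. vs[k := v'] ! i \<in> homog natural_module r"
        if "k \<le> i" "i < d" "v' \<in> homog natural_module r" for i v' r
        using that Suc.prems(3) Suc.prems(4)[of i] by (cases "i = k") auto
      show "P (m, n, vs[k := v0]) \<in> ?S"
        using Suc.prems *[OF _ _ v(2)] by (intro Suc.IH) auto
      show "P (m, n, vs[k := v1]) \<in> ?S"
        using Suc.prems *[OF _ _ v(3)] by (intro Suc.IH) auto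
    qed
    finally show ?case .
  qed
  obtain m n vs where w: "w = (m, n, vs)" "m \<in> carrier M" "n \<in> carrier N" "length vs = d"
    using assms by (auto simp: tuples_def)
  obtain m0 m1 where m: "m0 \<in> homog M 0" "m1 \<in> homog M 1" "m = m0 \<oplus>\<^bsub>M\<^esub> m1" using sM.homog_decomp w by blast
  obtain n0 n1 where n: "n0 \<in> homog N 0" "n1 \<in> homog N 1" "n = n0 \<oplus>\<^bsub>N\<^esub> n1" using sN.homog_decomp w by blast
  note c = m(1,2)[THEN sM.homog_carrier] n(1,2)[THEN sN.homog_carrier]
  have "P (m, n, vs) = (P (m0, n0, vs) + P (m0, n1, vs)) + (P (m1, n0, vs) + P (m1, n1, vs))"
    using w c m(3) n(3) by (simp add: P_M_add P_N_add tuples_def)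
  also have "\<dots> \<in> ?S"
    by (intro pm.span_add V[of _ _ _ _ _ d]) (use m n w in auto)
  finally show ?thesis using w by simp
qed

lemma rho_homog_span: "rho y \<in> pm.span {P w | w ps. homog_tuple M N d ps w}"
proof -
  have "rho y \<in> pm.span (point ` tup)" using rho(4)[of y] by (intro span_points) (simp add: FS_simps)
  then have "rho (rho y) \<in> pm.span {P w | w ps. homog_tuple M N d ps w}"
  proof (induction rule: pm.span_induct_alt)
    case (step c x y)
    then show ?case using P_homog_span by (auto simp: rho_lin P_def[symmetric] pm.span_add pm.span_scale)
  qed (simp add: rho_lin pm.span_zero)
  then show ?thesis by (simp add: rho)
qed

lemma graded_part_closed: "0 \<in> graded_part p" "x \<in> graded_part p \<Longrightarrow> y \<in> graded_part p
    \<Longrightarrow> x + y \<in> graded_part p" "x \<in> graded_part p \<Longrightarrow> scl c x \<in> graded_part p"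
  unfolding graded_part_def by (rule pm.span_zero pm.span_add pm.span_scale; assumption)+

lemma P_graded_part: "homog_tuple M N d ps w \<Longrightarrow> P w \<in> graded_part (sum_list ps)"
  unfolding graded_part_def by (intro pm.span_base CollectI exI[of _ w] exI[of _ ps]) simp

lemma homog_span_sum:
  assumes "y \<in> pm.span {P w | w ps. homog_tuple M N d ps w}"
  shows "\<exists>y0\<in>graded_part 0. \<exists>y1\<in>graded_part 1. y = y0 + y1"
  using assms
proof (induction rule: pm.span_induct_alt)
  case base
  show ?case by (rule bexI[OF _ graded_part_closed(1)], rule bexI[OF _ graded_part_closed(1)]) simp
next
  case (step c x y)
  obtain y0 y1 where y: "y0 \<in> graded_part 0" "y1 \<in> graded_part 1" "y = y0 + y1" using step(2) by blast
  obtain w ps where "x = P w" "homog_tuple M N d ps w" using step(1) by blast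
  then have x: "x \<in> graded_part (sum_list ps)" using P_graded_part by simp
  show ?case
  proof (cases "sum_list ps = 0")
    case True
    then have "scl c x + y0 \<in> graded_part 0"
        using graded_part_closed(2)[OF graded_part_closed(3)[OF x]] y(1) by simp
    then show ?thesis by (rule bexI[rotated]) (rule bexI[OF _ y(2)], simp add: y(3) add.assoc)
  next
    case False
    then have "scl c x + y1 \<in> graded_part 1"
        using graded_part_closed(2)[OF graded_part_closed(3)[OF x]] y(2) by simp
    from bexI[OF _ this] show ?thesis by (rule bexI[OF _ y(1)]) (simp add: y(3) add.left_commute)
  qed
qed

lemma graded_part_rho: "y \<in> graded_part p \<Longrightarrow> rho y = y" unfolding graded_part_def
  by (induction rule: pm.span_induct_alt) (auto simp: rho_lin P_def rho(5))

lemma graded_part_FS: "y \<in> graded_part p \<Longrightarrow> y \<in> carrier FS" using graded_part_rho rho(4) by metis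

lemma ap_even_slot:
  assumes "w \<in> tup" "loc_linear p a"
  shows "ap (slot 0 p a) (P w) = P (tuple_map ((\<lambda>_. loc_id)(p := a)) w)"
proof -
  have "slot 0 p a = G ((\<lambda>_. loc_id)(p := a))" using assms unfolding slot_def by (intro G_cong) auto
  then show ?thesis using assms by (simp add: ap_G)
qed

lemma tuple_map_single:
  assumes "(m, n, vs) \<in> tup"
  shows "tuple_map ((\<lambda>_. loc_id)(0 := a)) (m, n, vs) = (fst a m, n, vs)"
    "tuple_map ((\<lambda>_. loc_id)(Suc 0 := a)) (m, n, vs) = (m, fst (snd a) n, vs)"
    "k < d \<Longrightarrow> tuple_map ((\<lambda>_. loc_id)(Suc (Suc k) := a)) (m, n, vs) = (m, n, vs[k := snd (snd a) *v (vs ! k)])"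
  using tuple_map_id[OF assms] assms by (auto simp: tuple_map_upd tuples_def) (simp_all add: loc_id_def)

lemma P_loc_sigma:
  assumes "homog_tuple M N d ps w" "p < d + 2"
  shows "P (tuple_map ((\<lambda>_. loc_id)(p := loc_sigma)) w) = scl (psign (ps ! p)) (P w)"
proof -
  obtain m n vs where w: "w = (m, n, vs)" by (cases w)
  have tup: "(m, n, vs) \<in> tup" using homog_tuple_tup assms w by auto
  obtain p' q' rs where h: "ps = p' # q' # rs" "m \<in> homog M p'" "n \<in> homog N q'" "length vs
      = d" "list_all2 (\<lambda>v r. v \<in> homog natural_module r) vs rs"
    using assms w by (auto simp: homog_tuple.simps)
  from assms(2) show ?thesis
  proof (rule position_cases)
    assume 1: "p = 0"

    then show ?thesis using h by (simp add: w tuple_map_single[OF tup] loc_sigma_def sM.\<sigma>_homog P_M_smult[OF tup])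
  next
    assume 2: "p = Suc 0"
    then show ?thesis using h by (simp add: w tuple_map_single[OF tup] loc_sigma_def sN.\<sigma>_homog P_N_smult[OF tup])
  next
    fix k assume 3: "p = Suc (Suc k)" "k < d"
    then have "vs ! k \<in> homog natural_module (rs ! k)" using h by (auto simp: list_all2_conv_all_nth)
    then show ?thesis using 3 h P_V_smult[OF tup, of k "psign (rs ! k)" "vs ! k"]
      by (simp add: w tuple_map_single[OF tup] loc_sigma_def parity_matrix_vector)
  qed
qed

lemma ap_prefix:
  assumes "homog_tuple M N d ps w" "p \<le> d + 2"
  shows "ap (G (\<lambda>q. if q < p then loc_sigma_pow t else loc_id)) (P w) = scl (psign (\<Sum>j<p. t * ps ! j)) (P w)"
  using assms(2)
proof (induction p)
  case 0
  then show ?case using homog_tuple_tup[OF assms(1)] by (simp add: G_id P_def rho)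
next
  case (Suc p)
  have "G (\<lambda>q. if q < Suc p then loc_sigma_pow t else loc_id)
      = G ((\<lambda>_. loc_id)(p := loc_sigma_pow t)) * G (\<lambda>q. if q < p then loc_sigma_pow t else loc_id)"
    by (subst G_mult) (auto intro!: G_cong simp: less_Suc_eq)
  moreover have "ap (G ((\<lambda>_. loc_id)(p := loc_sigma_pow t))) (P w) = scl (psign (t * ps ! p)) (P w)"
    using P_loc_sigma[OF assms(1), of p] homog_tuple_tup[OF assms(1)] Suc.prems
    by (cases t) (auto simp: ap_G tuple_map_id fun_upd_idem)
  ultimately show ?case using Suc by (simp add: ap_lin psign_add)
qed

text \<open>
  On homogeneous pure tensors the involutions contribute the sign of the Koszul rule.
\<close>

lemma ap_slot:
  assumes "homog_tuple M N d ps w" "p < d + 2" "loc_linear p a"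
  shows "ap (slot t p a) (P w) = scl (psign (\<Sum>j<p. t * ps ! j)) (P (tuple_map ((\<lambda>_. loc_id)(p := a)) w))"
proof -
  have "slot t p a = slot 0 p a * G (\<lambda>q. if q < p then loc_sigma_pow t else loc_id)"
    unfolding slot_def using assms by (subst G_mult) (auto intro!: G_cong)
  then show ?thesis
    using ap_prefix[OF assms(1), of p t] assms homog_tuple_tup[OF assms(1)] by (simp add: ap_lin ap_even_slot)
qed

lemma ap_Pi:
  assumes "homog_tuple M N d ps w" shows "ap Pi_op (P w) = scl (psign (sum_list ps)) (P w)"
proof -
  have "Pi_op = G (\<lambda>q. if q < d + 2 then loc_sigma_pow 1 else loc_id)"
    unfolding Pi_op_def by (rule G_cong) auto
  then show ?thesis using ap_prefix[OF assms, of "d + 2" 1] homog_tuple_tup(2)[OF assms]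
    by (simp add: sum_list_sum_nth lessThan_atLeast0)
qed

text \<open>
  Homogeneous vectors are the eigenvectors of the total involution.  The grading is defined by
  spans of pure tensors, but in this form it can be checked by commuting an operator past
  \<open>Pi_op\<close>.
\<close>

lemma graded_part_iff: "y \<in> graded_part p \<longleftrightarrow> rho y = y \<and> ap Pi_op y = scl (psign p) y"
proof -
  have HTP: "ap Pi_op y = scl (psign p) y" if "y \<in> graded_part p" for y p
    using that unfolding graded_part_def
  proof (induction rule: pm.span_induct_alt)
    case (step c x y)
    obtain w ps where w: "x = P w" "homog_tuple M N d ps w" "sum_list ps = p" using step(1) by blast
    have "ap Pi_op x = scl (psign p) x" using ap_Pi[OF w(2)] unfolding w(1,3) .
    then show ?case
      unfolding ap_lin(1,2) pm.scale_right_distrib step(2) by (simp only: pm.scale_left_commute)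
  qed (simp only: ap_lin(3) pm.scale_zero_right)
  \<comment> \<open>The component of the wrong parity is equal to its negative.\<close>
  have double: "x = 0" if "x + x = 0" for x :: "('m, 'n, 'k) tensor_tuple \<Rightarrow>\<^sub>0 complex"
  proof -
    have "scl 2 x = 0" using that pm.scale_left_distrib[of 1 1 x] by simp
    then show ?thesis by (simp only: pm.scale_eq_0_iff) simp
  qed
  have "y \<in> graded_part p" if y: "rho y = y" "ap Pi_op y = scl (psign p) y"
  proof -
    obtain y0 y1 where 1: "y0 \<in> graded_part 0" "y1 \<in> graded_part 1" "y = y0 + y1"
      using homog_span_sum[OF rho_homog_span[of y, unfolded y(1)]] by blast
    have "ap Pi_op y = y0 - y1"
      unfolding 1(3) ap_lin(1) HTP[OF 1(1)] HTP[OF 1(2)] by (simp add: scl_minus_one)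
    then have 2: "y0 - y1 = scl (psign p) (y0 + y1)" unfolding y(2) unfolding 1(3) by (rule sym)
    show "y \<in> graded_part p"
    proof (cases "p = 0")
      case True
      then have "y1 + y1 = 0" using 2 by (simp add: algebra_simps)
      then have "y1 = 0" by (rule double)
      then show ?thesis using 1 True by simp
    next
      case False
      then have "p = 1" by simp
      then have "y0 - y1 = - (y0 + y1)" using 2 by (simp add: scl_minus_one)
      then have "(y0 - y1) + (y0 + y1) = 0" by (simp only: left_minus)
      then have "y0 + y0 = 0" by simp
      then have "y0 = 0" by (rule double)
      then show ?thesis using 1 \<open>p = 1\<close> by simp
    qed
  qed
  then show ?thesis using graded_part_rho HTP by blast
qed

end

section \<open>Endomorphisms of the tensor product\<close>

lemma replicate_update_same: "(replicate n c)[k := c] = replicate n c"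
  by (cases "k < n") (auto simp: nth_list_update list_update_beyond intro!: nth_equalityI)

context tensor begin

abbreviation "TS \<equiv> tensor_space M N d"
abbreviation "TM \<equiv> tensor_module M N d"

lemma TS_simps: "carrier TS = carrier Q" "add TS = add Q" "zero TS = zero Q" "smult TS = smult Q"
  by (simp_all add: tensor_space_def Let_def module.defs)

lemma TM_simps: "carrier TM = carrier Q" "add TM = add Q" "zero TM = zero Q" "smult TM = smult Q" "homog TM
    = homog TS"
  "act TM x w = tensor_act M N d 0 (qn_part 0 x) w \<oplus>\<^bsub>Q\<^esub> tensor_act M N d 1 (qn_part 1 x) w"
  by (simp_all add: tensor_module_def superspace.defs qmodule.defs TS_simps)

lemma homog_TS: "homog TS p = cls ` graded_part p"
proof -
  have "{pure M N d w | w ps. homog_tuple M N d ps w \<and> sum_list ps = p}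
      = cls ` {P w | w ps. homog_tuple M N d ps w \<and> sum_list ps = p}"
  proof (intro equalityI subsetI)
    fix X assume "X \<in> {pure M N d w | w ps. homog_tuple M N d ps w \<and> sum_list ps = p}"
    then obtain w ps where w: "X = pure M N d w" "homog_tuple M N d ps w" "sum_list ps = p" by blast
    then show "X \<in> cls ` {P w | w ps. homog_tuple M N d ps w \<and> sum_list ps = p}"
      unfolding w(1) pure_eq[OF homog_tuple_tup(1)[OF w(2)]] by blast
  next
    fix X assume "X \<in> cls ` {P w | w ps. homog_tuple M N d ps w \<and> sum_list ps = p}"
    then obtain w ps where w: "X = cls (P w)" "homog_tuple M N d ps w" "sum_list ps = p" by blast
    then show "X \<in> {pure M N d w | w ps. homog_tuple M N d ps w \<and> sum_list ps = p}"
      unfolding w(1) pure_eq[OF homog_tuple_tup(1)[OF w(2)], symmetric] by blast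
  qed
  moreover have "{P w | w ps. homog_tuple M N d ps w \<and> sum_list ps = p} \<subseteq> carrier FS"
    by (auto simp: P_def rho)
  moreover have "homog TS p = lin_span Q {pure M N d w | w ps. homog_tuple M N d ps w \<and> sum_list ps = p}"
    by (simp add: tensor_space_def Let_def module.defs superspace.defs)
  ultimately show ?thesis
    unfolding graded_part_def by (simp only: lin_span_Q)
qed

lemma finsum_TS: "finsum TS f A = finsum Q f A"
  by (simp add: finsum_def finprod_def TS_simps)

lemma minus_TS: "x \<ominus>\<^bsub>TS\<^esub> y = x \<ominus>\<^bsub>Q\<^esub> y"
  by (simp add: a_minus_def a_inv_def m_inv_def TS_simps)

text \<open>
  An operator in the corner kills the relations, so the chosen representative of a coset does not
  affect the value.
\<close>

definition induced :: "('m, 'n, 'k) tensor_tuple linop \<Rightarrow> ('k, 'm, 'n) tens \<Rightarrow> ('k, 'm, 'n) tens" where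
  "induced x = (\<lambda>X\<in>carrier Q. cls (ap x (SOME v. v \<in> X)))"

lemma induced_cls: assumes "x \<in> corner" "y \<in> carrier FS" shows "induced x (cls y) = cls (ap x y)"
proof -
  have "(SOME v. v \<in> cls y) \<in> cls y" using self_in_cls by (rule someI)
  then have "ap x ((SOME v. v \<in> cls y) - y) = 0" using assms by (intro ap_corner(4)) (auto simp: cls_mem)
  then show ?thesis using assms by (simp add: induced_def ap_lin)
qed

lemma induced_linear: assumes "x \<in> corner" shows "induced x \<in> linear_maps TS TS"
proof -
  have "induced x \<in> carrier Q \<rightarrow>\<^sub>E carrier Q"
    using assms ap_corner(1) by (auto simp: induced_def)
  then show ?thesis
    using assms sub ap_corner(1)[OF assms]
    by (auto simp: linear_maps_def TS_simps carrier_Q add_Q smult_Q induced_cls ap_lin)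
qed

lemma induced_eqI:
  assumes "x \<in> corner" "g \<in> extensional (carrier Q)" "\<And>y. y \<in> carrier FS \<Longrightarrow> g (cls y) = cls (ap x y)"
  shows "g = induced x"
proof (rule extensionalityI[OF assms(2)])
  show "induced x \<in> extensional (carrier Q)" by (simp add: induced_def)
  fix X assume "X \<in> carrier Q"
  then obtain y where y: "X = cls y" "y \<in> carrier FS" unfolding carrier_Q by blast
  show "g X = induced x X" unfolding y(1) assms(3)[OF y(2)] induced_cls[OF assms(1) y(2)] ..
qed

lemma End_simps: "carrier (End_super TM) = linear_maps TS TS"
  "f \<otimes>\<^bsub>End_super TM\<^esub> g = compose (carrier Q) f g" "\<one>\<^bsub>End_super TM\<^esub> = (\<lambda>x\<in>carrier Q. x)"
  "f \<oplus>\<^bsub>End_super TM\<^esub> g = (\<lambda>x\<in>carrier Q. f x \<oplus>\<^bsub>Q\<^esub> g x)" "\<zero>\<^bsub>End_super TM\<^esub> = (\<lambda>x\<in>carrier Q. \<zero>\<^bsub>Q\<^esub>)"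
  "c \<odot>\<^bsub>End_super TM\<^esub> f = (\<lambda>x\<in>carrier Q. c \<odot>\<^bsub>Q\<^esub> f x)"
  "homog (End_super TM) p = {f \<in> linear_maps TS TS. \<forall>q. f ` homog TS q \<subseteq> homog TS (p + q)}"
  by (simp_all add: End_super_def TM_simps TS_simps linear_maps_def)

lemma induced_mult: "x \<in> corner \<Longrightarrow> y \<in> corner \<Longrightarrow> induced x \<otimes>\<^bsub>End_super TM\<^esub> induced y = induced (x * y)"
  unfolding End_simps by (rule induced_eqI) (auto simp: compose_def induced_cls ap_corner(1))
lemma induced_add: "x \<in> corner \<Longrightarrow> y \<in> corner \<Longrightarrow> induced x \<oplus>\<^bsub>End_super TM\<^esub> induced y = induced (x + y)"
  unfolding End_simps by (rule induced_eqI) (auto simp: induced_cls add_Q)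
lemma induced_smult: "x \<in> corner \<Longrightarrow> c \<odot>\<^bsub>End_super TM\<^esub> induced x = induced (scal c * x)"
  unfolding End_simps by (rule induced_eqI) (auto simp: induced_cls smult_Q)
lemma induced_one: "\<one>\<^bsub>End_super TM\<^esub> = induced u"
  unfolding End_simps by (rule induced_eqI) (auto simp: cls_rho)
lemma induced_zero: "\<zero>\<^bsub>End_super TM\<^esub> = induced 0"
  unfolding End_simps by (rule induced_eqI) (auto simp: zero_Q)

lemma linear_mapsD:
  assumes "g \<in> linear_maps TS TS"
  shows "g \<in> extensional (carrier Q)" "x \<in> carrier Q \<Longrightarrow> g x \<in> carrier Q"
    "x \<in> carrier Q \<Longrightarrow> y \<in> carrier Q \<Longrightarrow> g (x \<oplus>\<^bsub>Q\<^esub> y) = g x \<oplus>\<^bsub>Q\<^esub> g y"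
    "x \<in> carrier Q \<Longrightarrow> g (c \<odot>\<^bsub>Q\<^esub> x) = c \<odot>\<^bsub>Q\<^esub> g x"
proof -
  note * = assms[unfolded linear_maps_def TS_simps mem_Collect_eq]
  show "g \<in> extensional (carrier Q)" using *[THEN conjunct1] by (simp add: PiE_iff)
  show "x \<in> carrier Q \<Longrightarrow> g x \<in> carrier Q" using *[THEN conjunct1] by (rule PiE_mem)
  show "x \<in> carrier Q \<Longrightarrow> y \<in> carrier Q \<Longrightarrow> g (x \<oplus>\<^bsub>Q\<^esub> y) = g x \<oplus>\<^bsub>Q\<^esub> g y"
    using *[THEN conjunct2, THEN conjunct1] by blast
  show "x \<in> carrier Q \<Longrightarrow> g (c \<odot>\<^bsub>Q\<^esub> x) = c \<odot>\<^bsub>Q\<^esub> g x"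
    using *[THEN conjunct2, THEN conjunct2] by blast
qed

lemma End_add_closed:
  assumes f: "f \<in> linear_maps TS TS" and g: "g \<in> linear_maps TS TS"
  shows "f \<oplus>\<^bsub>End_super TM\<^esub> g \<in> linear_maps TS TS"
proof -
  interpret Qm: cmodule Q using module_Q by (simp add: cmodule_def)
  note c = linear_mapsD(2)[OF f] linear_mapsD(2)[OF g]
  show ?thesis
    unfolding linear_maps_def TS_simps mem_Collect_eq End_simps(4)
  proof (intro conjI ballI allI)
    show "(\<lambda>x\<in>carrier Q. f x \<oplus>\<^bsub>Q\<^esub> g x) \<in> carrier Q \<rightarrow>\<^sub>E carrier Q"
      by (rule restrict_PiE[THEN iffD2]) (simp add: c Pi_iff)
  next
    fix x y assume xy: "x \<in> carrier Q" "y \<in> carrier Q"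
    have "(f x \<oplus>\<^bsub>Q\<^esub> f y) \<oplus>\<^bsub>Q\<^esub> (g x \<oplus>\<^bsub>Q\<^esub> g y) = (f x \<oplus>\<^bsub>Q\<^esub> g x) \<oplus>\<^bsub>Q\<^esub> (f y \<oplus>\<^bsub>Q\<^esub> g y)"
      using xy c by (simp only: Qm.a_ac Qm.a_closed)
    then show "(\<lambda>x\<in>carrier Q. f x \<oplus>\<^bsub>Q\<^esub> g x) (x \<oplus>\<^bsub>Q\<^esub> y)
        = (\<lambda>x\<in>carrier Q. f x \<oplus>\<^bsub>Q\<^esub> g x) x \<oplus>\<^bsub>Q\<^esub> (\<lambda>x\<in>carrier Q. f x \<oplus>\<^bsub>Q\<^esub> g x) y"
      using xy by (simp only: restrict_apply' Qm.a_closed linear_mapsD(3)[OF f] linear_mapsD(3)[OF g])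
  next
    fix a x assume x: "x \<in> carrier Q"
    then show "(\<lambda>x\<in>carrier Q. f x \<oplus>\<^bsub>Q\<^esub> g x) (a \<odot>\<^bsub>Q\<^esub> x) = a \<odot>\<^bsub>Q\<^esub> (\<lambda>x\<in>carrier Q. f x \<oplus>\<^bsub>Q\<^esub> g x) x"
      by (simp only: restrict_apply' Qm.smult_simps(1) linear_mapsD(4)[OF f] linear_mapsD(4)[OF g] Qm.smult_distribs(1) c)
  qed
qed

lemma End_abelian_monoid: "abelian_monoid (End_super TM)"
proof (rule abelian_monoidI, unfold End_simps(1))
  interpret Q: abelian_group Q by (rule abelian_group_Q)
  show "\<zero>\<^bsub>End_super TM\<^esub> \<in> linear_maps TS TS" unfolding induced_zero by (rule induced_linear) simp
  show "f \<oplus>\<^bsub>End_super TM\<^esub> g \<in> linear_maps TS TS" if "f \<in> linear_maps TS TS" "g \<in> linear_maps TS TS" for f g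
    using that by (rule End_add_closed)
  fix f assume f: "f \<in> linear_maps TS TS"
  note fc = linear_mapsD(2)[OF f]
  show "\<zero>\<^bsub>End_super TM\<^esub> \<oplus>\<^bsub>End_super TM\<^esub> f = f"
    unfolding End_simps
    by (rule extensionalityI[OF restrict_extensional linear_mapsD(1)[OF f]]) (simp add: fc)
  fix g assume g: "g \<in> linear_maps TS TS"
  note gc = linear_mapsD(2)[OF g]
  show "f \<oplus>\<^bsub>End_super TM\<^esub> g = g \<oplus>\<^bsub>End_super TM\<^esub> f"
    unfolding End_simps by (rule restrict_ext) (simp only: Q.a_comm fc gc)
  fix h assume h: "h \<in> linear_maps TS TS"
  note hc = linear_mapsD(2)[OF h]
  show "f \<oplus>\<^bsub>End_super TM\<^esub> g \<oplus>\<^bsub>End_super TM\<^esub> h = f \<oplus>\<^bsub>End_super TM\<^esub> (g \<oplus>\<^bsub>End_super TM\<^esub> h)"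
    unfolding End_simps by (rule restrict_ext) (simp only: restrict_apply' Q.a_assoc fc gc hc)
qed

lemma induced_finsum:
  assumes "finite A" "\<And>i. i \<in> A \<Longrightarrow> f i \<in> corner"
  shows "finsum (End_super TM) (\<lambda>i. induced (f i)) A = induced (sum f A)"
proof -
  interpret E: abelian_monoid "End_super TM" by (rule End_abelian_monoid)
  show ?thesis using assms
  proof (induction A rule: finite_induct)
    case empty
    show ?case unfolding E.finsum_empty sum.empty by (rule induced_zero)
  next
    case (insert i A)
    have "finsum (End_super TM) (\<lambda>i. induced (f i)) (insert i A)
        = induced (f i) \<oplus>\<^bsub>End_super TM\<^esub> finsum (End_super TM) (\<lambda>i. induced (f i)) A"
      by (rule E.finsum_insert[OF insert(1,2)]) (auto simp only: End_simps(1) Pi_iff intro!: induced_linear insert.prems)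
    also have "finsum (End_super TM) (\<lambda>i. induced (f i)) A = induced (sum f A)"
      by (rule insert.IH) (rule insert.prems, simp)
    also have "induced (f i) \<oplus>\<^bsub>End_super TM\<^esub> induced (sum f A) = induced (f i + sum f A)"
      by (rule induced_add) (auto intro!: insert.prems corner_sum)
    finally show ?case using insert(1,2) by simp
  qed
qed

lemma induced_pure:
  assumes "x \<in> corner" "homog_tuple M N d ps w" shows "induced x (pure M N d w) = cls (ap x (P w))"
proof -
  have "induced x (cls (P w)) = cls (ap x (P w))"
    by (rule induced_cls[OF assms(1)]) (simp only: P_def rho(4))
  then show ?thesis by (simp only: pure_eq[OF homog_tuple_tup(1)[OF assms(2)]])
qed

lemma linear_map_eq_induced:
  assumes x: "x \<in> corner" and g: "g \<in> linear_maps TS TS"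
    and gp: "\<And>ps w. homog_tuple M N d ps w \<Longrightarrow> g (pure M N d w) = cls (ap x (P w))"
  shows "g = induced x"
proof (rule induced_eqI[OF x])
  note gl' = g[unfolded linear_maps_def TS_simps mem_Collect_eq]
  note ge = gl'[THEN conjunct1] and gl = gl'[THEN conjunct2, THEN conjunct1] gl'[THEN conjunct2, THEN conjunct2]
  show "g \<in> extensional (carrier Q)" using ge by (simp add: PiE_iff)
  fix y assume y: "y \<in> carrier FS"
  have gadd: "g (cls (a + b)) = g (cls a) \<oplus>\<^bsub>Q\<^esub> g (cls b)"
    if "a \<in> carrier FS" "b \<in> carrier FS" for a b
    using bspec[OF bspec[OF gl(1) carrier_mem[OF that(1)]] carrier_mem[OF that(2)]]
    unfolding add_Q .
  have gsc: "g (cls (scl c a)) = c \<odot>\<^bsub>Q\<^esub> g (cls a)"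
    if "a \<in> carrier FS" for a c
    using bspec[OF spec[OF gl(2)] carrier_mem[OF that]] unfolding smult_Q .
  have "rho y \<in> carrier FS \<and> g (cls (rho y)) = cls (ap x (rho y))" using rho_homog_span[of y]
  proof (induction rule: pm.span_induct_alt)
    case base
    interpret Qm: cmodule Q using module_Q by (simp add: cmodule_def)
    have "g (cls 0) \<in> carrier Q" using ge carrier_mem[OF sub(3)] by (rule PiE_mem)
    then have "0 \<odot>\<^bsub>Q\<^esub> g (cls 0) = cls 0" unfolding zero_Q[symmetric] by (rule Qm.smult_simps(4))
    then have "g (cls 0) = cls 0"
      using gsc[OF sub(3), of 0] unfolding pm.scale_zero_left by (rule trans[rotated])
    then show ?case unfolding ap_lin(3) using sub(3) by (rule conjI[rotated])
  next
    case (step c a b)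
    obtain w ps where w: "a = P w" "homog_tuple M N d ps w" using step(1) by blast
    have ga: "g (cls a) = cls (ap x a)"
      using gp[OF w(2)] unfolding pure_eq[OF homog_tuple_tup(1)[OF w(2)]] w(1)[symmetric] .
    have a: "a \<in> carrier FS" unfolding w(1) P_def by (rule rho(4))
    note b = step(2)[THEN conjunct1] step(2)[THEN conjunct2]
    have ca: "scl c a \<in> carrier FS" using a by (rule sub(2))
    have "g (cls (scl c a + b)) = cls (ap x (scl c a + b))"
      unfolding gadd[OF ca b(1)] gsc[OF a] ga b(2) smult_Q add_Q ap_lin(1,2) ..
    with sub(1)[OF ca b(1)] show ?case by (rule conjI)
  qed
  then have "g (cls (rho y)) = cls (ap x (rho y))" by (rule conjunct2)
  then show "g (cls y) = cls (ap x y)" unfolding cls_rho[OF y] ap_corner(3)[OF x] .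
qed

text \<open>
  A linear extension is identified by exhibiting an operator with the prescribed values on
  homogeneous pure tensors: it exists by construction and is unique since these tensors span.
\<close>

lemma induced_lin_ext:
  assumes x: "x \<in> corner" and F: "\<And>ps w. homog_tuple M N d ps w \<Longrightarrow> F' ps w = cls (ap x (P w))"
  shows "lin_ext M N d F' = induced x"
proof -
  let ?P = "\<lambda>g. g \<in> linear_maps TS TS \<and> (\<forall>ps w. homog_tuple M N d ps w \<longrightarrow> g (pure M N d w) = F' ps w)"
  have 1: "?P (induced x)"
    by (intro conjI allI impI induced_linear[OF x]) (simp only: F induced_pure[OF x])
  have 2: "g = induced x" if "?P g" for g
    using that by (intro linear_map_eq_induced[OF x]) (simp_all only: F)
  show ?thesis unfolding lin_ext_def by (rule the_equality[of ?P, OF 1 2])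
qed

end

section \<open>The prescribed operators\<close>

lemma koszul_single:
  assumes "length ps = n" "p < n"
  shows "koszul ((replicate n 0)[p := t]) ps = psign (\<Sum>j<p. t * ps ! j)"
proof -
  have "(\<Sum>i<n. \<Sum>j<i. (replicate n 0)[p := t] ! i * ps ! j) = (\<Sum>i<n. if i = p then (\<Sum>j<p. t * ps ! j) else 0)"
    using assms by (intro sum.cong) (auto simp: nth_list_update)
  then show ?thesis using assms by (simp add: koszul_def)
qed

context tensor begin

lemma position_bij: "bij_betw position (factors d) {..<d + 2}"
proof (rule bij_betw_imageI)
  show "inj_on position (factors d)" by (auto simp: inj_on_def factors_def)
  have "p \<in> position ` factors d" if "p < d + 2" for p
    using that
  proof (rule position_cases)
    fix k assume "p = Suc (Suc k)" "k < d"
    then show ?thesis by (auto simp: factors_def intro!: image_eqI[of _ _ "FactorV (Suc k)"])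
  qed (force simp: factors_def)+
  then show "position ` factors d = {..<d + 2}" by (auto simp: factors_def)
qed

lemma act_at_eq:
  assumes "A \<in> factors d" "w \<in> tup"
  shows "act_at M N A x w = tuple_map ((\<lambda>_. loc_id)(position A := loc_act x)) w"
proof -
  obtain m n vs where w: "w = (m, n, vs)" by (cases w)
  show ?thesis
  proof (cases A)
    case (FactorV k)
    then obtain k' where "k = Suc k'" "k' < d" using assms(1) by (cases k) (auto simp: factors_def)
    then show ?thesis using assms w FactorV by (simp add: tuple_map_single loc_act_def natural_module_def)
  qed (use assms w in \<open>simp_all add: tuple_map_single loc_act_def\<close>)
qed

lemma act_at_tup: "A \<in> factors d \<Longrightarrow> w \<in> tup \<Longrightarrow> x \<in> qn \<Longrightarrow> act_at M N A x w \<in> tup"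
  by (simp add: act_at_eq tuple_map_tuples loc_linear_loc_act)

lemma signed_op_eq:
  assumes "homog_tuple M N d ps w" "p < d + 2" "f w \<in> tup"
  shows "signed_op M N d ((replicate (d + 2) 0)[p := t]) f ps w = cls (scl (psign (\<Sum>j<p. t * ps ! j)) (P (f w)))"
  using assms koszul_single[OF homog_tuple_tup(2)[OF assms(1)] assms(2)]
  by (simp add: signed_op_def TS_simps pure_eq smult_Q)

text \<open>
  The prescription by the Koszul sign and the construction by involutions agree.
\<close>

lemma signed_slot:
  assumes "homog_tuple M N d ps w" "p < d + 2" "loc_linear p a" "f w = tuple_map ((\<lambda>_. loc_id)(p := a)) w"
  shows "signed_op M N d ((replicate (d + 2) 0)[p := t]) f ps w = cls (ap (slot t p a) (P w))"
proof -
  have "f w \<in> tup" unfolding assms(4) using assms(3) homog_tuple_tup(1)[OF assms(1)]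
      by (intro tuple_map_tuples) auto
  from signed_op_eq[where f = f, OF assms(1,2) this] show ?thesis unfolding ap_slot[OF assms(1-3)] assms(4) .
qed

text \<open>
  The action of a homogeneous element on the whole tensor product through the iterated coproduct.
\<close>

definition total_act :: "bit \<Rightarrow> 'k mat2 \<Rightarrow> ('m, 'n, 'k) tensor_tuple linop" where
  "total_act t x = (\<Sum>p<d + 2. slot_act t p x)"

lemma total_act_corner [simp, intro]: "total_act t x \<in> corner" by (simp add: total_act_def)

lemma P_FS [simp, intro]: "P w \<in> carrier FS" by (simp add: P_def rho)

lemma finite_factors [simp]: "finite (factors d)" by (simp add: factors_def)

lemma tensor_act_eq: assumes "x \<in> qn" shows "tensor_act M N d t x = induced (total_act t x)"
  unfolding tensor_act_def
proof (rule induced_lin_ext)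
  fix ps w assume h: "homog_tuple M N d ps w"
  interpret Q: abelian_group Q by (rule abelian_group_Q)
  have p: "position A < d + 2" if "A \<in> factors d" for A using that position_bij by (auto simp: bij_betw_def)
  have "finsum Q (\<lambda>A. signed_op M N d ((replicate (d + 2) 0)[position A := t]) (act_at M N A x) ps w) (factors d)
    = finsum Q (\<lambda>A. cls (ap (slot_act t (position A) x) (P w))) (factors d)"
    using h assms p homog_tuple_tup[OF h] unfolding slot_act_def
    by (intro Q.finsum_cong' refl signed_slot) (auto simp: act_at_eq loc_linear_loc_act ap_corner)
  also have "\<dots> = cls (\<Sum>A\<in>factors d. ap (slot_act t (position A) x) (P w))"
    by (rule finsum_Q) (auto simp: ap_corner)
  also have "(\<Sum>A\<in>factors d. ap (slot_act t (position A) x) (P w)) = ap (total_act t x) (P w)"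
    unfolding total_act_def ap_sum by (rule sum.reindex_bij_betw[OF position_bij])
  finally show "finsum TS (\<lambda>A. signed_op M N d ((replicate (d + 2) 0)[position A := t]) (act_at M N A x) ps w) (factors d)
      = cls (ap (total_act t x) (P w))"
    by (simp only: finsum_TS)
qed simp

lemma tuple_map_commute: "p \<noteq> q \<Longrightarrow> tuple_map ((\<lambda>_. loc_id)(p := a)) (tuple_map ((\<lambda>_. loc_id)(q := b)) w)
    = tuple_map ((\<lambda>_. loc_id)(q := b)) (tuple_map ((\<lambda>_. loc_id)(p := a)) w)"
  unfolding tuple_map_comp by (rule arg_cong[where f = "\<lambda>l. tuple_map l w"]) auto

lemma Om_corner [simp, intro]: "alg.Om p q \<in> corner"
  unfolding alg.Om_def E_def F_def by auto

lemma finsum_Q2: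
  fixes f :: "'k \<Rightarrow> 'k \<Rightarrow> _"
  assumes "\<And>i j. f i j \<in> carrier FS"
  shows "finsum Q (\<lambda>i. finsum Q (\<lambda>j. cls (f i j)) UNIV) UNIV = cls (\<Sum>i\<in>UNIV. \<Sum>j\<in>UNIV. f i j)"
proof -
  have "finsum Q (\<lambda>j. cls (f i j)) UNIV = cls (\<Sum>j\<in>UNIV. f i j)" for i
    using assms by (intro finsum_Q) auto
  then show ?thesis using assms
    by (simp add: finsum_Q pm.subspace_sum[OF sub_A])
qed

text \<open>
  In the summands $f_{ij} \otimes e_{ji}$ the even leg on the right is moved past the odd leg on the left
  before evaluation, so that in both sums the operator with the involutions acts first, on the original
  homogeneous tuple.
\<close>

lemma Omega_op_eq:
  assumes "A \<in> factors d" "B \<in> factors d" "A \<noteq> B"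
  shows "Omega_op M N d A B = induced (alg.Om (position A) (position B))"
  unfolding Omega_op_def
proof (rule induced_lin_ext)
  fix ps w assume h: "homog_tuple M N d ps w"
  let ?p = "position A" and ?q = "position B"
  have pq: "?p < d + 2" "?q < d + 2" "?p \<noteq> ?q"
    using assms position_bij by (auto simp: bij_betw_def inj_on_def)
  have w: "w \<in> tup" using homog_tuple_tup h by blast
  note tt = tuple_map_tuples[OF _ w] 
  have 1: "signed_op M N d ((replicate (d + 2) 0)[?p := 0, ?q := 1]) (act_at M N A (e_unit i j) \<circ> act_at M N B (f_unit j i)) ps w
     = cls (ap (E ?p i j * F ?q j i) (P w))" for i j
  proof -
    let ?w' = "act_at M N B (f_unit j i) w"
    have w': "?w' \<in> tup" by (rule act_at_tup[OF assms(2) w units_qn(2)])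
    have "ap (E ?p i j * F ?q j i) (P w) = scl (psign (\<Sum>j<?q. 1 * ps ! j)) (P (act_at M N A (e_unit i j) ?w'))"
      unfolding times_linop.rep_eq F_def E_def slot_act_def ap_slot[OF h pq(2) loc_linear_loc_act[OF units_qn(2)]] ap_lin(2)
        act_at_eq[OF assms(2) w, symmetric] ap_even_slot[OF w' loc_linear_loc_act[OF units_qn(1)]] act_at_eq[OF assms(1) w', symmetric] ..
    then show ?thesis
      using signed_op_eq[OF h pq(2), of "act_at M N A (e_unit i j) \<circ> act_at M N B (f_unit j i)" 1]
        act_at_tup[OF assms(1) w' units_qn(1)]
      by (simp only: replicate_update_same o_apply)
  qed
  have 2: "signed_op M N d ((replicate (d + 2) 0)[?p := 1, ?q := 0]) (act_at M N A (f_unit i j) \<circ> act_at M N B (e_unit j i)) ps w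
     = cls (ap (F ?p i j * E ?q j i) (P w))" for i j
  proof -
    let ?w' = "act_at M N A (f_unit i j) w"
    have w': "?w' \<in> tup" by (rule act_at_tup[OF assms(1) w units_qn(2)])
    have w'': "act_at M N B (e_unit j i) w \<in> tup" by (rule act_at_tup[OF assms(2) w units_qn(1)])
    have "F ?p i j * E ?q j i = E ?q j i * F ?p i j"
      using alg.far_EF[of ?q ?p j i i j] pq by (simp add: comm_def)
    then have "ap (F ?p i j * E ?q j i) (P w) = ap (E ?q j i * F ?p i j) (P w)" by simp
    also have "\<dots> = scl (psign (\<Sum>j<?p. 1 * ps ! j)) (P (act_at M N B (e_unit j i) ?w'))"
      unfolding times_linop.rep_eq F_def E_def slot_act_def ap_slot[OF h pq(1) loc_linear_loc_act[OF units_qn(2)]] ap_lin(2)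
        act_at_eq[OF assms(1) w, symmetric] ap_even_slot[OF w' loc_linear_loc_act[OF units_qn(1)]] act_at_eq[OF assms(2) w', symmetric] ..
    also have "act_at M N B (e_unit j i) ?w' = act_at M N A (f_unit i j) (act_at M N B (e_unit j i) w)"
      unfolding act_at_eq[OF assms(1) w] act_at_eq[OF assms(2) w] act_at_eq[OF assms(2) w', unfolded act_at_eq[OF assms(1) w]]
        act_at_eq[OF assms(1) w'', unfolded act_at_eq[OF assms(2) w]] using pq(3) by (intro tuple_map_commute) simp
    finally have "ap (F ?p i j * E ?q j i) (P w)
        = scl (psign (\<Sum>j<?p. 1 * ps ! j)) (P (act_at M N A (f_unit i j) (act_at M N B (e_unit j i) w)))" .
    moreover have "(replicate (d + 2) 0)[?p := 1, ?q := 0] = (replicate (d + 2) (0::bit))[?p := 1]"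
      unfolding list_update_swap[OF pq(3)] replicate_update_same ..
    ultimately show ?thesis
      using signed_op_eq[OF h pq(1), of "act_at M N A (f_unit i j) \<circ> act_at M N B (e_unit j i)" 1]
        act_at_tup[OF assms(1) w'' units_qn(2)]
      by (simp only: o_apply)
  qed
  have c: "E p i j * F q k l \<in> corner" "F p i j * E q k l \<in> corner" for p q i j k l
    by (auto simp: E_def F_def)
  note cs = pm.subspace_sum[OF sub_A]
  have "cls (\<Sum>i\<in>UNIV. \<Sum>j\<in>UNIV. ap (E ?p i j * F ?q j i) (P w)) \<ominus>\<^bsub>Q\<^esub>
     cls (\<Sum>i\<in>UNIV. \<Sum>j\<in>UNIV. ap (F ?p i j * E ?q j i) (P w)) = cls (ap (alg.Om ?p ?q) (P w))"
    using c ap_corner(1) by (subst minus_Q) (auto intro!: cs simp: alg.Om_def sum_subtractf simp del: times_linop.rep_eq)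
  then show "(\<Oplus>\<^bsub>TS\<^esub>i\<in>UNIV. \<Oplus>\<^bsub>TS\<^esub>j\<in>UNIV.
        signed_op M N d ((replicate (d + 2) 0)[?p := 0, ?q := 1]) (act_at M N A (e_unit i j) \<circ> act_at M N B (f_unit j i)) ps w)
     \<ominus>\<^bsub>TS\<^esub> (\<Oplus>\<^bsub>TS\<^esub>i\<in>UNIV. \<Oplus>\<^bsub>TS\<^esub>j\<in>UNIV.
        signed_op M N d ((replicate (d + 2) 0)[?p := 1, ?q := 0]) (act_at M N A (f_unit i j) \<circ> act_at M N B (e_unit j i)) ps w)
     = cls (ap (alg.Om ?p ?q) (P w))"
    unfolding 1 2 finsum_TS minus_TS finsum_Q2[OF ap_corner(1)[OF c(1)]] finsum_Q2[OF ap_corner(1)[OF c(2)]] .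
qed simp

lemma U_corner [simp, intro]: "U p a b \<in> corner" by (simp add: U_def)

lemma C_corner [simp, intro]: "alg.C p \<in> corner" by (auto simp: alg.C_def)

lemma Sw_corner [simp, intro]: "alg.Sw p q \<in> corner" by (auto simp: alg.Sw_def)

lemma C_eq_slot: assumes "2 \<le> p" "p < d + 2" shows "alg.C p = slot 1 p (loc_matrix Cmat)"
proof -
  have diff: "slot 1 p (loc_matrix (X - X')) = slot 1 p (loc_matrix X) - slot 1 p (loc_matrix X')" for X X'
    using slot_loc_matrix_add[OF assms, of 1 "X - X'" X'] by simp
  have Cm: "(Cmat :: 'k mat2) = (\<Sum>i\<in>UNIV. matrix_unit (Inr i) (Inl i) - matrix_unit (Inl i) (Inr i))"
  proof -
    have "(\<Sum>i\<in>UNIV. matrix_unit (Inr i) (Inl i) $ Inr a $ Inl b - matrix_unit (Inl i) (Inr i) $ Inr a $ Inl b)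
        = (\<Sum>i\<in>UNIV. if i = a then (mat 1 $ a $ b :: complex) else 0)"
      "(\<Sum>i\<in>UNIV. matrix_unit (Inr i) (Inl i) $ Inl a $ Inr b - matrix_unit (Inl i) (Inr i) $ Inl a $ Inr b)
        = (\<Sum>i\<in>UNIV. if i = a then - (mat 1 $ a $ b :: complex) else 0)" for a b :: 'k
      by (intro sum.cong; auto simp: matrix_unit_def mat_def)+
    then show ?thesis
      by (simp add: vec_eq_iff forall_sum_type Cmat_def block_def) (simp add: matrix_unit_def)
  qed
  show ?thesis unfolding Cm slot_loc_matrix_sum[OF assms] diff alg.C_def U_def by simp
qed

lemma C_op_eq: assumes "i \<in> {1..d}" shows "C_op M N d i = induced (alg.C (i + 1))"
  unfolding C_op_def
proof (rule induced_lin_ext)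
  fix ps w assume h: "homog_tuple M N d ps w"
  obtain k where k: "i = Suc k" "k < d" using assms by (cases i) auto
  obtain m n vs where w: "w = (m, n, vs)" by (cases w)
  have t: "(m, n, vs) \<in> tup" using homog_tuple_tup h w by auto
  have "(case w of (m, n, vs) \<Rightarrow> (m, n, vs[i - 1 := Cmat *v (vs ! (i - 1))]))
      = tuple_map ((\<lambda>_. loc_id)(i + 1 := loc_matrix Cmat)) w"
    using tuple_map_single(3)[OF t k(2)] by (simp add: w k loc_matrix_def)
  then show "signed_op M N d ((replicate (d + 2) 0)[position (FactorV i) := 1])
        (\<lambda>(m, n, vs). (m, n, vs[i - 1 := Cmat *v (vs ! (i - 1))])) ps w = cls (ap (alg.C (i + 1)) (P w))"
    using signed_slot[OF h, of "i + 1" "loc_matrix Cmat" _ 1] k by (simp add: C_eq_slot)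
qed simp

lemma P_V_sum:
  assumes "(m, n, vs) \<in> tup" "k < d" "finite S"
  shows "P (m, n, vs[k := (\<Sum>a\<in>S. c a *s e a)]) = (\<Sum>a\<in>S. scl (c a) (P (m, n, vs[k := e a])))"
  using assms(3)
proof (induction S rule: finite_induct)
  case empty
  then show ?case using P_V_smult[OF assms(1,2), of 0 0] by simp
next
  case (insert a S)
  then show ?case by (simp add: P_V_add[OF assms(1,2)] P_V_smult[OF assms(1,2)])
qed

text \<open>
  In $E_{ab} \otimes E_{ba}$ the involutions before the left position cancel, and
  $\sigma^{\bar a + \bar b}$ remains at the left position itself.  The coefficients $v_b$ and $v'_a$ vanish unless $b$ and $a$ have the
  parities of $v$ and $v'$; the total sign is then $(-1)^{\bar v \, \bar v'}$.
\<close>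

lemma U_U_apply:
  assumes t: "(m, n, vs) \<in> tup" and k: "Suc k < d" and h: "vs ! k \<in> homog natural_module r" "vs ! Suc k \<in> homog natural_module r'"
  shows "ap (ksign (index_parity b) * (U (Suc (Suc k)) a b * U (Suc (Suc (Suc k))) b a)) (P (m, n, vs))
    = scl (psign (r * r')) (scl (vs ! Suc k $ a) (scl (vs ! k $ b) (P (m, n, vs[k := axis a 1, Suc k := axis b 1]))))"
proof -
  let ?p = "Suc (Suc k)" and ?q = "Suc (Suc (Suc k))"
  let ?s = "index_parity a + index_parity b"
  let ?l = "((\<lambda>_. loc_id)(?p := loc_comp (loc_matrix (matrix_unit a b)) (loc_sigma_pow ?s)))(?q := loc_matrix (matrix_unit b a))"
  have "U ?p a b * U ?q b a = slot ?s ?p (loc_matrix (matrix_unit a b)) * slot ?s ?q (loc_matrix (matrix_unit b a))"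
    by (simp add: U_def add.commute)
  also have "\<dots> = G ?l"
    unfolding slot_def
    by (subst G_mult) (auto intro!: G_cong loc_eq_trans[OF loc_sigma_pow_add])
  finally have "ap (U ?p a b * U ?q b a) (P (m, n, vs)) = P (tuple_map ?l (m, n, vs))"
    using t by (simp add: ap_G)
  also have "tuple_map ?l (m, n, vs) = (m, n, vs[k := matrix_unit a b *v (snd (snd (loc_sigma_pow ?s)) *v (vs ! k)), Suc k := matrix_unit b a *v (vs ! Suc k)])"
    using k tuple_map_id[OF t] t by (simp add: tuple_map_upd tuples_def) (simp add: loc_id_def loc_matrix_def loc_comp_def matrix_vector_mul_assoc)
  also have "snd (snd (loc_sigma_pow ?s)) *v (vs ! k) = psign (?s * r) *s (vs ! k)"
    by (cases ?s) (simp_all add: loc_id_def loc_sigma_def parity_matrix_vector[OF h(1)])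
  also have "matrix_unit a b *v (psign (?s * r) *s (vs ! k)) = (psign (?s * r) * vs ! k $ b) *s axis a 1"
    by (simp add: matrix_unit_vector)
  also have "P (m, n, vs[k := (psign (?s * r) * vs ! k $ b) *s axis a 1, Suc k := matrix_unit b a *v (vs ! Suc k)])
     = scl (vs ! Suc k $ a) (scl (psign (?s * r) * vs ! k $ b) (P (m, n, vs[k := axis a 1, Suc k := axis b 1])))"
  proof -
    have t': "(m, n, vs[k := x]) \<in> tup" "(m, n, vs[Suc k := x]) \<in> tup" for x using t by (auto simp: tuples_def)
    show ?thesis
      unfolding matrix_unit_vector P_V_smult[OF t'(1) k]
      using k by (simp add: list_update_swap[of k "Suc k"] P_V_smult[OF t'(2)])
  qed
  finally have eq: "ap (U ?p a b * U ?q b a) (P (m, n, vs)) = \<dots>" .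
  have sc: "scal (psign (index_parity b)) = (ksign (index_parity b) :: ('m, 'n, 'k) tensor_tuple linop)"
      by (rule scal_psign)
  have "ap (ksign (index_parity b) * (U ?p a b * U ?q b a)) (P (m, n, vs))
     = scl (psign (index_parity b)) (ap (U ?p a b * U ?q b a) (P (m, n, vs)))"
    unfolding sc[symmetric] by simp
  also have "\<dots> = scl (psign (index_parity b) * (vs ! Suc k $ a * (psign (?s * r) * vs ! k $ b))) (P (m, n, vs[k := axis a 1, Suc k := axis b 1]))"
    unfolding eq by (simp only: pm.scale_scale)
  also have "psign (index_parity b) * (vs ! Suc k $ a * (psign (?s * r) * vs ! k $ b))
      = psign (r * r') * (vs ! Suc k $ a * vs ! k $ b)"
  proof (cases "vs ! Suc k $ a = 0 \<or> vs ! k $ b = 0")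
    case False
    then have ab: "index_parity a = r'" "index_parity b = r" using h by (auto simp: natural_homog)
    \<comment> \<open>The sign of the swap tensor, times the sign from $\sigma$ at the left position.\<close>
    have "psign r * psign ((r' + r) * r) = psign (r * r')" by (cases r; cases r') simp_all
    then show ?thesis by (simp add: ab mult.left_commute mult.assoc[symmetric])
  qed auto
  finally show ?thesis by (simp only: pm.scale_scale)
qed

text \<open>
  Summing the previous formula over \<open>a\<close> and \<open>b\<close> reassembles the two vectors from their coordinates, in
  exchanged places.
\<close>

lemma swap_op_eq: assumes "i \<in> {1..<d}" shows "swap_op M N d i = induced (alg.Sw (i + 1) (i + 2))"
  unfolding swap_op_def
proof (rule induced_lin_ext)
  fix ps w assume h: "homog_tuple M N d ps w"
  obtain k where k: "i = Suc k" "Suc k < d" using assms by (cases i) auto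
  obtain m n vs where w: "w = (m, n, vs)" by (cases w)
  have t: "(m, n, vs) \<in> tup" using homog_tuple_tup h w by auto
  then have t': "(m, n, vs[k := x]) \<in> tup" "(m, n, vs[Suc k := x]) \<in> tup" for x by (auto simp: tuples_def)
  obtain p' q' rs where ps: "ps = p' # q' # rs" "length vs
      = d" "list_all2 (\<lambda>v r. v \<in> homog natural_module r) vs rs"
    using h w by (auto simp: homog_tuple.simps)
  have v: "vs ! k \<in> homog natural_module (rs ! k)" "vs ! Suc k \<in> homog natural_module (rs ! Suc k)"
    using ps k by (auto simp: list_all2_conv_all_nth)
  let ?P = "\<lambda>a b. P (m, n, vs[k := axis a 1, Suc k := axis b 1])"
  have e: "(\<Sum>a\<in>UNIV. x $ a *s axis a 1) = x" for x :: "'k vec2"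
    by (simp add: vec_eq_iff axis_def if_distrib cong: if_cong)
  have inner: "(\<Sum>b\<in>UNIV. scl (vs ! k $ b) (?P a b)) = P (m, n, vs[Suc k := vs ! k, k := axis a 1])" for a
    using P_V_sum[of m n "vs[k := axis a 1]" "Suc k" UNIV "\<lambda>b. vs ! k $ b" "\<lambda>b. axis b 1"] t'(1) k(2)
    by (simp add: e list_update_swap[of "Suc k" k])
  have "ap (alg.Sw (i + 1) (i + 2)) (P w)
      = (\<Sum>a\<in>UNIV. \<Sum>b\<in>UNIV. scl (psign (rs ! k * rs ! Suc k)) (scl (vs ! Suc k $ a) (scl (vs ! k $ b) (?P a b))))"
    unfolding alg.Sw_def ap_sum w k using U_U_apply[OF t k(2) v] by simp
  also have "\<dots> = scl (psign (rs ! k * rs ! Suc k)) (\<Sum>a\<in>UNIV. scl (vs ! Suc k $ a) (\<Sum>b\<in>UNIV. scl (vs ! k $ b) (?P a b)))"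
    by (simp only: pm.scale_sum_right)
  also have "\<dots> = scl (psign (rs ! k * rs ! Suc k)) (\<Sum>a\<in>UNIV. scl (vs ! Suc k $ a) (P (m, n, vs[Suc k := vs ! k, k := axis a 1])))"
    by (simp only: inner)
  also have "(\<Sum>a\<in>UNIV. scl (vs ! Suc k $ a) (P (m, n, vs[Suc k := vs ! k, k := axis a 1])))
     = P (m, n, vs[Suc k := vs ! k, k := vs ! Suc k])"
    using P_V_sum[of m n "vs[Suc k := vs ! k]" k UNIV "\<lambda>a. vs ! Suc k $ a" "\<lambda>a. axis a 1"] t'(2) k by (simp add: e)
  finally have "ap (alg.Sw (i + 1) (i + 2)) (P w)
      = scl (psign (rs ! k * rs ! Suc k)) (P (m, n, vs[k := vs ! Suc k, Suc k := vs ! k]))"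
    by (simp add: list_update_swap[of "Suc k" k])
  moreover have "(m, n, vs[k := vs ! Suc k, Suc k := vs ! k]) \<in> tup" using t by (auto simp: tuples_def)
  ultimately show "(\<lambda>(m, n, vs). psign (ps ! position (FactorV i) * ps ! position (FactorV (i + 1)))
       \<odot>\<^bsub>TS\<^esub> pure M N d (m, n, vs[i - 1 := vs ! i, i := vs ! (i - 1)])) w
           = cls (ap (alg.Sw (i + 1) (i + 2)) (P w))"
    by (simp add: w k ps TS_simps pure_eq smult_Q)
qed simp

end

context tensor begin

section \<open>Parity and equivariance of operators\<close>

text \<open>
  The properties of the image of a homogeneous element of $\mathcal H_d$: it has parity \<open>t\<close> and supercommutes
  with $\mathfrak q(n)$.  Both are commutation rules, hence stable under products.
\<close>

definition equivariant :: "bit \<Rightarrow> ('m, 'n, 'k) tensor_tuple linop \<Rightarrow> bool" where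
  "equivariant t z \<longleftrightarrow> z \<in> corner \<and> z * Pi_op = ksign t * (Pi_op * z) \<and>
     (\<forall>s. \<forall>x\<in>qn_homog s. z * total_act s x = ksign (t * s) * (total_act s x * z))"

lemma Pi_corner [simp, intro]: "Pi_op \<in> corner" by (simp add: Pi_op_def)

lemma equivariant_u: "equivariant 0 u"
  by (simp add: equivariant_def corner_u)

lemma equivariant_0: "equivariant t 0" by (simp add: equivariant_def)

lemma equivariant_add: "equivariant t z \<Longrightarrow> equivariant t w \<Longrightarrow> equivariant t (z + w)"
  by (simp add: equivariant_def ring_distribs)

lemma equivariant_scal: "equivariant t z \<Longrightarrow> equivariant t (scal c * z)"
  unfolding equivariant_def
  by (auto simp: mult.assoc ksign_left_commute[of "scal c"]) (simp_all add: mult.assoc[symmetric] scal_commute)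

lemma supercommute_mult:
  assumes "z * D = ksign a * (D * z)" "w * D = ksign b * (D * (w :: 'r::ring_1))"
  shows "(z * w) * D = ksign (a + b) * (D * (z * w))"
proof -
  have "(z * w) * D = ksign b * ((z * D) * w)"
    using assms(2) by (simp add: mult.assoc ksign_left_commute[of z])
  also have "\<dots> = ksign (a + b) * (D * (z * w))"
    unfolding assms(1) by (simp add: ksign_add mult.assoc ksign_left_commute[of "ksign b"])
  finally show ?thesis .
qed

lemma equivariant_mult: "equivariant t z \<Longrightarrow> equivariant s w \<Longrightarrow> equivariant (t + s) (z * w)"
  unfolding equivariant_def distrib_right by (intro conjI allI ballI supercommute_mult) simp_all

lemma equivariant_sum: "(\<And>i. i \<in> A \<Longrightarrow> equivariant t (f i)) \<Longrightarrow> equivariant t (sum f A)"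
  by (induction A rule: infinite_finite_induct) (auto simp: equivariant_0 equivariant_add)

lemma total_act_expand:
  "x \<in> qn_homog 0 \<Longrightarrow> total_act 0 x = (\<Sum>i\<in>UNIV. \<Sum>j\<in>UNIV. scal (x $ Inl i $ Inl j) * (\<Sum>p<d + 2. E p i j))"
  "x \<in> qn_homog 1 \<Longrightarrow> total_act 1 x = (\<Sum>i\<in>UNIV. \<Sum>j\<in>UNIV. scal (x $ Inl i $ Inr j) * (\<Sum>p<d + 2. F p i j))"
proof -
  \<comment> \<open>The linear expansion is applied at each position; the sum over positions is then moved inside.\<close>
  have swap: "(\<Sum>p<d + 2. \<Sum>i\<in>UNIV. \<Sum>j\<in>UNIV. f p i j) = (\<Sum>i\<in>UNIV. \<Sum>j\<in>UNIV. \<Sum>p<d + 2. f p i j)"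
    for f :: "nat \<Rightarrow> 'k \<Rightarrow> 'k \<Rightarrow> ('m, 'n, 'k) tensor_tuple linop"
    by (subst sum.swap) (intro sum.cong refl sum.swap)
  have E: "slot_act 0 p x = (\<Sum>i\<in>UNIV. \<Sum>j\<in>UNIV. scal (x $ Inl i $ Inl j) * E p i j)"
      if "x \<in> qn_homog 0" "p < d + 2" for p
  proof -
    have "slot_act 0 p x = slot_act 0 p (\<Sum>i\<in>UNIV. \<Sum>j\<in>UNIV. (\<chi> a b. x $ Inl i $ Inl j * e_unit i j $ a $ b))"
      using qn_homog_expand(1)[OF that(1)] by (rule arg_cong)
    then show ?thesis using that(2) by (simp only: slot_act_sum slot_act_scal qn_sum qn_closed units_qn E_def)
  qed
  have F: "slot_act 1 p x = (\<Sum>i\<in>UNIV. \<Sum>j\<in>UNIV. scal (x $ Inl i $ Inr j) * F p i j)"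
      if "x \<in> qn_homog 1" "p < d + 2" for p
  proof -
    have "slot_act 1 p x = slot_act 1 p (\<Sum>i\<in>UNIV. \<Sum>j\<in>UNIV. (\<chi> a b. x $ Inl i $ Inr j * f_unit i j $ a $ b))"
      using qn_homog_expand(2)[OF that(1)] by (rule arg_cong)
    then show ?thesis using that(2) by (simp only: slot_act_sum slot_act_scal qn_sum qn_closed units_qn F_def)
  qed
  show "x \<in> qn_homog 0 \<Longrightarrow> total_act 0 x = (\<Sum>i\<in>UNIV. \<Sum>j\<in>UNIV. scal (x $ Inl i $ Inl j) * (\<Sum>p<d + 2. E p i j))"
    unfolding total_act_def sum_distrib_left swap[symmetric] by (intro sum.cong refl) (simp add: E)
  show "x \<in> qn_homog 1 \<Longrightarrow> total_act 1 x = (\<Sum>i\<in>UNIV. \<Sum>j\<in>UNIV. scal (x $ Inl i $ Inr j) * (\<Sum>p<d + 2. F p i j))"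
    unfolding total_act_def sum_distrib_left swap[symmetric] by (intro sum.cong refl) (simp add: F)
qed

text \<open>
  The action of $\mathfrak q(n)$ is a linear combination of the diagonal operators of $e_{kl}$ and
  $f_{kl}$.
\<close>

lemma equivariantI:
  assumes z: "z \<in> corner" "z * Pi_op = ksign t * (Pi_op * z)"
    and E: "\<And>k l. z * (\<Sum>p<d + 2. E p k l) = (\<Sum>p<d + 2. E p k l) * z"
    and F: "\<And>k l. z * (\<Sum>p<d + 2. F p k l) = ksign t * ((\<Sum>p<d + 2. F p k l) * z)"
  shows "equivariant t z"
proof -
  have sc: "z * (scal c * e) = ksign s * (scal c * e * z)" if "z * e = ksign s * (e * z)" for c e s
  proof -
    have "z * (scal c * e) = scal c * (z * e)" by (simp add: mult.assoc[symmetric] scal_commute)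
    then show ?thesis unfolding that by (simp add: mult.assoc ksign_left_commute[of "scal c"])
  qed
  have "z * total_act s x = ksign (t * s) * (total_act s x * z)" if "x \<in> qn_homog s" for s x
  proof (cases "s = 0")
    case True
    have "z * (scal c * (\<Sum>p<d + 2. E p k l)) = scal c * (\<Sum>p<d + 2. E p k l) * z" for c k l
      using sc[of "\<Sum>p<d + 2. E p k l" 0 c] E[of k l] by simp
    then show ?thesis using True that by (simp add: total_act_expand sum_distrib_left[of z] sum_distrib_right[of _ _ z])
  next
    case False
    then have s: "s = 1" by simp
    have "z * (scal c * (\<Sum>p<d + 2. F p k l)) = ksign t * (scal c * (\<Sum>p<d + 2. F p k l) * z)" for c k l
      using sc[of "\<Sum>p<d + 2. F p k l" t c] F[of k l] by simp
    then show ?thesis using s that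
      by (simp add: total_act_expand sum_distrib_left[of z] sum_distrib_right[of _ _ z] sum_distrib_left[of "ksign t"])
  qed
  then show ?thesis using z by (simp add: equivariant_def)
qed

lemma supercommute_sum:
  assumes "\<And>i. i \<in> A \<Longrightarrow> f i * D = ksign t * (D * (f i :: 'r::ring_1))"
  shows "sum f A * D = ksign t * (D * sum f A)"
  unfolding sum_distrib_right sum_distrib_left using assms by (intro sum.cong refl)

lemma Pi_E_F: "p < d + 2 \<Longrightarrow> E p i j * Pi_op = ksign 0 * (Pi_op * E p i j)" "p < d + 2 \<Longrightarrow> F p i j * Pi_op
    = ksign 1 * (Pi_op * F p i j)"
  unfolding E_def F_def slot_act_def
  by (rule slot_Pi[OF _ loc_parity_loc_act[OF unit_homog(1)]] slot_Pi[OF _ loc_parity_loc_act[OF unit_homog(2)]], assumption)+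

lemma Pi_U: "2 \<le> p \<Longrightarrow> p < d + 2 \<Longrightarrow> U p a b * Pi_op = ksign (index_parity a + index_parity b) * (Pi_op * U p a b)"
  unfolding U_def by (rule slot_Pi[OF _ loc_parity_loc_matrix[OF _ mat_parity_matrix_unit]])

lemma equivariant_Sw:
  assumes "p \<in> {2..<d + 2}" "q \<in> {2..<d + 2}" "p \<noteq> q" shows "equivariant 0 (alg.Sw p q)"
proof (rule equivariantI)
  have "U p a b * U q b a * Pi_op = ksign (index_parity a + index_parity b + (index_parity b + index_parity a)) * (Pi_op * (U p a b * U q b a))" for a b
    using assms by (intro supercommute_mult Pi_U) auto
  then have "ksign (index_parity b) * (U p a b * U q b a) * Pi_op
      = ksign 0 * (Pi_op * (ksign (index_parity b) * (U p a b * U q b a)))" for a b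
    by (simp add: mult.assoc ksign_left_commute[of Pi_op] add.commute)
  then show "alg.Sw p q * Pi_op = ksign 0 * (Pi_op * alg.Sw p q)"
    unfolding alg.Sw_def by (intro supercommute_sum)
  show "alg.Sw p q * (\<Sum>p<d + 2. E p k l) = (\<Sum>p<d + 2. E p k l) * alg.Sw p q" for k l
    using alg.Sw_sum(1)[of "{..<d + 2}" p q k l] assms by (simp add: comm_zero_iff)
  show "alg.Sw p q * (\<Sum>p<d + 2. F p k l) = ksign 0 * ((\<Sum>p<d + 2. F p k l) * alg.Sw p q)" for k l
    using alg.Sw_sum(2)[of "{..<d + 2}" p q k l] assms by (simp add: comm_zero_iff)
qed simp

lemma equivariant_C:
  assumes "p \<in> {2..<d + 2}" shows "equivariant 1 (alg.C p)"
proof (rule equivariantI)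
  have "(U p (Inr i) (Inl i) - U p (Inl i) (Inr i)) * Pi_op
      = ksign 1 * (Pi_op * (U p (Inr i) (Inl i) - U p (Inl i) (Inr i)))" for i
    using assms by (simp add: left_diff_distrib right_diff_distrib Pi_U)
  then show "alg.C p * Pi_op = ksign 1 * (Pi_op * alg.C p)"
    unfolding alg.C_def by (intro supercommute_sum)
  show "alg.C p * (\<Sum>p<d + 2. E p k l) = (\<Sum>p<d + 2. E p k l) * alg.C p" for k l
    using alg.C_sum(1)[of "{..<d + 2}" p k l] assms by (simp add: comm_zero_iff)
  show "alg.C p * (\<Sum>p<d + 2. F p k l) = ksign 1 * ((\<Sum>p<d + 2. F p k l) * alg.C p)" for k l
    using alg.C_sum(2)[of "{..<d + 2}" p k l] assms by (simp add: anti_zero_iff)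
qed simp

lemma equivariant_Om:
  assumes "p < d + 2" "q < d + 2" "p \<noteq> q" shows "equivariant 1 (alg.Om p q)"
proof (rule equivariantI)
  have "E p i j * F q j i * Pi_op = ksign (0 + 1) * (Pi_op * (E p i j * F q j i))"
    "F p i j * E q j i * Pi_op = ksign (1 + 0) * (Pi_op * (F p i j * E q j i))" for i j
    using assms by (intro supercommute_mult Pi_E_F; simp)+
  then have "(E p i j * F q j i - F p i j * E q j i) * Pi_op
      = ksign 1 * (Pi_op * (E p i j * F q j i - F p i j * E q j i))" for i j
    by (simp add: left_diff_distrib right_diff_distrib)
  then show "alg.Om p q * Pi_op = ksign 1 * (Pi_op * alg.Om p q)"
    unfolding alg.Om_def by (intro supercommute_sum)
  show "alg.Om p q * (\<Sum>p<d + 2. E p k l) = (\<Sum>p<d + 2. E p k l) * alg.Om p q" for k l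
    using alg.Om_sum_E[of "{..<d + 2}" p q k l] assms by (simp add: comm_zero_iff)
  show "alg.Om p q * (\<Sum>p<d + 2. F p k l) = ksign 1 * ((\<Sum>p<d + 2. F p k l) * alg.Om p q)" for k l
    using alg.Om_sum_F[of "{..<d + 2}" p q k l] assms by (simp add: anti_zero_iff)
qed simp

section \<open>The relations between the operators\<close>

text \<open>
  The summands with $r = 0, 1$ are the tensors $\Omega_{M,j}$ and $\Omega_{N,j}$, the other ones
  $\Omega_{k,j}$ with $k = r - 1$.
  With $j = 0$ this is $\Omega_{M,N}$, so $\tilde z_0$ needs no separate treatment.
\<close>

definition Z :: "nat \<Rightarrow> ('m, 'n, 'k) tensor_tuple linop" where
  "Z j = (\<Sum>r<j + 1. alg.Om r (j + 1))"

lemma Z_corner [simp, intro]: "Z j \<in> corner" by (auto simp: Z_def)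

fun gen :: "hgen \<Rightarrow> ('m, 'n, 'k) tensor_tuple linop" where
  "gen (GenS i) = alg.Sw (i + 1) (i + 2)"
| "gen (GenC i) = alg.C (i + 1)"
| "gen GenX = alg.Om 0 2"
| "gen (GenZ j) = Z j"

lemma gen_corner [simp, intro]: "gen g \<in> corner" by (cases g) auto

lemma equivariant_Z: "j \<le> d \<Longrightarrow> equivariant 1 (Z j)"
  unfolding Z_def by (intro equivariant_sum equivariant_Om) auto

lemma equivariant_gen: assumes "g \<in> hgens d" shows "equivariant (hgen_parity g) (gen g)"
proof (cases g)
  case (GenZ j)
  then have "j \<le> d" using assms by (auto simp: hgens_def split: if_splits)
  then show ?thesis using equivariant_Z GenZ by simp
qed (use assms in \<open>auto simp: hgens_def intro!: equivariant_Sw equivariant_C equivariant_Om split: if_splits\<close>)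

text \<open>
  Conjugation by the swap turns $\Omega_{r,i+1}$ into $\Omega_{r,i+2}$; the summand of $\tilde z_{i+1}$ that does not
  arise in this way is $\Omega_{i+1,i+2} = (c_{i+2} - c_{i+1}) s$, in the numbering by positions.
\<close>

lemma Sw_Z:
  assumes i: "i \<in> {1..<d}"
  shows "alg.Sw (i + 1) (i + 2) * Z i = Z (i + 1) * alg.Sw (i + 1) (i + 2) + alg.C (i + 1) - alg.C (i + 2)"
proof -
  let ?S = "alg.Sw (i + 1) (i + 2)"
  have "?S * Z i = (\<Sum>r<i + 1. alg.Om r (i + 2) * ?S)"
    unfolding Z_def sum_distrib_left
  proof (rule sum.cong[OF refl])
    fix r assume "r \<in> {..<i + 1}"
    then show "?S * alg.Om r (i + 1) = alg.Om r (i + 2) * ?S"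
      using i alg.Sw_mult_Om[of "i + 1" "i + 2" r "i + 1"] by (auto simp: Transposition.transpose_def)
  qed
  also have "\<dots> = Z (i + 1) * ?S - alg.Om (i + 1) (i + 2) * ?S"
    by (simp add: Z_def sum_distrib_right distrib_right)
  also have "alg.Om (i + 1) (i + 2) * ?S = (alg.C (i + 2) - alg.C (i + 1)) * (?S * ?S)"
    using i by (subst alg.Om_eq_C_Sw) (auto simp: mult.assoc)
  also have "\<dots> = alg.C (i + 2) - alg.C (i + 1)"
    using i by (subst alg.Sw_square) (auto simp: corner_u)
  finally show ?thesis by simp
qed

lemma Sw_Z_far:
  assumes i: "i \<in> {1..<d}" "j \<in> {0..d}" "j \<noteq> i" "j \<noteq> i + 1"
  shows "alg.Sw (i + 1) (i + 2) * Z j = Z j * alg.Sw (i + 1) (i + 2)"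
proof -
  let ?S = "alg.Sw (i + 1) (i + 2)" and ?t = "tr (i + 1) (i + 2)"
  have t: "?t (j + 1) = j + 1" using i by (simp add: Transposition.transpose_def)
  have bij: "bij_betw ?t {..<j + 1} {..<j + 1}"
    by (rule bij_betwI[of _ _ _ ?t]) (use i in \<open>auto simp: Transposition.transpose_def\<close>)
  have "?S * Z j = (\<Sum>r<j + 1. alg.Om (?t r) (?t (j + 1)) * ?S)"
    unfolding Z_def sum_distrib_left using i by (intro sum.cong refl alg.Sw_mult_Om) auto
  also have "\<dots> = (\<Sum>r<j + 1. alg.Om (?t r) (j + 1)) * ?S"
    unfolding t sum_distrib_right ..
  also have "(\<Sum>r<j + 1. alg.Om (?t r) (j + 1)) = Z j"
    unfolding Z_def by (rule sum.reindex_bij_betw[OF bij])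
  finally show ?thesis .
qed

lemma anti_Om_Z:
  assumes "p < j + 1" "q < j + 1" "p \<noteq> q" "j \<le> d"
  shows "anti (alg.Om p q) (Z j) = 0"
  unfolding Z_def using assms by (intro alg.anti_Om_Jucys_Murphy) auto

lemma anti_Om_two:
  assumes "distinct [p, q, m]" "p < d + 2" "q < d + 2" "m < d + 2"
  shows "anti (alg.Om p q) (alg.Om p m + alg.Om q m) = 0"
  using alg.anti_Om_Jucys_Murphy[of "{p, q}" p q m] assms by simp

lemma anti_C_Z: "i \<in> {1..d} \<Longrightarrow> j \<le> d \<Longrightarrow> anti (alg.C (i + 1)) (Z j) = 0"
  unfolding Z_def anti_sum by (intro sum.neutral ballI alg.anti_C_Om) auto

text \<open>
  The element that has to anticommute with $\tilde x_1$ is the sum $\Omega_{M,2} + \Omega_{1,2}$ over the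
  factors on which $\tilde x_1$ acts.
\<close>

lemma conjugate_x_eq:
  assumes "d \<ge> 2"
  shows "alg.Sw 2 3 * alg.Om 0 2 * alg.Sw 2 3 - (alg.C 2 - alg.C 3) * alg.Sw 2 3 = alg.Om 0 3 + alg.Om 2 3"
proof -
  have "alg.Sw 2 3 * alg.Om 0 2 = alg.Om 0 3 * alg.Sw 2 3"
    using alg.Sw_mult_Om[of 2 3 0 2] assms by (simp add: Transposition.transpose_def)
  then have "alg.Sw 2 3 * alg.Om 0 2 * alg.Sw 2 3 = alg.Om 0 3"
    using alg.Sw_square[of 2 3] assms by (simp add: mult.assoc corner_u)
  moreover have "alg.Om 2 3 = (alg.C 3 - alg.C 2) * alg.Sw 2 3"
    using alg.Om_eq_C_Sw[of 2 3] assms by simp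
  ultimately show ?thesis by (simp add: left_diff_distrib)
qed

lemma Z_small: "Z 0 = alg.Om 0 1" "Z 1 = alg.Om 0 2 + alg.Om 1 2"
  by (simp_all add: Z_def numeral_2_eq_2)

end

section \<open>Free superalgebras and the ideal of relations\<close>

lemma span_all_points: "(v :: 'a \<Rightarrow>\<^sub>0 complex) \<in> pm.span (point ` UNIV)"
  by (rule span_points) simp

lemma scl_point: "scl c (point w) = Poly_Mapping.single w c"
  by (simp add: scl_single)

lemma single0_mult: "Poly_Mapping.single 0 c * (x :: ('a::monoid_add) \<Rightarrow>\<^sub>0 complex) = scl c x"
  using span_all_points[of x]
proof (induction rule: pm.span_induct_alt)
  case (step e x y)
  then obtain w where w: "x = point w" by auto
  show ?case
    unfolding w scl_point distrib_left step(2) pm.scale_right_distrib mult_single scl_single by simp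
qed simp

lemma mult_single0: "(x :: ('a::monoid_add) \<Rightarrow>\<^sub>0 complex) * Poly_Mapping.single 0 c = scl c x"
  using span_all_points[of x]
proof (induction rule: pm.span_induct_alt)
  case (step e x y)
  then obtain w where w: "x = point w" by auto
  show ?case
    unfolding w scl_point distrib_right step(2) pm.scale_right_distrib mult_single scl_single
        by (simp add: mult.commute)
qed simp

lemma scl_mult: "scl c x * (y :: ('a::monoid_add) \<Rightarrow>\<^sub>0 complex) = scl c (x * y)" "x * scl c y = scl c (x * y)"
proof -
  show "scl c x * y = scl c (x * y)" by (simp only: single0_mult[symmetric] mult.assoc)
  have "x * scl c y = (x * Poly_Mapping.single 0 c) * y" by (simp only: single0_mult[symmetric] mult.assoc)
  then show "x * scl c y = scl c (x * y)" by (simp only: mult_single0 single0_mult[symmetric] mult.assoc)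
qed

context
  fixes G :: "'g set" and par :: "'g \<Rightarrow> bit"
begin

abbreviation "FA \<equiv> free_superalgebra G par"

lemma FA_simps: "carrier FA = {u. \<forall>w\<in>Poly_Mapping.keys u. set (letters w) \<subseteq> G}" "u \<otimes>\<^bsub>FA\<^esub> v = u * v"
  "\<one>\<^bsub>FA\<^esub> = 1" "\<zero>\<^bsub>FA\<^esub> = 0" "add FA = (+)" "smult FA = scl"
  "homog FA p = {u. \<forall>w\<in>Poly_Mapping.keys u. set (letters w) \<subseteq> G \<and> sum_list (map par (letters w)) = p}"
  by (simp_all add: free_superalgebra_def)

lemma FA_closed: "x \<in> carrier FA \<Longrightarrow> y \<in> carrier FA \<Longrightarrow> x + y \<in> carrier FA"
  "x \<in> carrier FA \<Longrightarrow> y \<in> carrier FA \<Longrightarrow> x - y \<in> carrier FA"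
  "x \<in> carrier FA \<Longrightarrow> - x \<in> carrier FA" "0 \<in> carrier FA" "1 \<in> carrier FA"
  "x \<in> carrier FA \<Longrightarrow> y \<in> carrier FA \<Longrightarrow> x * y \<in> carrier FA" "x \<in> carrier FA \<Longrightarrow> scl c x \<in> carrier FA"
  "Poly_Mapping.single 0 c \<in> carrier FA" "set gs \<subseteq> G \<Longrightarrow> point (Word gs) \<in> carrier FA"
proof -
  assume x: "x \<in> carrier FA"
  show "- x \<in> carrier FA" using x by (simp add: FA_simps)
  have "Poly_Mapping.keys (scl c x) \<subseteq> Poly_Mapping.keys x" by (auto simp: in_keys_iff)
  then show "scl c x \<in> carrier FA" using x by (auto simp: FA_simps)
  assume y: "y \<in> carrier FA"
  show "x + y \<in> carrier FA" using x y Poly_Mapping.keys_add[of x y] by (auto simp: FA_simps)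
  show "x - y \<in> carrier FA" using x y keys_diff[of x y] by (auto simp: FA_simps)
  have "set (letters w) \<subseteq> G" if w: "w \<in> Poly_Mapping.keys (x * y)" for w
  proof -
    obtain a b where "w = a + b" "a \<in> Poly_Mapping.keys x" "b \<in> Poly_Mapping.keys y"
      using w keys_mult[of x y] by blast
    then show ?thesis using x y by (auto simp: FA_simps plus_word_def)
  qed
  then show "x * y \<in> carrier FA" by (simp add: FA_simps)
next
  show "set gs \<subseteq> G \<Longrightarrow> point (Word gs) \<in> carrier FA" by (simp add: FA_simps)
  show "0 \<in> carrier FA" by (simp add: FA_simps)
  show "Poly_Mapping.single 0 c \<in> carrier FA" for c by (simp add: FA_simps zero_word_def)
  from this[of 1] show "1 \<in> carrier FA" by simp
qed

lemma ring_FA: "ring FA"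
proof (rule ringI)
  show "abelian_group FA"
  proof (rule abelian_groupI)
    fix x assume "x \<in> carrier FA"
    then show "\<exists>y\<in>carrier FA. y \<oplus>\<^bsub>FA\<^esub> x = \<zero>\<^bsub>FA\<^esub>"
      by (intro bexI[of _ "- x"] FA_closed) (simp_all add: FA_simps(4,5))
  qed (simp_all only: FA_simps(2-6) FA_closed add.assoc add.commute add_0_left add_0_right add.left_commute)
  show "monoid FA"
    by (rule monoidI) (simp_all only: FA_simps(2-6) FA_closed mult.assoc mult_1_left mult_1_right)
qed (simp_all only: FA_simps(2-6) distrib_left distrib_right)

lemma subspace_FA: "pm.subspace (carrier FA)"
  by (rule pm.subspaceI) (simp_all only: FA_closed)

text \<open>
  The words of a polynomial are sorted by parity.
\<close>

lemma FA_decomp: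
  assumes "v \<in> carrier FA" shows "\<exists>v0\<in>homog FA 0. \<exists>v1\<in>homog FA 1. v = v0 + v1"
proof -
  let ?t = "\<lambda>w. scl (Poly_Mapping.lookup v w) (point w)"
  let ?K = "\<lambda>p. {w \<in> Poly_Mapping.keys v. sum_list (map par (letters w)) = p}"
  have h: "(\<Sum>w\<in>?K p. ?t w) \<in> homog FA p" for p
  proof -
    have "w \<in> ?K p" if "w \<in> Poly_Mapping.keys (\<Sum>w\<in>?K p. ?t w)" for w
    proof (rule ccontr)
      assume "w \<notin> ?K p"
      then have "(\<Sum>w'\<in>?K p. Poly_Mapping.lookup (?t w') w) = 0"
        by (intro sum.neutral ballI) (auto simp: lookup_single when_def)
      then show False using that[unfolded in_keys_iff[of w "sum _ _"] lookup_sum] by contradiction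
    qed
    moreover have "set (letters w) \<subseteq> G" if "w \<in> Poly_Mapping.keys v" for w
      using assms that by (simp add: FA_simps)
    ultimately show ?thesis unfolding FA_simps(7) by blast
  qed
  have "v = (\<Sum>w\<in>Poly_Mapping.keys v. ?t w)" by (rule poly_mapping_sum_points[symmetric]) simp_all
  also have "Poly_Mapping.keys v = ?K 0 \<union> ?K 1" by auto
  also have "(\<Sum>w\<in>?K 0 \<union> ?K 1. ?t w) = (\<Sum>w\<in>?K 0. ?t w) + (\<Sum>w\<in>?K 1. ?t w)"
    by (rule sum.union_disjoint) auto
  finally show ?thesis using h by blast
qed

end

lemma hgens_mem: "GenS i \<in> hgens d \<longleftrightarrow> i \<in> {1..<d}" "GenC i \<in> hgens d \<longleftrightarrow> i \<in> {1..d}"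
  "GenX \<in> hgens d \<longleftrightarrow> d \<ge> 1" "GenZ i \<in> hgens d \<longleftrightarrow> i \<le> d"
  by (auto simp: hgens_def)

lemma gens_carrier:
  "i \<in> {1..<d} \<Longrightarrow> sg i \<in> carrier (hfree d)" "i \<in> {1..d} \<Longrightarrow> cg i \<in> carrier (hfree d)"
  "d \<ge> 1 \<Longrightarrow> xg \<in> carrier (hfree d)" "i \<le> d \<Longrightarrow> zg i \<in> carrier (hfree d)"
  by (simp_all add: FA_closed(9) hgens_mem)

lemma hrel_carrier: "hrel d l r \<Longrightarrow> l - r \<in> carrier (hfree d)"
  by (cases rule: hrel.cases, assumption)
    (simp_all only:, (intro FA_closed(1-3,5,6) gens_carrier; simp)+)

lemma relators_carrier: "{l - r | l r. hrel d l r} \<subseteq> carrier (hfree d)"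
  using hrel_carrier by auto

lemma hideal_ideal: "ideal (hideal d) (hfree d)"
  unfolding hideal_def by (rule ring.genideal_ideal[OF ring_FA relators_carrier])

lemma pm_quot_hfree: "pm_quot (hfree d) (hideal d)"
proof
  interpret ideal "hideal d" "hfree d" by (rule hideal_ideal)
  show "pm.subspace (carrier (hfree d))" by (rule subspace_FA)
  show I: "hideal d \<subseteq> carrier (hfree d)" using a_subset .
  show "pm.subspace (hideal d)"
  proof (rule pm.subspaceI)
    show "0 \<in> hideal d" using additive_subgroup.zero_closed[OF additive_subgroup_axioms] by (simp only: FA_simps)
    show "x + y \<in> hideal d" if "x \<in> hideal d" "y \<in> hideal d" for x y
      using additive_subgroup.a_closed[OF additive_subgroup_axioms that] by (simp only: FA_simps)
    show "scl c x \<in> hideal d" if "x \<in> hideal d" for c x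
      using I_l_closed[OF that FA_closed(8), of c] by (simp only: FA_simps single0_mult)
  qed
qed (rule FA_simps)+

lemma qn_part_homog:
  "x \<in> qn_homog 0 \<Longrightarrow> qn_part 0 x = x" "x \<in> qn_homog 0 \<Longrightarrow> qn_part 1 x = 0"
  "x \<in> qn_homog 1 \<Longrightarrow> qn_part 0 x = 0" "x \<in> qn_homog 1 \<Longrightarrow> qn_part 1 x = x"
  by (auto simp: qn_homog_def qn_part_def vec_eq_iff forall_sum_type qmat_nth)

context tensor begin

section \<open>The action of the quotient superalgebra\<close>

interpretation hq: pm_quot "hfree d" "hideal d" by (rule pm_quot_hfree)

text \<open>
  The empty word is sent to \<open>u\<close>, the identity of the corner.
\<close>

fun word_op :: "hgen list \<Rightarrow> ('m, 'n, 'k) tensor_tuple linop" where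
  "word_op [] = u"
| "word_op (g # gs) = gen g * word_op gs"

lemma word_op_corner [simp, intro]: "word_op gs \<in> corner" by (induction gs) auto

lemma word_op_append: "word_op (as @ bs) = word_op as * word_op bs"
  by (induction as) (simp_all add: corner_u mult.assoc)

lemma equivariant_word_op: "set gs \<subseteq> hgens d \<Longrightarrow> equivariant (sum_list (map hgen_parity gs)) (word_op gs)"
  by (induction gs) (auto simp: equivariant_u intro!: equivariant_mult equivariant_gen)

definition eval_free :: "(hgen word \<Rightarrow>\<^sub>0 complex) \<Rightarrow> ('m, 'n, 'k) tensor_tuple linop" where
  "eval_free v = (\<Sum>w\<in>Poly_Mapping.keys v. scal (Poly_Mapping.lookup v w) * word_op (letters w))"

lemma eval_free_corner [simp, intro]: "eval_free v \<in> corner" by (auto simp: eval_free_def)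

lemma eval_free_superset:
  "finite S \<Longrightarrow> Poly_Mapping.keys v \<subseteq> S \<Longrightarrow> eval_free v = (\<Sum>w\<in>S. scal (Poly_Mapping.lookup v w) * word_op (letters w))"
  unfolding eval_free_def by (rule sum.mono_neutral_left) (auto simp: in_keys_iff scal_simps)

lemma eval_free_add: "eval_free (v + v') = eval_free v + eval_free v'"
proof -
  let ?S = "Poly_Mapping.keys v \<union> Poly_Mapping.keys v'"
  have "eval_free x = (\<Sum>w\<in>?S. scal (Poly_Mapping.lookup x w) * word_op (letters w))" if "x \<in> {v, v', v + v'}" for x
    using that Poly_Mapping.keys_add[of v v'] by (intro eval_free_superset) auto
  then show ?thesis
    by (simp add: lookup_add scal_simps distrib_right sum.distrib)
qed

lemma eval_free_scl: "eval_free (scl c v) = scal c * eval_free v"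
proof -
  have "eval_free (scl c v) = (\<Sum>w\<in>Poly_Mapping.keys v. scal (Poly_Mapping.lookup (scl c v) w) * word_op (letters w))"
    by (intro eval_free_superset) (auto simp: in_keys_iff)
  then show ?thesis
    by (simp add: eval_free_def scal_simps sum_distrib_left mult.assoc)
qed

lemma eval_free_0: "eval_free 0 = 0" by (simp add: eval_free_def)

lemma eval_free_neg: "eval_free (- v) = - eval_free v"
  using eval_free_scl[of "- 1" v] by (simp add: scl_minus_one scal_simps)

lemma eval_free_diff: "eval_free (v - v') = eval_free v - eval_free v'"
  using eval_free_add[of v "- v'"] by (simp add: eval_free_neg)

lemma eval_free_point: "eval_free (point w) = word_op (letters w)" by (simp add: eval_free_def scal_simps)

lemma eval_free_gen: "eval_free (point (Word [g])) = gen g"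
  by (simp add: eval_free_point corner_u)

lemma eval_free_1: "eval_free 1 = u"
  using eval_free_point[of 0] by (simp add: zero_word_def[symmetric]) (simp add: zero_word_def)

lemma eval_free_mult: "eval_free (v * v') = eval_free v * eval_free v'"
proof -
  have 1: "eval_free (point w * v') = eval_free (point w) * eval_free v'" for w
    using span_all_points[of v']
  proof (induction rule: pm.span_induct_alt)
    case (step c x y)
    then obtain w' where w: "x = point w'" by auto
    have "eval_free (point w * x) = eval_free (point w) * eval_free x"
      unfolding w mult_single by (simp add: eval_free_point plus_word_def word_op_append)
    moreover have "eval_free (point w) * (scal c * eval_free x) = scal c * (eval_free (point w) * eval_free x)"
      by (simp only: mult.assoc[symmetric] scal_commute)
    ultimately show ?case
      unfolding distrib_left scl_mult eval_free_add eval_free_scl step(2) by simp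
  qed (simp only: eval_free_0 mult_zero_right)
  show ?thesis
    using span_all_points[of v]
  proof (induction rule: pm.span_induct_alt)
    case (step c x y)
    then obtain w where w: "x = point w" by auto
    show ?case
      unfolding w distrib_right scl_mult eval_free_add eval_free_scl step(2) 1 by (simp only: mult.assoc)
  qed (simp only: eval_free_0 mult_zero_left)
qed

lemma tr_other: "r \<noteq> p \<Longrightarrow> r \<noteq> q \<Longrightarrow> tr p q r = r"
  by (simp add: Transposition.transpose_def)

text \<open>
  The correspondence of generators and positions is: $s_i$ swaps the positions $i+1$ and $i+2$, $c_i$ acts at
  $i+1$, and $\tilde x_1$ is $\Omega_{0,2}$.
\<close>

theorem eval_free_relation: "hrel d l r \<Longrightarrow> eval_free l = eval_free r"
proof (induction rule: hrel.induct)
  case (c_square i)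
  then show ?case by (simp add: eval_free_mult eval_free_neg eval_free_1 eval_free_gen alg.C_square)
next
  case (c_c i j)
  then show ?case using alg.anti_C_C[of "i + 1" "j + 1"]
      by (simp add: eval_free_mult eval_free_neg eval_free_gen anti_zero_iff)
next
  case (s_square i)
  then show ?case using alg.Sw_square[of "i + 1" "i + 2"] by (simp add: eval_free_mult eval_free_1 eval_free_gen)
next
  case (s_s i j)
  then have ne: "i \<noteq> j" "i \<noteq> j + 1" "j \<noteq> i + 1" by auto
  then show ?case using alg.Sw_mult_Sw[of "i + 1" "i + 2" "j + 1" "j + 2"] s_s(1,2)
    by (simp add: eval_free_mult eval_free_gen tr_other)
next
  case (braid i)
  then show ?case using alg.Sw_braid[of "i + 1" "i + 2" "i + 3"]
      by (simp add: eval_free_mult eval_free_gen numeral_3_eq_3)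
next
  case (s_c i j)
  then show ?case using alg.Sw_mult_C[of "i + 1" "i + 2" "j + 1"]
      by (simp add: eval_free_mult eval_free_gen tr_other)
next
  case (s_c_left i)
  then show ?case using alg.Sw_mult_C[of "i + 1" "i + 2" "i + 1"] by (simp add: eval_free_mult eval_free_gen)
next
  case (s_c_right i)
  then show ?case using alg.Sw_mult_C[of "i + 1" "i + 2" "i + 2"] by (simp add: eval_free_mult eval_free_gen)
next
  case (s_z i)
  then show ?case using Sw_Z[of i] by (simp add: eval_free_mult eval_free_gen eval_free_add eval_free_diff)
next
  case (x_s i)
  then show ?case using alg.Sw_mult_Om[of "i + 1" "i + 2" 0 2] by (simp add: eval_free_mult eval_free_gen tr_other)
next
  case (z_s i j)
  then show ?case using Sw_Z_far[of i j] by (simp add: eval_free_mult eval_free_gen)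
next
  case (c_x i)
  then show ?case using alg.anti_C_Om[of "i + 1" 0 2]
      by (simp add: eval_free_mult eval_free_neg eval_free_gen anti_zero_iff)
next
  case (c_z i j)
  then show ?case using anti_C_Z[of i j] by (simp add: eval_free_mult eval_free_neg eval_free_gen anti_zero_iff)
next
  case x_x
  have "eval_free (sg 1 * xg * sg 1 - (cg 1 - cg 2) * sg 1) = alg.Om 0 3 + alg.Om 2 3"
    using conjugate_x_eq[OF x_x] by (simp add: eval_free_mult eval_free_diff eval_free_gen numeral_2_eq_2 numeral_3_eq_3)
  moreover have "anti (alg.Om 0 2) (alg.Om 0 3 + alg.Om 2 3) = 0"
    using anti_Om_two[of 0 2 3] x_x by simp
  ultimately show ?case by (simp only: eval_free_mult eval_free_neg eval_free_gen gen.simps anti_zero_iff)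
next
  case z1_z2
  have "anti (alg.Om 0 2 + alg.Om 1 2) (Z 2) = 0"
    using anti_Om_Z[of 0 2 2] anti_Om_Z[of 1 2 2] z1_z2 by (simp add: anti_add)
  then show ?case by (simp only: eval_free_mult eval_free_neg eval_free_gen gen.simps anti_zero_iff Z_small)
next
  case z0_z1
  have "anti (alg.Om 0 1) (Z 1) = 0" using anti_Om_Z[of 0 1 1] z0_z1 by simp
  then show ?case by (simp only: eval_free_mult eval_free_neg eval_free_gen gen.simps anti_zero_iff Z_small(1))
next
  case z2_x
  have "anti (Z 2) (alg.Om 0 2) = 0" using anti_Om_Z[of 0 2 2] z2_x by (simp add: anti_swap)
  then show ?case by (simp only: eval_free_mult eval_free_neg eval_free_gen gen.simps anti_zero_iff)
next
  case z_x
  have "alg.Om 2 1 = - alg.Om 1 2" using alg.Om_swap[of 1 2] z_x by simp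
  \<comment> \<open>Antisymmetry turns $- \Omega_{N,1}$ into $\Omega_{1,N}$, so that invariance applies to the pair $M, V_1$.\<close>
  then have e: "Z 0 - Z 1 + alg.Om 0 2 = alg.Om 0 1 + alg.Om 2 1" unfolding Z_small by simp
  have "anti (Z 0 - Z 1 + alg.Om 0 2) (alg.Om 0 2) = 0"
    using anti_Om_two[of 0 2 1] z_x unfolding e by (simp add: anti_swap)
  then show ?case by (simp only: eval_free_mult eval_free_neg eval_free_gen eval_free_add eval_free_diff gen.simps anti_zero_iff)
qed

text \<open>
  The kernel of the evaluation is a two-sided ideal that contains the relators.
\<close>

lemma eval_free_hideal: assumes "v \<in> hideal d" shows "eval_free v = 0"
proof -
  let ?K = "{v \<in> carrier (hfree d). eval_free v = 0}"
  interpret ring "hfree d" by (rule ring_FA)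
  have neg: "inv\<^bsub>add_monoid (hfree d)\<^esub> x = - x" if "x \<in> carrier (hfree d)" for x
  proof -
    have "\<ominus>\<^bsub>hfree d\<^esub> x = - x"
      using that FA_closed(3)[OF that] by (intro minus_equality) (simp_all add: FA_simps(4,5))
    then show ?thesis by (simp add: a_inv_def)
  qed
  \<comment> \<open>The ideal is generated by the relators, so it suffices to compare it with the kernel.\<close>
  have "ideal ?K (hfree d)"
  proof (rule idealI[OF ring_FA])
    show "subgroup ?K (add_monoid (hfree d))"
    proof (rule subgroup.intro)
      show "inv\<^bsub>add_monoid (hfree d)\<^esub> x \<in> ?K" if "x \<in> ?K" for x
        using that by (simp add: neg FA_closed(3) eval_free_neg)
      show "x \<otimes>\<^bsub>add_monoid (hfree d)\<^esub> y \<in> ?K" if "x \<in> ?K" "y \<in> ?K" for x y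
        using that FA_closed(1)[of x "hgens d" hgen_parity y] by (simp add: FA_simps(5) eval_free_add)
      show "\<one>\<^bsub>add_monoid (hfree d)\<^esub> \<in> ?K" by (simp add: FA_simps(4) FA_closed(4) eval_free_0)
    qed auto
  next
    fix a x assume "a \<in> ?K" "x \<in> carrier (hfree d)"
    then show "x \<otimes>\<^bsub>hfree d\<^esub> a \<in> ?K" "a \<otimes>\<^bsub>hfree d\<^esub> x \<in> ?K"
      by (simp_all add: FA_simps(2) FA_closed(6) eval_free_mult)
  qed
  moreover have "{l - r | l r. hrel d l r} \<subseteq> ?K"
    using hrel_carrier eval_free_relation by (auto simp: eval_free_diff)
  ultimately have "hideal d \<subseteq> ?K" unfolding hideal_def by (rule genideal_minimal)
  then show ?thesis using assms by auto
qed

definition H_action :: "(hgen word \<Rightarrow>\<^sub>0 complex) set \<Rightarrow> ('k, 'm, 'n) tens \<Rightarrow> ('k, 'm, 'n) tens" where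
  "H_action X = induced (eval_free (SOME v. v \<in> X))"

lemma hclass_cls: "hclass d v = hq.cls v" by (simp add: hclass_def hq.cls_def)

lemma H_action_class: "H_action (hclass d v) = induced (eval_free v)"
proof -
  have "(SOME v'. v' \<in> hq.cls v) \<in> hq.cls v" using hq.self_in_cls by (rule someI)
  then have "eval_free ((SOME v'. v' \<in> hq.cls v) - v) = 0" by (intro eval_free_hideal) (simp add: hq.cls_mem)
  then show ?thesis by (simp add: H_action_def hclass_cls eval_free_diff)
qed

lemma H_simps: "carrier (H_alg d) = hclass d ` carrier (hfree d)" "\<one>\<^bsub>H_alg d\<^esub> = hclass d 1"
  "hclass d v \<oplus>\<^bsub>H_alg d\<^esub> hclass d v' = hclass d (v + v')"
  "c \<odot>\<^bsub>H_alg d\<^esub> hclass d v = hclass d (scl c v)"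
  "homog (H_alg d) p = hclass d ` homog (hfree d) p"
proof -
  have s: "carrier (H_alg d) = carrier hq.Q" "\<one>\<^bsub>H_alg d\<^esub> = \<one>\<^bsub>hq.Q\<^esub>" "add (H_alg d)
      = add hq.Q" "smult (H_alg d) = smult hq.Q"
    by (simp_all add: H_alg_def module.defs)
  have h: "hclass d = hq.cls" by (rule ext) (rule hclass_cls)
  show "carrier (H_alg d) = hclass d ` carrier (hfree d)" unfolding s h hq.carrier_Q ..
  show "\<one>\<^bsub>H_alg d\<^esub> = hclass d 1" unfolding s h hq.one_Q FA_simps(3) ..
  show "hclass d v \<oplus>\<^bsub>H_alg d\<^esub> hclass d v' = hclass d (v + v')" unfolding s h hq.add_Q ..
  show "c \<odot>\<^bsub>H_alg d\<^esub> hclass d v = hclass d (scl c v)" unfolding s h hq.smult_Q ..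
  show "homog (H_alg d) p = hclass d ` homog (hfree d) p"
    by (simp add: H_alg_def module.defs superspace.defs)
qed

lemma H_mult:
  assumes "v \<in> carrier (hfree d)" "v' \<in> carrier (hfree d)"
  shows "hclass d v \<otimes>\<^bsub>H_alg d\<^esub> hclass d v' = hclass d (v * v')"
proof -
  have "hclass d v \<otimes>\<^bsub>H_alg d\<^esub> hclass d v' = rcoset_mult (hfree d) (hideal d) (hclass d v) (hclass d v')"
    by (simp add: H_alg_def module.defs quot_module_def ring.defs FactRing_def)
  then show ?thesis
    unfolding hclass_def ideal.rcoset_mult_add[OF hideal_ideal assms] FA_simps(2) .
qed

lemma equivariant_eval_free: assumes "v \<in> homog (hfree d) p" shows "equivariant p (eval_free v)"
  unfolding eval_free_def
proof (rule equivariant_sum, rule equivariant_scal)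
  fix w assume "w \<in> Poly_Mapping.keys v"
  then have "set (letters w) \<subseteq> hgens d" "sum_list (map hgen_parity (letters w)) = p"
    using assms by (auto simp: FA_simps)
  then show "equivariant p (word_op (letters w))" using equivariant_word_op by blast
qed

lemma equivariant_induced_homog: assumes "equivariant t z" shows "induced z \<in> homog (End_super TM) t"
proof -
  have z: "z \<in> corner" and Pi: "Pi_op * z = ksign t * (z * Pi_op)" using assms by (simp_all add: equivariant_def)
  have "induced z X \<in> homog TS (t + q)" if X: "X \<in> homog TS q" for q X
  proof -
    obtain y where y: "X = cls y" "y \<in> graded_part q" using X unfolding homog_TS by blast
    have "ap Pi_op (ap z y) = ap (scal (psign t) * (z * Pi_op)) y"
      unfolding scal_psign Pi[symmetric] by simp
    also have "\<dots> = scl (psign t) (ap z (ap Pi_op y))" by simp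
    also have "ap Pi_op y = scl (psign q) y" using y(2) by (simp add: graded_part_iff)
    finally have "ap Pi_op (ap z y) = scl (psign (t + q)) (ap z y)"
      unfolding ap_lin(2) pm.scale_scale psign_add .
    then have "ap z y \<in> graded_part (t + q)" unfolding graded_part_iff using ap_corner(2)[OF z] by simp
    then show ?thesis unfolding homog_TS y(1) induced_cls[OF z graded_part_FS[OF y(2)]] by (rule imageI)
  qed
  then show ?thesis unfolding End_simps using induced_linear[OF z] by blast
qed

text \<open>
  The action is defined through both homogeneous parts; on a homogeneous element the other part is
  zero.
\<close>

lemma act_TM: assumes "x \<in> qn_homog q" "y \<in> carrier FS" shows "act TM x (cls y) = cls (ap (total_act q x) y)"
proof -
  have DD0: "total_act t 0 = 0" for t by (simp add: total_act_def slot_act_0)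
  have 0: "tensor_act M N d t 0 (cls y) = cls 0" for t
    by (simp add: tensor_act_eq qn_closed(1) DD0 induced_cls[OF _ assms(2)])
  have x: "tensor_act M N d q x (cls y) = cls (ap (total_act q x) y)"
    by (simp add: tensor_act_eq qn_closed(4)[OF assms(1)] induced_cls[OF _ assms(2)])
  show ?thesis
  proof (cases "q = 0")
    case True
    then show ?thesis using assms(1) 0 x by (simp add: TM_simps qn_part_homog add_Q)
  next
    case False
    then have "q = 1" by simp
    then show ?thesis using assms(1) 0 x by (simp add: TM_simps qn_part_homog add_Q)
  qed
qed

lemma equivariant_induced_supercommutes: assumes "equivariant t z" shows "supercommutes TM t (induced z)"
  unfolding supercommutes_def TM_simps(4,5)
proof (intro allI ballI)
  fix q r w and x :: "'k mat2" assume x: "x \<in> qn_homog q" and "w \<in> homog TS r"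
  then obtain y where y: "w = cls y" "y \<in> graded_part r" unfolding homog_TS by blast
  note yc = graded_part_FS[OF y(2)]
  have z: "z \<in> corner" and D: "z * total_act q x = scal (psign (t * q)) * (total_act q x * z)"
    using assms x by (simp_all add: equivariant_def scal_psign)
  have "induced z (act TM x w) = cls (ap (z * total_act q x) y)"
    unfolding y(1) act_TM[OF x yc] induced_cls[OF z ap_corner(1)[OF total_act_corner]] by simp
  also have "\<dots> = psign (q * t) \<odot>\<^bsub>Q\<^esub> act TM x (induced z w)"
    unfolding D y(1) induced_cls[OF z yc] act_TM[OF x ap_corner(1)[OF z]] smult_Q
        by (simp add: mult.commute[of q t])
  finally show "induced z (act TM x w) = psign (q * t) \<odot>\<^bsub>Q\<^esub> act TM x (induced z w)" .
qed

lemma H_action_hom: "superalg_hom (H_alg d) (End_super TM) H_action"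
proof -
  have "H_action \<in> ring_hom (H_alg d) (End_super TM)"
  proof (rule ring_hom_memI)
    fix x y assume "x \<in> carrier (H_alg d)" "y \<in> carrier (H_alg d)"
    then obtain v v' where v: "x = hclass d v" "v \<in> carrier (hfree d)" "y = hclass d v'" "v' \<in> carrier (hfree d)"
      unfolding H_simps by blast
    show "H_action (x \<otimes>\<^bsub>H_alg d\<^esub> y) = H_action x \<otimes>\<^bsub>End_super TM\<^esub> H_action y"
      unfolding v(1,3) H_mult[OF v(2,4)] H_action_class induced_mult[OF eval_free_corner eval_free_corner] eval_free_mult ..
    show "H_action (x \<oplus>\<^bsub>H_alg d\<^esub> y) = H_action x \<oplus>\<^bsub>End_super TM\<^esub> H_action y"
      unfolding v(1,3) H_simps H_action_class induced_add[OF eval_free_corner eval_free_corner] eval_free_add ..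
  next
    fix x assume "x \<in> carrier (H_alg d)"
    then obtain v where v: "x = hclass d v" unfolding H_simps by blast
    show "H_action x \<in> carrier (End_super TM)" unfolding v H_action_class End_simps by (rule induced_linear) simp
  next
    show "H_action \<one>\<^bsub>H_alg d\<^esub> = \<one>\<^bsub>End_super TM\<^esub>" unfolding H_simps H_action_class eval_free_1 induced_one ..
  qed
  moreover have "H_action (c \<odot>\<^bsub>H_alg d\<^esub> x) = c \<odot>\<^bsub>End_super TM\<^esub> H_action x" if x: "x \<in> carrier (H_alg d)" for c x
  proof -
    obtain v where v: "x = hclass d v" using x unfolding H_simps by blast
    show ?thesis unfolding v H_simps H_action_class induced_smult[OF eval_free_corner] eval_free_scl ..
  qed
  moreover have "H_action ` homog (H_alg d) p \<subseteq> homog (End_super TM) p" for p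
    unfolding H_simps(5) using equivariant_induced_homog[OF equivariant_eval_free] by (auto simp: H_action_class)
  ultimately show ?thesis unfolding superalg_hom_def by blast
qed

lemma H_action_supercommutes: "h \<in> homog (H_alg d) p \<Longrightarrow> supercommutes TM p (H_action h)"
  unfolding H_simps(5) using equivariant_induced_supercommutes[OF equivariant_eval_free]
      by (auto simp: H_action_class)

text \<open>
  An element of $\mathcal H_d$ is the sum of two homogeneous ones, and these act by homogeneous
  endomorphisms that supercommute with $\mathfrak q(n)$.
\<close>

lemma H_action_hom_End_q: "superalg_hom (H_alg d) (End_q TM) H_action"
proof -
  let ?S = "lin_span (End_super TM) {g. \<exists>p. g \<in> homog (End_super TM) p \<and> supercommutes TM p g}"
  have gen: "induced (eval_free v) \<in> {g. \<exists>p. g \<in> homog (End_super TM) p \<and> supercommutes TM p g}"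
      if "v \<in> homog (hfree d) p" for v p
    using equivariant_induced_homog[OF equivariant_eval_free[OF that]] equivariant_induced_supercommutes[OF equivariant_eval_free[OF that]] by blast
  have S: "H_action x \<in> ?S" if x: "x \<in> carrier (H_alg d)" for x
  proof -
    obtain v where v: "x = hclass d v" "v \<in> carrier (hfree d)" using x unfolding H_simps by blast
    obtain v0 v1 where v01: "v0 \<in> homog (hfree d) 0" "v1 \<in> homog (hfree d) 1" "v = v0 + v1"
      using FA_decomp[OF v(2)] by blast
    have H_action: "H_action x = induced (eval_free v0) \<oplus>\<^bsub>End_super TM\<^esub> induced (eval_free v1)"
      unfolding v(1) H_action_class v01(3) eval_free_add induced_add[OF eval_free_corner eval_free_corner] ..
    have "H_action x \<in> H" if H: "submodule H complex_ring (End_super TM)"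
        "{g. \<exists>p. g \<in> homog (End_super TM) p \<and> supercommutes TM p g} \<subseteq> H" for H
    proof -
      have "induced (eval_free v0) \<in> H" "induced (eval_free v1) \<in> H" using H(2) gen v01 by blast+
      then show ?thesis
        unfolding H_action using subgroup.m_closed[OF submodule.axioms(1)[OF H(1)]] by simp
    qed
    then show ?thesis unfolding lin_span_def by blast
  qed
  have E: "carrier (End_q TM) = ?S" "monoid.mult (End_q TM) = monoid.mult (End_super TM)" "one (End_q TM)
      = one (End_super TM)"
    "add (End_q TM) = add (End_super TM)" "smult (End_q TM) = smult (End_super TM)"
    "homog (End_q TM) p = homog (End_super TM) p \<inter> ?S" for p
    by (simp_all add: End_q_def Let_def)
  note hom = H_action_hom[unfolded superalg_hom_def ring_hom_def mem_Collect_eq]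
  have hc: "homog (H_alg d) p \<subseteq> carrier (H_alg d)" for p
    unfolding H_simps by (rule image_mono) (auto simp: FA_simps)
  show ?thesis
    unfolding superalg_hom_def ring_hom_def mem_Collect_eq E
  proof (intro conjI)
    show "H_action \<in> carrier (H_alg d) \<rightarrow> ?S" using S by (rule Pi_I)
    show "\<forall>p. H_action ` homog (H_alg d) p \<subseteq> homog (End_super TM) p \<inter> ?S"
      using hom[THEN conjunct2, THEN conjunct2] S hc by blast
  qed (insert hom, (elim conjE, assumption)+)
qed

lemma H_action_Z:
  assumes "i \<in> {1..d}"
  shows "H_action (hclass d (zg i)) = Omega_op M N d FactorM (FactorV i)
       \<oplus>\<^bsub>End_super TM\<^esub> Omega_op M N d FactorN (FactorV i)
       \<oplus>\<^bsub>End_super TM\<^esub> (\<Oplus>\<^bsub>End_super TM\<^esub>k\<in>{1..<i}. Omega_op M N d (FactorV k) (FactorV i))"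
proof -
  interpret En: abelian_monoid "End_super TM" by (rule End_abelian_monoid)
  have MN: "Omega_op M N d FactorM (FactorV i) = induced (alg.Om 0 (i + 1))"
    "Omega_op M N d FactorN (FactorV i) = induced (alg.Om 1 (i + 1))"
    using assms by (subst Omega_op_eq; auto simp: factors_def)+
  have V: "Omega_op M N d (FactorV k) (FactorV i) = induced (alg.Om (k + 1) (i + 1))" if "k \<in> {1..<i}" for k
    using assms that by (subst Omega_op_eq; auto simp: factors_def)
  have "(\<Oplus>\<^bsub>End_super TM\<^esub>k\<in>{1..<i}. Omega_op M N d (FactorV k) (FactorV i))
      = (\<Oplus>\<^bsub>End_super TM\<^esub>k\<in>{1..<i}. induced (alg.Om (k + 1) (i + 1)))"
    by (rule En.finsum_cong'[OF refl]) (auto simp: V End_simps(1) intro!: induced_linear)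
  also have "\<dots> = induced (\<Sum>k\<in>{1..<i}. alg.Om (k + 1) (i + 1))"
    by (rule induced_finsum) auto
  finally have sum: "(\<Oplus>\<^bsub>End_super TM\<^esub>k\<in>{1..<i}. Omega_op M N d (FactorV k) (FactorV i)) = \<dots>" .
  have "Z i = alg.Om 0 (i + 1) + alg.Om 1 (i + 1) + (\<Sum>k\<in>{1..<i}. alg.Om (k + 1) (i + 1))"
  proof -
    have "{..<i + 1} = insert 0 (insert 1 {1 + 1..<i + 1})" using assms by auto
    then have "Z i = alg.Om 0 (i + 1) + (alg.Om 1 (i + 1) + (\<Sum>r\<in>{1 + 1..<i + 1}. alg.Om r (i + 1)))"
      unfolding Z_def by (simp del: sum.op_ivl_Suc)
    then show ?thesis
      unfolding sum.shift_bounds_nat_ivl by (simp only: add.assoc)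
  qed
  then show ?thesis
    unfolding MN sum H_action_class eval_free_gen gen.simps by (simp add: induced_add)
qed

end

theorem theorem1p1:
  fixes M :: "(('k::finite) mat2, 'm) qmodule"
    and N :: "('k mat2, 'n) qmodule"
    and d :: nat
  assumes "q_module M" and "q_module N"
  shows "\<exists>\<phi>.
    superalg_hom (H_alg d) (End_super (tensor_module M N d)) \<phi> \<and>
    (\<forall>i\<in>{1..<d}. \<phi> (hclass d (sg i)) = swap_op M N d i) \<and>
    (\<forall>i\<in>{1..d}. \<phi> (hclass d (cg i)) = C_op M N d i) \<and>
    (d \<ge> 1 \<longrightarrow> \<phi> (hclass d xg) = Omega_op M N d FactorM (FactorV 1)) \<and>
    \<phi> (hclass d (zg 0)) = Omega_op M N d FactorM FactorN \<and>
    (\<forall>i\<in>{1..d}. \<phi> (hclass d (zg i)) =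
       Omega_op M N d FactorM (FactorV i)
       \<oplus>\<^bsub>End_super (tensor_module M N d)\<^esub> Omega_op M N d FactorN (FactorV i)
       \<oplus>\<^bsub>End_super (tensor_module M N d)\<^esub>
         (\<Oplus>\<^bsub>End_super (tensor_module M N d)\<^esub>k\<in>{1..<i}. Omega_op M N d (FactorV k) (FactorV i))) \<and>
    (\<forall>p. \<forall>h\<in>homog (H_alg d) p. supercommutes (tensor_module M N d) p (\<phi> h)) \<and>
    superalg_hom (H_alg d) (End_q (tensor_module M N d)) \<phi>"
proof -
  interpret tensor M N d using assms by unfold_locales
  show ?thesis
  proof (intro exI[of _ H_action] conjI ballI allI impI)
    show "superalg_hom (H_alg d) (End_super (tensor_module M N d)) H_action" by (rule H_action_hom)
    show "superalg_hom (H_alg d) (End_q (tensor_module M N d)) H_action" by (rule H_action_hom_End_q)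
    show "H_action (hclass d (sg i)) = swap_op M N d i" if "i \<in> {1..<d}" for i
      unfolding H_action_class eval_free_gen gen.simps swap_op_eq[OF that] ..
    show "H_action (hclass d (cg i)) = C_op M N d i" if "i \<in> {1..d}" for i
      unfolding H_action_class eval_free_gen gen.simps C_op_eq[OF that] ..
    show "H_action (hclass d xg) = Omega_op M N d FactorM (FactorV 1)" if "d \<ge> 1"
      unfolding H_action_class eval_free_gen gen.simps using that
          by (subst Omega_op_eq) (auto simp: factors_def numeral_2_eq_2)
    show "H_action (hclass d (zg 0)) = Omega_op M N d FactorM FactorN"
      unfolding H_action_class eval_free_gen gen.simps Z_small by (subst Omega_op_eq) (auto simp: factors_def)
  qed (rule H_action_Z H_action_supercommutes, assumption)+
qed

end
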